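(* Let $(\tau,Z)$ be a nominal impulse policy with corresponding family of probability spaces $\{(\check\Omega,\check{\mathcal F},\mathbb P_x^{(\tau,Z)}):x\in\mathcal E\}$ and let $\nu$ be a probability measure on $(\mathcal E,\mathcal B(\mathcal E))$. Define $\mathbb P_\nu^{(\tau,Z)}(F)=\int_{\mathcal E}\mathbb P_x^{(\tau,Z)}(F)\,\nu(dx)$ for each $F\in\check{\mathcal F}$. Then under $\mathbb P_\nu^{(\tau,Z)}$ the coordinate process $X$ on $(\check\Omega,\check{\mathcal F})$ is such that $X(0-)$ has distribution $\nu$ and, with $\tau_0=0$ and $Y_k=X(\tau_k-)$, for each $k\in\mathbb N$: (i) $X$ is the fundamental Markov process on the interval $[\tau_{k-1},\tau_k)$; (ii) on the set $\{\tau_k<\infty\}$, $Q_{(Y_k,Z_k)}$ is a regular conditional distribution of $X(\tau_k)$ given $\mathcal F_{\tau_k-}$ (given $\check{\mathcal F}_{\tau_1-}$ when $k=1$).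
   Context: Setting. $\mathcal E$ is a complete separable metric space, $\Omega=D_{\mathcal E}[0,\infty)$ is the space of càdlàg functions, $X(t,\omega)=\omega(t)$ is the coordinate process, $\mathcal F=\sigma(X(t):t\ge0)$, $\mathcal F_t=\sigma(X(s):0\le s\le t)$, $\mathcal F_{t-}=\sigma(X(s):0\le s<t)$ for $t>0$ and $\mathcal F_{0-}=\{\emptyset,\Omega\}$. $\{\mathbb P_x:x\in\mathcal E\}$ is a family of probability measures on $(\Omega,\mathcal F)$ such that $(\Omega,\mathcal F,X,\{\mathcal F_t\},\{\mathbb P_x\})$ is a Markov family: (1) for each $F\in\mathcal F$, $x\mapsto\mathbb P_x(F)$ is universally measurable; (2) $\mathbb P_x(X(0)=x)=1$; (3) $\mathbb P_x(X(s+t)\in B\mid\mathcal F_s)=\mathbb P_x(X(s+t)\in B\mid X(s))$ $\mathbb P_x$-a.s.; (4) $\mathbb P_x(X(s+t)\in B\mid X(s)=y)=\mathbb P_y(X(t)\in B)$ for $\mathbb P_xX(s)^{-1}$-a.e. $y$; for all $x\in\mathcal E$, $s,t\ge0$, $B\in\mathcal B(\mathcal E)$. Each $\mathbb P_x$ is supported in $C_{\mathcal E}[0,\infty)$. Under $\{\mathbb P_x\}$, $X$ is called the fundamental Markov process. Augmented space. $\check\Omega=\mathcal E\times\Omega$, $\check{\mathcal F}=\mathcal B(\mathcal E)\otimes\mathcal F$; elements are $\check\omega=(\check\omega(0-),\check\omega(\cdot))$; $X(0-,\check\omega)=\check\omega(0-)$, $X(t,\check\omega)=\check\omega(t)$ for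 $t\ge0$; $\check{\mathcal F}_t=\mathcal B(\mathcal E)\otimes\mathcal F_t$, $\check{\mathcal F}_{t-}=\mathcal B(\mathcal E)\otimes\mathcal F_{t-}$. $\check{\mathbb P}_x=\delta_x\otimes\mathbb P_x$. Functions and events on $\Omega$ are regarded as functions and events on $\check\Omega$ through the projection $\check\omega\mapsto\check\omega(\cdot)$. Impulse mechanism. $(\mathcal Z,\mathfrak Z)$ is a measurable space and $\{Q_{(y,z)}:(y,z)\in\mathcal E\times\mathcal Z\}$ is a family of probability measures on $\mathcal E$ such that $(y,z)\mapsto Q_{(y,z)}(\Gamma)$ is $\mathcal B(\mathcal E)\otimes\mathfrak Z$-measurable for each $\Gamma\in\mathcal B(\mathcal E)$. For an $\{\mathcal F_{t-}\}$-stopping time $\eta$ (i.e. $\{\eta\le t\}\in\mathcal F_{t-}$ for all $t\ge 0$), $\mathcal F_{\eta-}=\sigma(\{A\cap\{\eta>t\}:A\in\mathcal F_{t-},t\ge0\})$. For an $\{\check{\mathcal F}_{t-}\}$-stopping time $\eta$, $\check{\mathcal F}_{\eta-}$ is the $\sigma$-algebra generated by $X(0-)$ and the sets $A\cap\{\eta>t\}$, $A\in\check{\mathcal F}_{t-}$, $t\ge0$. Nominal impulse policy. A sequence $(\tau,Z)=\{(\tau_k,Z_k):k\in\mathbb N\}$ on $(\check\Omega,\check{\mathcal F})$ with: $\tau_1$ an $\{\check{\mathcal F}_{t-}\}$-stopping time and, for $k\ge2$, $\tau_k$ an $\{\mathcal F_{t-}\}$-stopping time; $\tau_{k+1}>\tau_k$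 on $\{\tau_k<\infty\}$ for each $k\in\mathbb N$; $\lim_{k\to\infty}\tau_k=\infty$; and $Z_k$ a $\mathcal Z$-valued random variable that is $\mathcal F_{\tau_k-}/\mathfrak Z$-measurable ($\check{\mathcal F}_{\tau_1-}/\mathfrak Z$-measurable for $k=1$). $Z_k$ is relevant only on $\{\tau_k<\infty\}$. The measures $\mathbb P_x^{(\tau,Z)}$. Fix arbitrary $\bar e\in\mathcal E$, $\bar z\in\mathcal Z$. Let $\Omega_0=\check\Omega$, $\Omega_k=\Omega$ for $k\ge1$, with $\sigma$-algebras $\mathscr F_0=\check{\mathcal F}$, $\mathscr F_k=\mathcal F$, coordinate processes $X_k$; $\widetilde\Omega=\prod_{k\ge0}\Omega_k$, $\widetilde{\mathcal G}=\bigotimes_{k\ge0}\mathscr F_k$; $\mathbf e_k=(\omega_0,\dots,\omega_k)$. Put $\widetilde\tau_0=0$, $\bar\omega_0=\omega_0$ and recursively, for $k\ge0$, $\widetilde\tau_{k+1}(\mathbf e_k)=\tau_{k+1}(\bar\omega_k)$, where for $k\ge1$ $\bar\omega_k\in\check\Omega$ is the pasted path with $\bar\omega_k(0-)=\omega_0(0-)$, $\bar\omega_k(t)=\omega_i(t-\widetilde\tau_i)$ for $\widetilde\tau_i\le t<\widetilde\tau_{i+1}$, $i\le k-1$, and $\bar\omega_k(t)=\omega_k(t-\widetilde\tau_k)$ for $t\ge\widetilde\tau_k$. On $\{\widetilde\tau_{k+1}<\infty\}$ let $\widetilde Z_{k+1}(\mathbf e_k)=Z_{k+1}(\bar\omega_k)$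 and $\widetilde Y_{k+1}(\mathbf e_k)=\bar\omega_k(\widetilde\tau_{k+1}-)$; on $\{\widetilde\tau_{k+1}=\infty\}$ let them be $\bar z$ and $\bar e$. Let $Q_{k+1}(\mathbf e_k,\cdot)=Q_{(\widetilde Y_{k+1},\widetilde Z_{k+1})}$ if $\widetilde\tau_{k+1}(\mathbf e_k)<\infty$ and $\delta_{\bar e}$ otherwise, and $P_{k+1}(\mathbf e_k,\cdot)=\int_{\mathcal E}\mathbb P_v(\cdot)\,Q_{k+1}(\mathbf e_k,dv)$. $\widetilde{\mathbb P}_x$ is the probability measure on $(\widetilde\Omega,\widetilde{\mathcal G})$ with initial law $\check{\mathbb P}_x$ on $\Omega_0$ and successive transition kernels $P_1,P_2,\dots$ (Ionescu Tulcea). $\widetilde X(0-)=\omega_0(0-)$, $\widetilde X(t)=X_k(t-\widetilde\tau_k)$ for $\widetilde\tau_k\le t<\widetilde\tau_{k+1}$, $k\ge 0$, and $\mathbb P_x^{(\tau,Z)}=\widetilde{\mathbb P}_x\widetilde X^{-1}$ is the law of $\widetilde X$ on $(\check\Omega,\check{\mathcal F})$; $x\mapsto\mathbb P_x^{(\tau,Z)}(F)$ is universally measurable. Meaning of "(i)". For $\check\omega\in\check\Omega$, $\omega\in\Omega$ and $r\ge0$, let $\check\omega\otimes_r\omega\in\check\Omega$ have $(\check\omega\otimes_r\omega)(0-)=\check\omega(0-)$, $(\check\omega\otimes_r\omega)(t)=\check\omega(t)$ for $0\le t<r$ and $=\omega(t-r)$ for $t\ge r$. "$X$ is the fundamental Markov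 process on $[\tau_{k-1},\tau_k)$" under a probability measure $P$ on $(\check\Omega,\check{\mathcal F})$ means the following, for all $n\ge1$, $0\le t_1<\dots<t_n$ and $B_1,\dots,B_n\in\mathcal B(\mathcal E)$. For $k=1$: $P(\tau_1>t_n,X(t_i)\in B_i,1\le i\le n\mid X(0-))=\check{\mathbb P}_{X(0-)}(\tau_1>t_n,X(t_i)\in B_i,1\le i\le n)$ $P$-a.s. For $k\ge2$: $P$-a.s. on $\{\tau_{k-1}<\infty\}$, the conditional probability of $\{\tau_k-\tau_{k-1}>t_n,\ X(\tau_{k-1}+t_i)\in B_i,\ 1\le i\le n\}$ given $\sigma(X(0-))\vee\mathcal G\vee\sigma(X(\tau_{k-1}))$, where $\mathcal G=\mathcal F_{\tau_{k-1}-}$ (or $\check{\mathcal F}_{\tau_1-}$ if $k=2$), at $\check\omega$ equals $\mathbb P_{\check\omega(\tau_{k-1})}\{\omega\in\Omega:\tau_k(\check\omega\otimes_{\tau_{k-1}(\check\omega)}\omega)-\tau_{k-1}(\check\omega)>t_n,\ \omega(t_i)\in B_i,\ 1\le i\le n\}$.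
   Formalization: Added so that X̃ and its law are defined: for each x the intervention times τ̃_k tend to ∞ P̃_x-a.s. (τ_k→∞ on càdlàg paths does not imply this), and τ_{k+1}=∞ wherever τ_k=∞ (otherwise pieces of X̃ overlap). *)

theory Defs
  imports "HOL-Probability.Probability"
begin

section \<open>Path space\<close>

text \<open>The space \<open>\<Omega>\<close> of cadlag functions on \<open>[0,\<infinity>)\<close>. A path is a function on the reals
  that is \<open>undefined\<close> at negative times, so that paths correspond to functions on \<open>[0,\<infinity>)\<close>.\<close>

type_synonym 'e path = "real \<Rightarrow> 'e"

definition cadlag_paths :: "'e::polish_space path set" where
  "cadlag_paths = {\<omega> \<in> extensional {0..}.
     (\<forall>t\<ge>0. (\<omega> \<longlongrightarrow> \<omega> t) (at_right t)) \<and> (\<forall>t>0. \<exists>l. (\<omega> \<longlongrightarrow> l) (at_left t))}"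

text \<open>\<open>\<sigma>(X(s) : s \<in> T)\<close>\<close>

definition path_sigma :: "real set \<Rightarrow> 'e::polish_space path measure" where
  "path_sigma T = sigma cadlag_paths {{\<omega> \<in> cadlag_paths. \<omega> s \<in> B} | s B. s \<in> T \<and> B \<in> sets borel}"

definition path_space :: "'e::polish_space path measure" where
  "path_space = path_sigma {0..}"

text \<open>\<open>\<F>\<^sub>t\<^sub>-\<close>, indexed by extended times in order to use the library's stopping times with values in
  \<open>[0,\<infinity>]\<close>. The instance \<open>t = \<infinity>\<close> of the stopping time condition is void.
  For \<open>t = 0\<close> there is no generator, so the \<open>\<sigma>\<close>-algebra is trivial.\<close>

definition left_filtration :: "ennreal \<Rightarrow> 'e::polish_space path measure" where
  "left_filtration t = path_sigma {s. 0 \<le> s \<and> ennreal s < t}"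

text \<open>An element of the augmented space is a pair of the value at \<open>0-\<close> and a path.\<close>

definition aug_space :: "('e::polish_space \<times> 'e path) measure" where
  "aug_space = borel \<Otimes>\<^sub>M path_space"

definition aug_left_filtration :: "ennreal \<Rightarrow> ('e::polish_space \<times> 'e path) measure" where
  "aug_left_filtration t = borel \<Otimes>\<^sub>M left_filtration t"

text \<open>\<open>\<F>\<^sub>t\<^sub>-\<close> regarded as a \<open>\<sigma>\<close>-algebra on the augmented space.\<close>

definition lifted_left_filtration :: "ennreal \<Rightarrow> ('e::polish_space \<times> 'e path) measure" where
  "lifted_left_filtration t = vimage_algebra (space aug_space) snd (left_filtration t)"

definition left_limit :: "'e::polish_space \<times> 'e path \<Rightarrow> ennreal \<Rightarrow> 'e" where
  "left_limit \<omega> t = (if t = 0 then fst \<omega> else Lim (at_left (enn2real t)) (snd \<omega>))"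

section \<open>The fundamental Markov family\<close>

definition universally_measurable :: "'a measure \<Rightarrow> ('a \<Rightarrow> ennreal) \<Rightarrow> bool" where
  "universally_measurable M f \<longleftrightarrow>
     (\<forall>\<mu>. prob_space \<mu> \<longrightarrow> sets \<mu> = sets M \<longrightarrow> f \<in> borel_measurable (completion \<mu>))"

text \<open>The conditional probability of \<open>A\<close> given \<open>Y = y\<close>, as a function of \<open>y\<close>: the density of
  \<open>B \<mapsto> M (A \<inter> {Y \<in> B})\<close> with respect to the distribution of \<open>Y\<close>.\<close>

definition cond_prob_at :: "'a measure \<Rightarrow> 'a set \<Rightarrow> ('a \<Rightarrow> 'b) \<Rightarrow> 'b measure \<Rightarrow> 'b \<Rightarrow> ennreal" where
  "cond_prob_at M A Y N = RN_deriv (distr M N Y) (distr (density M (indicator A)) N Y)"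

definition markov_family :: "('e::polish_space \<Rightarrow> 'e path measure) \<Rightarrow> bool" where
  "markov_family P \<longleftrightarrow>
     (\<forall>x. prob_space (P x) \<and> sets (P x) = sets path_space) \<and>
     (\<forall>F\<in>sets path_space. universally_measurable borel (\<lambda>x. emeasure (P x) F)) \<and>
     (\<forall>x. emeasure (P x) {\<omega> \<in> cadlag_paths. \<omega> 0 = x} = 1) \<and>
     (\<forall>x. \<forall>s\<ge>0. \<forall>t\<ge>0. \<forall>B\<in>sets borel.
        let A = {\<omega> \<in> cadlag_paths. \<omega> (s + t) \<in> B} in
        (AE \<omega> in P x. nn_cond_exp (P x) (path_sigma {0..s}) (indicator A) \<omega>
                      = nn_cond_exp (P x) (path_sigma {s}) (indicator A) \<omega>) \<and>
        (AE y in distr (P x) borel (\<lambda>\<omega>. \<omega> s). cond_prob_at (P x) A (\<lambda>\<omega>. \<omega> s) borel y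
                      = emeasure (P y) {\<omega> \<in> cadlag_paths. \<omega> t \<in> B}))"

definition aug_law :: "('e::polish_space \<Rightarrow> 'e path measure) \<Rightarrow> 'e \<Rightarrow> ('e \<times> 'e path) measure" where
  "aug_law P x = return borel x \<Otimes>\<^sub>M P x"

section \<open>Nominal impulse policies\<close>

definition strict_past :: "'a set \<Rightarrow> (ennreal \<Rightarrow> 'a measure) \<Rightarrow> ('a \<Rightarrow> ennreal) \<Rightarrow> 'a measure" where
  "strict_past \<Omega> G \<eta> = sigma \<Omega> {A \<inter> {\<omega> \<in> \<Omega>. t < \<eta> \<omega>} | A t. A \<in> sets (G t)}"

definition aug_strict_past ::
    "('e::polish_space \<times> 'e path \<Rightarrow> ennreal) \<Rightarrow> ('e \<times> 'e path) measure" where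
  "aug_strict_past \<eta> = sigma (space aug_space)
     ({{\<omega> \<in> space aug_space. fst \<omega> \<in> B} | B. B \<in> sets borel} \<union>
      {A \<inter> {\<omega> \<in> space aug_space. t < \<eta> \<omega>} | A t. A \<in> sets (aug_left_filtration t)})"

text \<open>The \<open>\<sigma>\<close>-algebra of the strict past of the \<open>k\<close>-th intervention time, on the augmented space.\<close>

definition policy_past ::
    "(nat \<Rightarrow> 'e::polish_space \<times> 'e path \<Rightarrow> ennreal) \<Rightarrow> nat \<Rightarrow> ('e \<times> 'e path) measure" where
  "policy_past \<tau> k = (if k = 1 then aug_strict_past (\<tau> 1)
     else strict_past (space aug_space) lifted_left_filtration (\<tau> k))"

text \<open>Indices start at 1; \<open>\<tau> 0\<close> and \<open>Z 0\<close> are not used. For \<open>k \<ge> 2\<close> the pair \<open>(\<tau> k, Z k)\<close> is a pair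
  of functions on \<open>\<Omega>\<close>, composed with the projection. The sequence \<open>\<tau>\<close> is understood to be nondecreasing
  and to be strictly increasing as long as it is finite, so that infinite times stay infinite;
  otherwise the pieces of the controlled path would overlap.\<close>

definition nominal_impulse_policy ::
    "'z measure \<Rightarrow> (nat \<Rightarrow> 'e::polish_space \<times> 'e path \<Rightarrow> ennreal) \<Rightarrow>
     (nat \<Rightarrow> 'e \<times> 'e path \<Rightarrow> 'z) \<Rightarrow> bool" where
  "nominal_impulse_policy S \<tau> Z \<longleftrightarrow>
     stopping_time aug_left_filtration (\<tau> 1) \<and>
     Z 1 \<in> aug_strict_past (\<tau> 1) \<rightarrow>\<^sub>M S \<and>
     (\<forall>k\<ge>2. \<exists>\<sigma> \<zeta>. stopping_time left_filtration \<sigma> \<and>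
        \<zeta> \<in> strict_past cadlag_paths left_filtration \<sigma> \<rightarrow>\<^sub>M S \<and>
        (\<forall>\<omega>\<in>space aug_space. \<tau> k \<omega> = \<sigma> (snd \<omega>) \<and> Z k \<omega> = \<zeta> (snd \<omega>))) \<and>
     (\<forall>\<omega>\<in>space aug_space. \<forall>k\<ge>1.
        (\<tau> k \<omega> < \<infinity> \<longrightarrow> \<tau> k \<omega> < \<tau> (Suc k) \<omega>) \<and> (\<tau> k \<omega> = \<infinity> \<longrightarrow> \<tau> (Suc k) \<omega> = \<infinity>)) \<and>
     (\<forall>\<omega>\<in>space aug_space. (\<lambda>k. \<tau> k \<omega>) \<longlonglongrightarrow> \<infinity>)"

section \<open>The controlled process\<close>

text \<open>A point of the product space is a pair of its coordinate with index 0 in the augmented space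
  and the sequence of its coordinates with indices \<open>\<ge> 1\<close> in \<open>\<Omega>\<close>. In \<open>initial_space k\<close> only the indices
  up to \<open>k\<close> are kept.\<close>

type_synonym 'e pieces = "('e \<times> 'e path) \<times> (nat \<Rightarrow> 'e path)"

definition product_space :: "'e::polish_space pieces measure" where
  "product_space = aug_space \<Otimes>\<^sub>M PiM {1..} (\<lambda>_. path_space)"

definition initial_space :: "nat \<Rightarrow> 'e::polish_space pieces measure" where
  "initial_space k = aug_space \<Otimes>\<^sub>M PiM {1..k} (\<lambda>_. path_space)"

definition initial_part :: "nat \<Rightarrow> 'e pieces \<Rightarrow> 'e pieces" where
  "initial_part k w = (fst w, restrict (snd w) {1..k})"

definition piece :: "'e pieces \<Rightarrow> nat \<Rightarrow> 'e path" where
  "piece w i = (if i = 0 then snd (fst w) else snd w i)"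

text \<open>The element of the augmented space that equals the \<open>i\<close>-th piece, started at time \<open>T i\<close>,
  on \<open>[T i, T (i + 1))\<close>.\<close>

definition paste :: "(nat \<Rightarrow> ennreal) \<Rightarrow> 'e pieces \<Rightarrow> 'e \<times> 'e path" where
  "paste T w = (fst (fst w), \<lambda>t\<in>{0..}.
     let i = (THE i. T i \<le> ennreal t \<and> ennreal t < T (Suc i)) in piece w i (t - enn2real (T i)))"

text \<open>Setting the times after the \<open>k\<close>-th to infinity makes the \<open>k\<close>-th piece last forever.\<close>

function jump_time :: "(nat \<Rightarrow> 'e \<times> 'e path \<Rightarrow> ennreal) \<Rightarrow> 'e pieces \<Rightarrow> nat \<Rightarrow> ennreal" where
  "jump_time \<tau> w 0 = 0"
| "jump_time \<tau> w (Suc k) =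
     \<tau> (Suc k) (paste (\<lambda>i. if i \<le> k then jump_time \<tau> w i else \<infinity>) w)"
  by pat_completeness auto
termination
  by (relation "Wellfounded.measure (\<lambda>(\<tau>, w, k). k)") auto

definition pasted_path :: "(nat \<Rightarrow> 'e \<times> 'e path \<Rightarrow> ennreal) \<Rightarrow> nat \<Rightarrow> 'e pieces \<Rightarrow> 'e \<times> 'e path" where
  "pasted_path \<tau> k w = paste (\<lambda>i. if i \<le> k then jump_time \<tau> w i else \<infinity>) w"

definition pre_jump_value ::
    "'e \<Rightarrow> (nat \<Rightarrow> 'e::polish_space \<times> 'e path \<Rightarrow> ennreal) \<Rightarrow> nat \<Rightarrow> 'e pieces \<Rightarrow> 'e" where
  "pre_jump_value ebar \<tau> k w = (if jump_time \<tau> w (Suc k) < \<infinity>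
     then left_limit (pasted_path \<tau> k w) (jump_time \<tau> w (Suc k)) else ebar)"

definition impulse_value ::
    "'z \<Rightarrow> (nat \<Rightarrow> 'e \<times> 'e path \<Rightarrow> ennreal) \<Rightarrow> (nat \<Rightarrow> 'e \<times> 'e path \<Rightarrow> 'z) \<Rightarrow>
     nat \<Rightarrow> 'e pieces \<Rightarrow> 'z" where
  "impulse_value zbar \<tau> Z k w = (if jump_time \<tau> w (Suc k) < \<infinity>
     then Z (Suc k) (pasted_path \<tau> k w) else zbar)"

text \<open>The kernels with index \<open>k + 1\<close>, as functions of the coordinates with indices up to \<open>k\<close>.\<close>

definition jump_kernel ::
    "('e::polish_space \<times> 'z \<Rightarrow> 'e measure) \<Rightarrow> 'e \<Rightarrow> 'z \<Rightarrow> (nat \<Rightarrow> 'e \<times> 'e path \<Rightarrow> ennreal) \<Rightarrow>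
     (nat \<Rightarrow> 'e \<times> 'e path \<Rightarrow> 'z) \<Rightarrow> nat \<Rightarrow> 'e pieces \<Rightarrow> 'e measure" where
  "jump_kernel Q ebar zbar \<tau> Z k w = (if jump_time \<tau> w (Suc k) < \<infinity>
     then Q (pre_jump_value ebar \<tau> k w, impulse_value zbar \<tau> Z k w) else return borel ebar)"

text \<open>The integrands below are only universally measurable, hence the completions.\<close>

definition path_kernel ::
    "('e::polish_space \<Rightarrow> 'e path measure) \<Rightarrow> ('e \<times> 'z \<Rightarrow> 'e measure) \<Rightarrow> 'e \<Rightarrow> 'z \<Rightarrow>
     (nat \<Rightarrow> 'e \<times> 'e path \<Rightarrow> ennreal) \<Rightarrow> (nat \<Rightarrow> 'e \<times> 'e path \<Rightarrow> 'z) \<Rightarrow>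
     nat \<Rightarrow> 'e pieces \<Rightarrow> 'e path measure" where
  "path_kernel P Q ebar zbar \<tau> Z k w = measure_of (space path_space) (sets path_space)
     (\<lambda>F. \<integral>\<^sup>+v. emeasure (P v) F \<partial>completion (jump_kernel Q ebar zbar \<tau> Z k w))"

text \<open>The law of Ionescu Tulcea. The library's construction asks for measurable kernels,
  whereas these are universally measurable; the law is therefore introduced as the unique probability
  measure with the given initial law and successive transition kernels.\<close>

definition pieces_law ::
    "('e::polish_space \<Rightarrow> 'e path measure) \<Rightarrow> ('e \<times> 'z \<Rightarrow> 'e measure) \<Rightarrow> 'e \<Rightarrow> 'z \<Rightarrow>
     (nat \<Rightarrow> 'e \<times> 'e path \<Rightarrow> ennreal) \<Rightarrow> (nat \<Rightarrow> 'e \<times> 'e path \<Rightarrow> 'z) \<Rightarrow>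
     'e \<Rightarrow> 'e pieces measure" where
  "pieces_law P Q ebar zbar \<tau> Z x = (THE \<mu>.
     prob_space \<mu> \<and> sets \<mu> = sets product_space \<and>
     distr \<mu> aug_space fst = aug_law P x \<and>
     (\<forall>k. \<forall>A\<in>sets (initial_space k). \<forall>F\<in>sets path_space.
        emeasure \<mu> {w \<in> space product_space. initial_part k w \<in> A \<and> piece w (Suc k) \<in> F} =
        (\<integral>\<^sup>+w. indicator A (initial_part k w) *
           emeasure (path_kernel P Q ebar zbar \<tau> Z k (initial_part k w)) F \<partial>completion \<mu>)))"

text \<open>The controlled path is defined on all of \<open>[0,\<infinity>)\<close> exactly when the jump times tend to infinity.
  The convergence of \<open>\<tau>\<close> on the space of cadlag paths does not imply this, because pieces
  with accumulating jump times need not paste to a cadlag path.\<close>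

definition nonexplosive ::
    "('e::polish_space \<Rightarrow> 'e path measure) \<Rightarrow> ('e \<times> 'z \<Rightarrow> 'e measure) \<Rightarrow> 'e \<Rightarrow> 'z \<Rightarrow>
     (nat \<Rightarrow> 'e \<times> 'e path \<Rightarrow> ennreal) \<Rightarrow> (nat \<Rightarrow> 'e \<times> 'e path \<Rightarrow> 'z) \<Rightarrow> bool" where
  "nonexplosive P Q ebar zbar \<tau> Z \<longleftrightarrow>
     (\<forall>x. AE w in pieces_law P Q ebar zbar \<tau> Z x. jump_time \<tau> w \<longlonglongrightarrow> \<infinity>)"

definition controlled_path ::
    "'e \<Rightarrow> (nat \<Rightarrow> 'e \<times> 'e path \<Rightarrow> ennreal) \<Rightarrow> 'e pieces \<Rightarrow> 'e \<times> 'e path" where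
  "controlled_path ebar \<tau> w = (if jump_time \<tau> w \<longlonglongrightarrow> \<infinity> then paste (jump_time \<tau> w) w
     else (ebar, \<lambda>t\<in>{0..}. ebar))"

definition controlled_law ::
    "('e::polish_space \<Rightarrow> 'e path measure) \<Rightarrow> ('e \<times> 'z \<Rightarrow> 'e measure) \<Rightarrow> 'e \<Rightarrow> 'z \<Rightarrow>
     (nat \<Rightarrow> 'e \<times> 'e path \<Rightarrow> ennreal) \<Rightarrow> (nat \<Rightarrow> 'e \<times> 'e path \<Rightarrow> 'z) \<Rightarrow>
     'e \<Rightarrow> ('e \<times> 'e path) measure" where
  "controlled_law P Q ebar zbar \<tau> Z x =
     distr (pieces_law P Q ebar zbar \<tau> Z x) aug_space (controlled_path ebar \<tau>)"

definition initial_controlled_law ::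
    "('e::polish_space \<Rightarrow> 'e path measure) \<Rightarrow> ('e \<times> 'z \<Rightarrow> 'e measure) \<Rightarrow> 'e \<Rightarrow> 'z \<Rightarrow>
     (nat \<Rightarrow> 'e \<times> 'e path \<Rightarrow> ennreal) \<Rightarrow> (nat \<Rightarrow> 'e \<times> 'e path \<Rightarrow> 'z) \<Rightarrow>
     'e measure \<Rightarrow> ('e \<times> 'e path) measure" where
  "initial_controlled_law P Q ebar zbar \<tau> Z \<nu> = measure_of (space aug_space) (sets aug_space)
     (\<lambda>F. \<integral>\<^sup>+x. emeasure (controlled_law P Q ebar zbar \<tau> Z x) F \<partial>completion \<nu>)"

section \<open>The fundamental process between interventions\<close>

definition splice :: "'e \<times> 'e path \<Rightarrow> real \<Rightarrow> 'e path \<Rightarrow> 'e \<times> 'e path" where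
  "splice \<omega> r \<omega>' = (fst \<omega>, \<lambda>t\<in>{0..}. if t < r then snd \<omega> t else \<omega>' (t - r))"

text \<open>\<open>\<sigma>(X(0-)) \<or> \<G> \<or> \<sigma>(X(\<tau>\<^sub>k))\<close> with \<open>\<G>\<close> the strict past of \<open>\<tau>\<^sub>k\<close>. The value \<open>X(\<tau>\<^sub>k)\<close> exists only
  where \<open>\<tau>\<^sub>k\<close> is finite, which is an event in \<open>\<G>\<close>.\<close>

definition policy_present ::
    "(nat \<Rightarrow> 'e::polish_space \<times> 'e path \<Rightarrow> ennreal) \<Rightarrow> nat \<Rightarrow> ('e \<times> 'e path) measure" where
  "policy_present \<tau> k = sigma (space aug_space)
     ({{\<omega> \<in> space aug_space. fst \<omega> \<in> B} | B. B \<in> sets borel} \<union>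
      sets (policy_past \<tau> k) \<union>
      {{\<omega> \<in> space aug_space. \<tau> k \<omega> < \<infinity> \<and> snd \<omega> (enn2real (\<tau> k \<omega>)) \<in> B} | B. B \<in> sets borel})"

text \<open>The process is the fundamental Markov process on \<open>[\<tau>\<^sub>k\<^sub>-\<^sub>1, \<tau>\<^sub>k)\<close> under \<open>M\<close>. Where \<open>t\<close> is nonnegative,
  truncation of the difference of two times does not affect whether it exceeds \<open>t\<close>.\<close>

definition fundamental_between ::
    "('e::polish_space \<Rightarrow> 'e path measure) \<Rightarrow> (nat \<Rightarrow> 'e \<times> 'e path \<Rightarrow> ennreal) \<Rightarrow>
     ('e \<times> 'e path) measure \<Rightarrow> nat \<Rightarrow> bool" where
  "fundamental_between P \<tau> M k \<longleftrightarrow>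
     (\<forall>n\<ge>1. \<forall>t :: nat \<Rightarrow> real. \<forall>B :: nat \<Rightarrow> 'e set.
        0 \<le> t 1 \<longrightarrow> strict_mono_on {1..n} t \<longrightarrow> (\<forall>i\<in>{1..n}. B i \<in> sets borel) \<longrightarrow>
        (if k = 1 then
           let E = {\<omega> \<in> space aug_space. \<tau> 1 \<omega> > ennreal (t n) \<and> (\<forall>i\<in>{1..n}. snd \<omega> (t i) \<in> B i)} in
           AE \<omega> in M. nn_cond_exp M (vimage_algebra (space aug_space) fst borel) (indicator E) \<omega>
                       = emeasure (aug_law P (fst \<omega>)) E
         else
           AE \<omega> in M. \<tau> (k - 1) \<omega> < \<infinity> \<longrightarrow>
             nn_cond_exp M (policy_present \<tau> (k - 1))
               (indicator {\<omega> \<in> space aug_space. \<tau> (k - 1) \<omega> < \<infinity> \<and>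
                  \<tau> k \<omega> - \<tau> (k - 1) \<omega> > ennreal (t n) \<and>
                  (\<forall>i\<in>{1..n}. snd \<omega> (enn2real (\<tau> (k - 1) \<omega>) + t i) \<in> B i)}) \<omega>
             = emeasure (P (snd \<omega> (enn2real (\<tau> (k - 1) \<omega>))))
                 {\<omega>' \<in> cadlag_paths.
                  \<tau> k (splice \<omega> (enn2real (\<tau> (k - 1) \<omega>)) \<omega>') - \<tau> (k - 1) \<omega> > ennreal (t n) \<and>
                  (\<forall>i\<in>{1..n}. \<omega>' (t i) \<in> B i)}))"

text \<open>On the event \<open>A\<close>, \<open>\<kappa>\<close> is a regular conditional distribution of \<open>Y\<close> given \<open>G\<close>;
  neither \<open>Y\<close> nor \<open>\<kappa>\<close> matters outside \<open>A\<close>.\<close>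

definition regular_cond_distr_on ::
    "'a measure \<Rightarrow> 'a measure \<Rightarrow> 'a set \<Rightarrow> ('a \<Rightarrow> 'b) \<Rightarrow> 'b measure \<Rightarrow> ('a \<Rightarrow> 'b measure) \<Rightarrow> bool" where
  "regular_cond_distr_on M G A Y N \<kappa> \<longleftrightarrow>
     A \<in> sets G \<and> \<kappa> \<in> restrict_space G A \<rightarrow>\<^sub>M prob_algebra N \<and>
     (\<forall>\<Gamma>\<in>sets N. AE \<omega> in M. \<omega> \<in> A \<longrightarrow>
        nn_cond_exp M G (indicator {\<omega> \<in> A. Y \<omega> \<in> \<Gamma>}) \<omega> = emeasure (\<kappa> \<omega>) \<Gamma>)"

end

(* For a fixed initial law nu, each universally measurable kernel agrees off a null set with a
measurable one, and the null set can be chosen recursively along the construction. The theorem of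
Ionescu Tulcea for the modified kernels gives a law of the pieces that is measurable in the initial
point, and for nu-almost every x it is the unique law with the prescribed universally measurable kernels.

The controlled path agrees with the path pasted from the first k + 1 pieces (indices 0 to k)
before the (k+1)-st intervention time. A path determines a time of the policy and the events of its strict past
already through its values before that time, so both sides of the defining identities of the conditional
probabilities are integrals over the first k + 2 pieces, where they follow from the form of the
transition kernel. *)

theory Submission
  imports Defs
begin

section \<open>Measurability on the path space\<close>

text \<open>For a universally measurable family, the null set off which the mass of an event is a
  measurable function depends on the event. One null set serves all events because the path space
  has a countable intersection-stable generator. It is taken with respect to the law of the point at
  which the path starts.

  The prescribed law of the pieces is a definite description, so every competing law has to be
  identified as well.

  The conditional probabilities involve the point drawn at a jump, which must be recovered from the
  controlled path. Since \<open>P v\<close> is carried by the paths that start at \<open>v\<close>,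
  that point is the value at 0 of the next piece. Integrating over the point and then over the path
  thus becomes a disintegration of the piece by its own starting value.

  Candidates for the conditional probabilities are written with the modified families, whose masses
  are measurable. The original family returns at the very end, because the starting values almost
  surely avoid the exceptional sets.\<close>

lemma sets_Collect_in: "f \<in> M \<rightarrow>\<^sub>M N \<Longrightarrow> B \<in> sets N \<Longrightarrow> {x \<in> space M. f x \<in> B} \<in> sets M"
  using measurable_sets[of f M N B] by (simp add: vimage_def Int_def conj_commute)

lemma sets_Collect_Ball_in:
  assumes "\<And>i. i \<in> I \<Longrightarrow> f i \<in> M \<rightarrow>\<^sub>M N" "\<And>i. i \<in> I \<Longrightarrow> B i \<in> sets N" "finite I"
  shows "{x \<in> space M. \<forall>i\<in>I. f i x \<in> B i} \<in> sets M"
  using assms by (intro sets.sets_Collect_finite_All sets_Collect_in)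

lemma space_path_sigma [simp]: "space (path_sigma T) = cadlag_paths"
  unfolding path_sigma_def by (rule space_measure_of) auto

lemma sets_path_sigma: "sets (path_sigma T) =
    sigma_sets cadlag_paths {{\<omega> \<in> cadlag_paths. \<omega> s \<in> B} | s B. s \<in> T \<and> B \<in> sets borel}"
  unfolding path_sigma_def by (rule sets_measure_of) auto

lemma measurable_path_eval: "s \<in> T \<Longrightarrow> (\<lambda>\<omega>. \<omega> s) \<in> path_sigma T \<rightarrow>\<^sub>M borel"
proof (rule measurableI)
  fix B :: "'a set" assume "s \<in> T" "B \<in> sets borel"
  then have "{\<omega> \<in> cadlag_paths. \<omega> s \<in> B} \<in> sets (path_sigma T)"
    unfolding sets_path_sigma by (blast intro: sigma_sets.Basic)
  then show "(\<lambda>\<omega>. \<omega> s) -` B \<inter> space (path_sigma T) \<in> sets (path_sigma T)"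
    by (simp add: vimage_def Int_def conj_commute)
qed simp

lemma measurable_path_sigmaI:
  fixes f :: "'a \<Rightarrow> 'e::polish_space path"
  assumes "\<And>x. x \<in> space M \<Longrightarrow> f x \<in> cadlag_paths"
    and "\<And>s. s \<in> T \<Longrightarrow> (\<lambda>x. f x s) \<in> M \<rightarrow>\<^sub>M borel"
  shows "f \<in> M \<rightarrow>\<^sub>M path_sigma T"
  unfolding path_sigma_def
proof (rule measurable_measure_of)
  fix y :: "'e path set" assume "y \<in> {{\<omega> \<in> cadlag_paths. \<omega> s \<in> B} | s B. s \<in> T \<and> B \<in> sets borel}"
  then obtain s B where y: "y = {\<omega> \<in> cadlag_paths. \<omega> s \<in> B}" "s \<in> T" "B \<in> sets borel"
    by blast
  have "f -` y \<inter> space M = (\<lambda>x. f x s) -` B \<inter> space M"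
    using assms(1) by (auto simp: y)
  then show "f -` y \<inter> space M \<in> sets M"
    using measurable_sets[OF assms(2)] y by simp
qed (use assms(1) in auto)

lemma space_path_space [simp]: "space path_space = cadlag_paths"
  by (simp add: path_space_def)

lemma sets_path_sigma_mono: "S \<subseteq> T \<Longrightarrow> sets (path_sigma S) \<subseteq> sets (path_sigma T)"
  unfolding sets_path_sigma by (rule sigma_sets_mono') blast

lemma measurable_path_space_eval [measurable]: "s \<ge> 0 \<Longrightarrow> (\<lambda>\<omega>. \<omega> s) \<in> path_space \<rightarrow>\<^sub>M borel"
  unfolding path_space_def by (rule measurable_path_eval) simp

lemma cadlag_right_lim: "\<omega> \<in> cadlag_paths \<Longrightarrow> t \<ge> 0 \<Longrightarrow> (\<omega> \<longlongrightarrow> \<omega> t) (at_right t)"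
  by (simp add: cadlag_paths_def)

lemma cadlag_left_lim: "\<omega> \<in> cadlag_paths \<Longrightarrow> t > 0 \<Longrightarrow> (\<omega> \<longlongrightarrow> Lim (at_left t) \<omega>) (at_left t)"
proof -
  assume "\<omega> \<in> cadlag_paths" "t > 0"
  then obtain l where l: "(\<omega> \<longlongrightarrow> l) (at_left t)"
    by (auto simp: cadlag_paths_def)
  then show ?thesis
    using tendsto_Lim[OF _ l] by simp
qed

lemma filterlim_at_right_sequentially:
  fixes s :: "nat \<Rightarrow> real"
  assumes "\<And>n. t < s n" "\<And>n. s n \<le> t + 1 / Suc n"
  shows "filterlim s (at_right t) sequentially"
  unfolding filterlim_at
proof
  have "s \<longlonglongrightarrow> t + 0"
  proof (rule tendsto_sandwich[where f = "\<lambda>_. t" and h = "\<lambda>n. t + 1 / Suc n"])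
    show "(\<lambda>n. t + 1 / real (Suc n)) \<longlonglongrightarrow> t + 0"
      by (intro tendsto_add tendsto_const LIMSEQ_Suc[OF lim_1_over_n])
  qed (use assms in \<open>auto intro!: always_eventually less_imp_le\<close>)
  then show "s \<longlonglongrightarrow> t" by simp
qed (use assms(1) less_imp_neq in \<open>fastforce intro!: always_eventually\<close>)

lemma filterlim_at_left_sequentially:
  fixes s :: "nat \<Rightarrow> real"
  assumes "\<And>n. s n < t" "\<And>n. t - 1 / Suc n \<le> s n"
  shows "filterlim s (at_left t) sequentially"
  unfolding filterlim_at
proof
  have "s \<longlonglongrightarrow> t - 0"
  proof (rule tendsto_sandwich[where h = "\<lambda>_. t" and f = "\<lambda>n. t - 1 / Suc n"])
    show "(\<lambda>n. t - 1 / real (Suc n)) \<longlonglongrightarrow> t - 0"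
      by (intro tendsto_diff tendsto_const LIMSEQ_Suc[OF lim_1_over_n])
  qed (use assms in \<open>auto intro!: always_eventually less_imp_le\<close>)
  then show "s \<longlonglongrightarrow> t" by simp
qed (use assms(1) less_imp_neq in \<open>fastforce intro!: always_eventually\<close>)

text \<open>The random time is approximated from the right by times with countably many values,
  where evaluation is measurable piece by piece; right-continuity carries this to the limit.\<close>

lemma measurable_path_eval_random:
  fixes f :: "'a \<Rightarrow> 'e::polish_space path"
  assumes f: "f \<in> M \<rightarrow>\<^sub>M path_space" and r [measurable]: "r \<in> borel_measurable M"
    and r0: "\<And>x. x \<in> space M \<Longrightarrow> 0 \<le> r x"
  shows "(\<lambda>x. f x (r x)) \<in> M \<rightarrow>\<^sub>M borel"
proof (rule borel_measurable_LIMSEQ_metric)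
  \<comment> \<open>For \<open>u \<ge> 0\<close> this is the least multiple of
    \<open>1 / Suc n\<close> that is strictly larger than \<open>u\<close>. The maximum with 0 keeps
    the time nonnegative for every integer index, also for those that the floor never takes.\<close>
  define s where "s n u = (of_int (max 0 \<lfloor>u * Suc n\<rfloor>) + 1) / real (Suc n)" for n and u :: real
  show "(\<lambda>x. f x (s n (r x))) \<in> borel_measurable M" for n
    unfolding s_def
  proof (rule measurable_compose_countable[where g = "\<lambda>x. \<lfloor>r x * Suc n\<rfloor>"])
    show "(\<lambda>x. f x ((of_int (max 0 i) + 1) / real (Suc n))) \<in> borel_measurable M" for i
      by (rule measurable_compose[OF f measurable_path_space_eval]) simp
  qed measurable
  fix x assume x: "x \<in> space M"
  have u: "r x < s n (r x)" "s n (r x) \<le> r x + 1 / Suc n" for n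
  proof -
    have "\<lfloor>r x * Suc n\<rfloor> \<ge> 0"
      using r0[OF x] by simp
    then have s: "s n (r x) = (of_int \<lfloor>r x * Suc n\<rfloor> + 1) / real (Suc n)"
      by (simp add: s_def)
    show "r x < s n (r x)"
      unfolding s by (subst pos_less_divide_eq) (linarith | simp)+
    show "s n (r x) \<le> r x + 1 / Suc n"
      unfolding s add_divide_distrib by (intro add_mono order_refl, subst pos_divide_le_eq) (linarith | simp)+
  qed
  show "(\<lambda>n. f x (s n (r x))) \<longlonglongrightarrow> f x (r x)"
    using filterlim_compose[OF cadlag_right_lim filterlim_at_right_sequentially[OF u]]
      measurable_space[OF f x] r0[OF x] by simp
qed

section \<open>Countable generation of the path space\<close>

lemma countable_Int_stable_generator:
  assumes "countable G" "G \<subseteq> Pow \<Omega>"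
  obtains G' where "countable G'" "Int_stable G'" "G' \<subseteq> Pow \<Omega>" "sigma_sets \<Omega> G' = sigma_sets \<Omega> G"
proof
  \<comment> \<open>The factor \<open>\<Omega>\<close> takes care of the empty family, whose
    intersection would otherwise be the whole type.\<close>
  let ?G' = "(\<lambda>F. \<Omega> \<inter> \<Inter>F) ` {F. finite F \<and> F \<subseteq> G}"
  show "countable ?G'"
    using countable_Collect_finite_subset[OF assms(1)] by (intro countable_image) (simp add: conj_commute)
  show "Int_stable ?G'"
  proof (rule Int_stableI)
    fix a b assume "a \<in> ?G'" "b \<in> ?G'"
    then obtain E F where "a = \<Omega> \<inter> \<Inter>E" "finite E" "E \<subseteq> G" "b = \<Omega> \<inter> \<Inter>F" "finite F" "F \<subseteq> G"
      by blast
    then show "a \<inter> b \<in> ?G'"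
      by (intro image_eqI[where x = "E \<union> F"]) auto
  qed
  show "?G' \<subseteq> Pow \<Omega>" by blast
  show "sigma_sets \<Omega> ?G' = sigma_sets \<Omega> G"
  proof (rule sigma_sets_eqI)
    fix a assume "a \<in> ?G'"
    then obtain F where a: "a = \<Omega> \<inter> \<Inter>F" and F: "finite F" "F \<subseteq> G" by blast
    from F have "\<Omega> \<inter> \<Inter>F \<in> sigma_sets \<Omega> G"
    proof (induction F)
      case (insert x F)
      interpret sigma_algebra \<Omega> "sigma_sets \<Omega> G" by (rule sigma_algebra_sigma_sets[OF assms(2)])
      have "\<Omega> \<inter> \<Inter>(insert x F) = x \<inter> (\<Omega> \<inter> \<Inter>F)" by blast
      moreover have "x \<in> sigma_sets \<Omega> G" using insert by blast
      ultimately show ?case using insert by (metis Int insert_subset)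
    qed (simp add: sigma_sets_top)
    then show "a \<in> sigma_sets \<Omega> G" by (simp add: a)
  next
    fix b assume "b \<in> G"
    then have "b = \<Omega> \<inter> \<Inter>{b}" using assms(2) by blast
    with \<open>b \<in> G\<close> show "b \<in> sigma_sets \<Omega> ?G'"
      by (intro sigma_sets.Basic image_eqI[where x = "{b}"]) auto
  qed
qed

text \<open>Rational times and a countable base of the topology suffice: a coordinate at any other
  time is a limit of coordinates at rational times from the right.\<close>

lemma path_space_countably_generated:
  obtains G :: "'e::polish_space path set set"
  where "countable G" "Int_stable G" "G \<subseteq> Pow cadlag_paths" "sets path_space = sigma_sets cadlag_paths G"
proof -
  obtain \<B> :: "'e set set" where \<B>: "countable \<B>" "topological_basis \<B>"
    using ex_countable_basis by blast
  let ?H = "(\<lambda>(q, U). {\<omega> \<in> cadlag_paths. \<omega> q \<in> U}) ` ((\<rat> \<inter> {0..}) \<times> \<B>) :: 'e path set set"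
  have H: "countable ?H" "?H \<subseteq> Pow cadlag_paths"
    using \<B>(1) countable_rat by auto
  have bq: "(\<lambda>\<omega>. \<omega> q) \<in> sigma cadlag_paths ?H \<rightarrow>\<^sub>M borel" if "q \<in> \<rat>" "q \<ge> 0" for q
    unfolding borel_eq_countable_basis[OF \<B>]
  proof (rule measurable_measure_of)
    fix U assume "U \<in> \<B>"
    have "(\<lambda>\<omega>. \<omega> q) -` U \<inter> space (sigma cadlag_paths ?H) = {\<omega> \<in> cadlag_paths. \<omega> q \<in> U}"
      using H(2) by (auto simp: space_measure_of_conv)
    with \<open>U \<in> \<B>\<close> that H(2)
    show "(\<lambda>\<omega>. \<omega> q) -` U \<inter> space (sigma cadlag_paths ?H) \<in> sets (sigma cadlag_paths ?H)"
      by (simp add: sets_measure_of) (rule sigma_sets.Basic, rule image_eqI[where x = "(q, U)"], auto)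
  qed auto
  have b: "(\<lambda>\<omega>. \<omega> t) \<in> sigma cadlag_paths ?H \<rightarrow>\<^sub>M borel" if "t \<ge> 0" for t
  proof -
    have "\<exists>q. q \<in> \<rat> \<and> t < q \<and> q < t + 1 / Suc n" for n
      by (rule Rats_dense_in_real[of t "t + 1 / Suc n", simplified Bex_def]) simp
    then obtain q :: "nat \<Rightarrow> real" where q: "\<And>n. q n \<in> \<rat>" "\<And>n. t < q n" "\<And>n. q n < t + 1 / Suc n"
      by metis
    show ?thesis
    proof (rule borel_measurable_LIMSEQ_metric)
      show "(\<lambda>\<omega>. \<omega> (q n)) \<in> sigma cadlag_paths ?H \<rightarrow>\<^sub>M borel" for n
        using q(1)[of n] q(2)[of n] that by (intro bq) auto
      fix \<omega> assume "\<omega> \<in> space (sigma cadlag_paths ?H)"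
      then have "\<omega> \<in> cadlag_paths"
        by (simp add: space_measure_of_conv)
      then show "(\<lambda>n. \<omega> (q n)) \<longlonglongrightarrow> \<omega> t"
        by (rule filterlim_compose[OF cadlag_right_lim[OF _ that]
              filterlim_at_right_sequentially[OF q(2) less_imp_le[OF q(3)]]])
    qed
  qed
  have id: "(\<lambda>\<omega>. \<omega>) \<in> sigma cadlag_paths ?H \<rightarrow>\<^sub>M path_space"
    unfolding path_space_def by (rule measurable_path_sigmaI) (auto simp: space_measure_of_conv b)
  have "sets path_space \<subseteq> sets (sigma cadlag_paths ?H)"
  proof
    fix A :: "'e path set" assume A: "A \<in> sets path_space"
    have "(\<lambda>\<omega>. \<omega>) -` A \<inter> space (sigma cadlag_paths ?H) = A"
      using sets.sets_into_space[OF A] by (simp add: space_measure_of_conv Int_absorb2)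
    with measurable_sets[OF id A] show "A \<in> sets (sigma cadlag_paths ?H)" by simp
  qed
  moreover have "sigma_sets cadlag_paths ?H \<subseteq> sets path_space"
    unfolding path_space_def sets_path_sigma
  proof (rule sigma_sets_mono, rule subsetI)
    fix A assume "A \<in> ?H"
    then obtain z where z: "z \<in> (\<rat> \<inter> {0..}) \<times> \<B>"
      "A = (case z of (q, U) \<Rightarrow> {\<omega> \<in> cadlag_paths. \<omega> q \<in> U})"
      by (rule imageE)
    then obtain q U where A: "A = {\<omega> \<in> cadlag_paths. \<omega> q \<in> U}" "q \<ge> 0" "U \<in> \<B>"
      by (cases z) simp
    then have "U \<in> sets borel"
      by (intro borel_open topological_basis_open[OF \<B>(2)])
    with A show "A \<in> sigma_sets cadlag_paths {{\<omega> \<in> cadlag_paths. \<omega> s \<in> B} |s B. s \<in> {0..} \<and> B \<in> sets borel}"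
      by (intro sigma_sets.Basic CollectI exI[of _ q] exI[of _ U]) simp
  qed
  ultimately have "sets path_space = sigma_sets cadlag_paths ?H"
    using H(2) by (simp add: sets_measure_of)
  with that countable_Int_stable_generator[OF H] show thesis by metis
qed

lemma space_aug_space: "space aug_space = {\<omega>. snd \<omega> \<in> cadlag_paths}"
  by (auto simp: aug_space_def space_pair_measure)

lemma measurable_aug_fst [measurable]: "fst \<in> aug_space \<rightarrow>\<^sub>M borel"
  and measurable_aug_snd [measurable]: "snd \<in> aug_space \<rightarrow>\<^sub>M path_space"
  unfolding aug_space_def by measurable

lemma measurable_aug_spaceI:
  assumes "\<And>x. x \<in> space M \<Longrightarrow> snd (f x) \<in> cadlag_paths"
    and "(\<lambda>x. fst (f x)) \<in> M \<rightarrow>\<^sub>M borel"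
    and "\<And>s. s \<ge> 0 \<Longrightarrow> (\<lambda>x. snd (f x) s) \<in> M \<rightarrow>\<^sub>M borel"
  shows "f \<in> M \<rightarrow>\<^sub>M aug_space"
proof -
  have "(\<lambda>x. snd (f x)) \<in> M \<rightarrow>\<^sub>M path_space"
    unfolding path_space_def by (rule measurable_path_sigmaI) (use assms in auto)
  with assms(2) show ?thesis
    unfolding aug_space_def by (simp add: measurable_pair_iff comp_def)
qed

section \<open>Splicing of paths\<close>

lemma filterlim_shift_at_right: "filterlim (\<lambda>s. s - r) (at_right (t - r)) (at_right t)" for t r :: real
  unfolding filterlim_at
  by (auto intro!: tendsto_eq_intros simp: eventually_at_filter)

lemma filterlim_shift_at_left: "filterlim (\<lambda>s. s - r) (at_left (t - r)) (at_left t)" for t r :: real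
  unfolding filterlim_at
  by (auto intro!: tendsto_eq_intros simp: eventually_at_filter)

text \<open>At time \<open>r\<close> itself the right limit belongs to the second path and the left
  limit to the first. Hence the case distinction is \<open>t < r\<close> for right limits and
  \<open>t \<le> r\<close> for left limits.\<close>

lemma splice_cadlag:
  fixes \<omega> :: "'e::polish_space \<times> 'e path"
  assumes "snd \<omega> \<in> cadlag_paths" "\<omega>' \<in> cadlag_paths"
  shows "snd (splice \<omega> r \<omega>') \<in> cadlag_paths"
proof -
  let ?p = "snd (splice \<omega> r \<omega>')"
  have p: "?p s = (if s < r then snd \<omega> s else \<omega>' (s - r))" if "s \<ge> 0" for s
    using that by (simp add: splice_def)
  have "(?p \<longlongrightarrow> ?p t) (at_right t)" if t: "t \<ge> 0" for t
  proof (cases "t < r")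
    case True
    have "\<forall>\<^sub>F s in at_right t. s \<in> {t<..<r}"
      by (rule eventually_at_right_real[OF True])
    then have "\<forall>\<^sub>F s in at_right t. ?p s = snd \<omega> s"
      by eventually_elim (use t p in auto)
    then show ?thesis
      using cadlag_right_lim[OF assms(1) t] p[OF t] True by (subst tendsto_cong) auto
  next
    case False
    then have "((\<lambda>s. \<omega>' (s - r)) \<longlongrightarrow> \<omega>' (t - r)) (at_right t)"
      by (intro filterlim_compose[OF cadlag_right_lim[OF assms(2)] filterlim_shift_at_right]) simp
    moreover have "\<forall>\<^sub>F s in at_right t. s \<in> {t<..<t + 1}"
      by (rule eventually_at_right_real) simp
    then have "\<forall>\<^sub>F s in at_right t. ?p s = \<omega>' (s - r)"
      by eventually_elim (use t p False in auto)
    ultimately show ?thesis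
      using p[OF t] False by (subst tendsto_cong) auto
  qed
  moreover have "\<exists>l. (?p \<longlongrightarrow> l) (at_left t)" if t: "t > 0" for t
  proof (cases "t \<le> r")
    case True
    have "\<forall>\<^sub>F s in at_left t. s \<in> {0<..<t}"
      by (rule eventually_at_left_real[OF t])
    then have "\<forall>\<^sub>F s in at_left t. ?p s = snd \<omega> s"
      by eventually_elim (use True p in auto)
    then show ?thesis
      by (metis cadlag_left_lim[OF assms(1) t] tendsto_cong)
  next
    case False
    then have "((\<lambda>s. \<omega>' (s - r)) \<longlongrightarrow> Lim (at_left (t - r)) \<omega>') (at_left t)"
      by (intro filterlim_compose[OF cadlag_left_lim[OF assms(2)] filterlim_shift_at_left]) simp
    moreover have "\<forall>\<^sub>F s in at_left t. s \<in> {max 0 r<..<t}"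
      by (rule eventually_at_left_real) (use False t in auto)
    then have "\<forall>\<^sub>F s in at_left t. ?p s = \<omega>' (s - r)"
      by eventually_elim (use p in auto)
    ultimately show ?thesis
      by (metis tendsto_cong)
  qed
  ultimately show ?thesis
    by (simp add: cadlag_paths_def) (simp add: splice_def)
qed

text \<open>The splice reads \<open>f x\<close> only before \<open>r x\<close>, so its values are
  required to be measurable only on the event that the time is not yet reached. This weak form is
  what makes the lemma applicable to the present at an intervention time, where nothing else is
  known about the later path.\<close>

lemma measurable_splice:
  assumes fst: "(\<lambda>x. fst (f x)) \<in> M \<rightarrow>\<^sub>M borel"
    and f: "\<And>x. x \<in> space M \<Longrightarrow> snd (f x) \<in> cadlag_paths"
    and f_before: "\<And>s. s \<ge> 0 \<Longrightarrow> (\<lambda>x. snd (f x) s) \<in> restrict_space M {x. s < r x} \<rightarrow>\<^sub>M borel"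
    and r [measurable]: "r \<in> borel_measurable M"
    and g: "g \<in> M \<rightarrow>\<^sub>M path_space"
  shows "(\<lambda>x. splice (f x) (r x) (g x)) \<in> M \<rightarrow>\<^sub>M aug_space"
proof (rule measurable_aug_spaceI)
  show "(\<lambda>x. fst (splice (f x) (r x) (g x))) \<in> M \<rightarrow>\<^sub>M borel"
    using fst by (simp add: splice_def)
  show "snd (splice (f x) (r x) (g x)) \<in> cadlag_paths" if "x \<in> space M" for x
    using f[OF that] measurable_space[OF g that] by (simp add: splice_cadlag)
  fix s :: real assume s: "s \<ge> 0"
  \<comment> \<open>The truncation keeps the evaluation time admissible where
    \<open>s < r x\<close>; there the value is discarded.\<close>
  have "(\<lambda>x. g x (max 0 (s - r x))) \<in> M \<rightarrow>\<^sub>M borel"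
    by (rule measurable_path_eval_random[OF g]) auto
  then have "(\<lambda>x. if s < r x then snd (f x) s else g x (max 0 (s - r x))) \<in> M \<rightarrow>\<^sub>M borel"
    using f_before[OF s] by (subst measurable_If_restrict_space_iff)
      (auto intro: measurable_restrict_space1)
  then show "(\<lambda>x. snd (splice (f x) (r x) (g x)) s) \<in> M \<rightarrow>\<^sub>M borel"
    using s by (subst measurable_cong) (auto simp: splice_def max_def)
qed

section \<open>Strict pasts\<close>

text \<open>The sets that do not separate two given points are closed under complements and
  countable unions, so it is enough to look at generators.\<close>

lemma sigma_sets_same_atom:
  assumes "A \<in> sigma_sets \<Omega> G" "x \<in> \<Omega>" "y \<in> \<Omega>" "\<And>g. g \<in> G \<Longrightarrow> x \<in> g \<longleftrightarrow> y \<in> g"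
  shows "x \<in> A \<longleftrightarrow> y \<in> A"
  using assms(1) by induction (use assms(2-4) in auto)

text \<open>Events of the strict past at time \<open>t\<close> cannot separate two elements related
  in this way, hence the strict inequality and the comparison of the values at 0-.\<close>

definition agree_before :: "ennreal \<Rightarrow> 'e \<times> 'e path \<Rightarrow> 'e \<times> 'e path \<Rightarrow> bool" where
  "agree_before t \<omega> \<omega>' \<longleftrightarrow> fst \<omega> = fst \<omega>' \<and> (\<forall>s\<ge>0. ennreal s < t \<longrightarrow> snd \<omega> s = snd \<omega>' s)"

lemma agree_before_sym: "agree_before t \<omega> \<omega>' \<longleftrightarrow> agree_before t \<omega>' \<omega>"
  by (auto simp: agree_before_def)

lemma agree_before_mono: "agree_before t \<omega> \<omega>' \<Longrightarrow> s \<le> t \<Longrightarrow> agree_before s \<omega> \<omega>'"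
  by (auto simp: agree_before_def dest: less_le_trans)

lemma agree_before_trans: "agree_before t \<omega> \<omega>' \<Longrightarrow> agree_before t \<omega>' \<omega>'' \<Longrightarrow> agree_before t \<omega> \<omega>''"
  by (auto simp: agree_before_def)

lemma space_left_filtration [simp]: "space (left_filtration t) = cadlag_paths"
  by (simp add: left_filtration_def)

lemma sets_left_filtration_subset: "sets (left_filtration t) \<subseteq> sets path_space"
  unfolding left_filtration_def path_space_def by (rule sets_path_sigma_mono) auto

lemma space_aug_left_filtration [simp]: "space (aug_left_filtration t) = space aug_space"
  by (simp add: aug_left_filtration_def aug_space_def space_pair_measure)

lemma sets_aug_left_filtration_subset: "sets (aug_left_filtration t) \<subseteq> sets aug_space"
  unfolding aug_left_filtration_def aug_space_def sets_pair_measure space_left_filtration space_path_space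
  by (rule sigma_sets_mono') (use sets_left_filtration_subset in blast)

lemma space_lifted_left_filtration [simp]: "space (lifted_left_filtration t) = space aug_space"
  by (simp add: lifted_left_filtration_def)

lemma sets_lifted_left_filtration:
  "sets (lifted_left_filtration t) = {{\<omega> \<in> space aug_space. snd \<omega> \<in> A} | A. A \<in> sets (left_filtration t)}"
proof -
  have "snd \<in> space aug_space \<rightarrow> space (left_filtration t)"
    by (auto simp: space_aug_space)
  then have "sets (lifted_left_filtration t) =
      {snd -` A \<inter> space aug_space | A. A \<in> sets (left_filtration t)}"
    unfolding lifted_left_filtration_def by (rule sets_vimage_algebra2)
  also have "\<dots> = {{\<omega> \<in> space aug_space. snd \<omega> \<in> A} | A. A \<in> sets (left_filtration t)}"
    by (intro Collect_cong ex_cong1) auto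
  finally show ?thesis .
qed

lemma aug_left_filtration_snd:
  assumes "A \<in> sets (left_filtration t)"
  shows "{\<omega> \<in> space aug_space. snd \<omega> \<in> A} \<in> sets (aug_left_filtration t)"
  using sets_Collect_in[of snd "aug_left_filtration t" "left_filtration t" A] assms
  by (simp add: aug_left_filtration_def[of t] flip: space_aug_left_filtration[of t])

lemma agree_left_filtration:
  assumes "A \<in> sets (aug_left_filtration t)" "agree_before t \<omega> \<omega>'" "\<omega> \<in> space aug_space" "\<omega>' \<in> space aug_space"
  shows "\<omega> \<in> A \<longleftrightarrow> \<omega>' \<in> A"
proof (rule sigma_sets_same_atom)
  show "A \<in> sigma_sets (space borel \<times> space (left_filtration t))
      {a \<times> b | a b. a \<in> sets borel \<and> b \<in> sets (left_filtration t)}"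
    using assms(1) by (simp add: aug_left_filtration_def sets_pair_measure)
  fix g :: "('a \<times> 'a path) set"
  assume "g \<in> {a \<times> b | a b. a \<in> sets borel \<and> b \<in> sets (left_filtration t)}"
  then obtain a b where g: "g = a \<times> b" "b \<in> sets (left_filtration t)" by blast
  have "snd \<omega> \<in> b \<longleftrightarrow> snd \<omega>' \<in> b"
    by (rule sigma_sets_same_atom[OF g(2)[unfolded left_filtration_def sets_path_sigma]])
      (use assms in \<open>auto simp: space_aug_space agree_before_def\<close>)
  then show "\<omega> \<in> g \<longleftrightarrow> \<omega>' \<in> g"
    using assms(2) by (auto simp: g agree_before_def mem_Times_iff)
qed (use assms in \<open>auto simp: space_aug_space mem_Times_iff\<close>)

text \<open>This is Galmarini's test. The event \<open>\<eta> \<le> \<eta> \<omega>\<close> belongs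
  to the strict past at \<open>\<eta> \<omega>\<close> and contains \<open>\<omega>\<close>, hence
  also \<open>\<omega>'\<close>. The same argument at the level \<open>\<eta> \<omega>'\<close>,
  before which the paths still agree, gives the reverse inequality.\<close>

lemma stopping_time_agree:
  assumes \<eta>: "stopping_time aug_left_filtration \<eta>" and agree: "agree_before (\<eta> \<omega>) \<omega> \<omega>'"
    and \<omega>: "\<omega> \<in> space aug_space" "\<omega>' \<in> space aug_space"
  shows "\<eta> \<omega>' = \<eta> \<omega>"
proof -
  have m: "{\<omega> \<in> space aug_space. \<eta> \<omega> \<le> t} \<in> sets (aug_left_filtration t)" for t
    using stopping_timeD[OF \<eta>, of t] by (simp add: pred_def)
  have le: "\<eta> \<omega>' \<le> \<eta> \<omega>"
    using agree_left_filtration[OF m agree \<omega>] \<omega> by auto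
  then have "\<eta> \<omega> \<le> \<eta> \<omega>'"
    using agree_left_filtration[OF m agree_before_mono[OF agree le] \<omega>] \<omega> by auto
  with le show ?thesis by simp
qed

abbreviation initial_events :: "('e::polish_space \<times> 'e path) set set" where
  "initial_events \<equiv> {{\<omega> \<in> space aug_space. fst \<omega> \<in> B} | B. B \<in> sets borel}"

abbreviation past_events :: "('e::polish_space \<times> 'e path \<Rightarrow> ennreal) \<Rightarrow> ('e \<times> 'e path) set set" where
  "past_events \<eta> \<equiv> {A \<inter> {\<omega> \<in> space aug_space. t < \<eta> \<omega>} | A t. A \<in> sets (aug_left_filtration t)}"

lemma space_aug_strict_past [simp]: "space (aug_strict_past \<eta>) = space aug_space"
  unfolding aug_strict_past_def by (rule space_measure_of) blast

lemma sets_aug_strict_past: "sets (aug_strict_past \<eta>) = sigma_sets (space aug_space)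
     (initial_events \<union> past_events \<eta>)"
  unfolding aug_strict_past_def by (rule sets_measure_of) blast

text \<open>Consider a generator with level \<open>t\<close>. If \<open>t < \<eta> \<omega>\<close>,
  the paths agree before \<open>t\<close> and the factor from the filtration does not separate them;
  otherwise both lie outside, because the two stopping times coincide.\<close>

lemma agree_strict_past:
  assumes A: "A \<in> sets (aug_strict_past \<eta>)" and \<eta>: "stopping_time aug_left_filtration \<eta>"
    and agree: "agree_before (\<eta> \<omega>) \<omega> \<omega>'" and \<omega>: "\<omega> \<in> space aug_space" "\<omega>' \<in> space aug_space"
  shows "\<omega> \<in> A \<longleftrightarrow> \<omega>' \<in> A"
proof (rule sigma_sets_same_atom[OF A[unfolded sets_aug_strict_past] \<omega>])
  fix g assume "g \<in> initial_events \<union> past_events \<eta>"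
  then show "\<omega> \<in> g \<longleftrightarrow> \<omega>' \<in> g"
  proof
    assume "g \<in> past_events \<eta>"
    then obtain A t where g: "g = A \<inter> {\<omega> \<in> space aug_space. t < \<eta> \<omega>}" "A \<in> sets (aug_left_filtration t)"
      by blast
    show ?thesis
    proof (cases "t < \<eta> \<omega>")
      case True
      then show ?thesis
        using agree_left_filtration[OF g(2) agree_before_mono[OF agree] \<omega>]
          stopping_time_agree[OF \<eta> agree \<omega>] \<omega> by (simp add: g)
    qed (use stopping_time_agree[OF \<eta> agree \<omega>] g in simp)
  qed (use agree \<omega> in \<open>auto simp: agree_before_def\<close>)
qed

lemma sets_aug_strict_past_subset:
  assumes [measurable]: "\<eta> \<in> aug_space \<rightarrow>\<^sub>M borel"
  shows "sets (aug_strict_past \<eta>) \<subseteq> sets aug_space"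
  unfolding sets_aug_strict_past
proof (rule sets.sigma_sets_subset, intro Un_least subsetI)
  fix g assume "g \<in> initial_events"
  then show "g \<in> sets aug_space" by auto
next
  fix g assume "g \<in> past_events \<eta>"
  then obtain A t where "g = A \<inter> {\<omega> \<in> space aug_space. t < \<eta> \<omega>}" "A \<in> sets aug_space"
    using sets_aug_left_filtration_subset by blast
  then show "g \<in> sets aug_space" by simp
qed

section \<open>Times, marks and strict pasts of a policy\<close>

locale impulse_policy =
  fixes S :: "'z measure"
    and \<tau> :: "nat \<Rightarrow> 'e::polish_space \<times> 'e path \<Rightarrow> ennreal"
    and Z :: "nat \<Rightarrow> 'e \<times> 'e path \<Rightarrow> 'z"
  assumes policy: "nominal_impulse_policy S \<tau> Z"
begin

lemma later_policy:
  assumes "k \<ge> 2"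
  obtains \<sigma> \<zeta> where "stopping_time left_filtration \<sigma>"
    "\<zeta> \<in> strict_past cadlag_paths left_filtration \<sigma> \<rightarrow>\<^sub>M S"
    "\<And>\<omega>. \<omega> \<in> space aug_space \<Longrightarrow> \<tau> k \<omega> = \<sigma> (snd \<omega>)" "\<And>\<omega>. \<omega> \<in> space aug_space \<Longrightarrow> Z k \<omega> = \<zeta> (snd \<omega>)"
  using policy assms unfolding nominal_impulse_policy_def by metis

lemma stopping_\<tau>: "k \<ge> 1 \<Longrightarrow> stopping_time aug_left_filtration (\<tau> k)"
proof (cases "k = 1")
  case True
  then show ?thesis
    using policy by (simp add: nominal_impulse_policy_def)
next
  case False
  moreover assume "k \<ge> 1"
  ultimately have "k \<ge> 2" by simp
  then obtain \<sigma> \<zeta> where \<sigma>: "stopping_time left_filtration \<sigma>" "\<And>\<omega>. \<omega> \<in> space aug_space \<Longrightarrow> \<tau> k \<omega> = \<sigma> (snd \<omega>)"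
    using later_policy by metis
  show ?thesis
  proof
    fix t
    have "{p \<in> cadlag_paths. \<sigma> p \<le> t} \<in> sets (left_filtration t)"
      using stopping_timeD[OF \<sigma>(1), of t] by (simp add: pred_def)
    from aug_left_filtration_snd[OF this]
    have "{\<omega> \<in> space aug_space. snd \<omega> \<in> cadlag_paths \<and> \<sigma> (snd \<omega>) \<le> t} \<in> sets (aug_left_filtration t)"
      by simp
    also have "{\<omega> \<in> space aug_space. snd \<omega> \<in> cadlag_paths \<and> \<sigma> (snd \<omega>) \<le> t} = {\<omega> \<in> space aug_space. \<tau> k \<omega> \<le> t}"
      by (intro Collect_cong conj_cong refl) (simp_all add: \<sigma>(2), simp add: space_aug_space)
    finally show "Measurable.pred (aug_left_filtration t) (\<lambda>\<omega>. \<tau> k \<omega> \<le> t)"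
      by (simp add: pred_def)
  qed
qed

lemma measurable_\<tau> [measurable]: "k \<ge> 1 \<Longrightarrow> \<tau> k \<in> aug_space \<rightarrow>\<^sub>M borel"
  by (rule measurable_stopping_time[OF stopping_\<tau>]) (auto simp: sets_aug_left_filtration_subset)

lemma \<tau>_agree: "k \<ge> 1 \<Longrightarrow> agree_before (\<tau> k \<omega>) \<omega> \<omega>' \<Longrightarrow> \<omega> \<in> space aug_space \<Longrightarrow> \<omega>' \<in> space aug_space \<Longrightarrow>
    \<tau> k \<omega>' = \<tau> k \<omega>"
  using stopping_time_agree[OF stopping_\<tau>] .

lemma \<tau>_less: "\<omega> \<in> space aug_space \<Longrightarrow> k \<ge> 1 \<Longrightarrow> \<tau> k \<omega> < \<infinity> \<Longrightarrow> \<tau> k \<omega> < \<tau> (Suc k) \<omega>"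
  and \<tau>_infinite: "\<omega> \<in> space aug_space \<Longrightarrow> k \<ge> 1 \<Longrightarrow> \<tau> k \<omega> = \<infinity> \<Longrightarrow> \<tau> (Suc k) \<omega> = \<infinity>"
  using policy unfolding nominal_impulse_policy_def by blast+

text \<open>Only the first intervention may happen at time 0. This excludes the left limit at 0,
  which is the value at 0-, for later interventions, whose strict past does not contain that
  value.\<close>

lemma \<tau>_pos:
  assumes "\<omega> \<in> space aug_space" "k \<ge> 2"
  shows "\<tau> k \<omega> > 0"
proof -
  obtain j where "k = Suc j" "j \<ge> 1"
    using assms(2) by (cases k) auto
  then show ?thesis
    using \<tau>_less[OF assms(1), of j] \<tau>_infinite[OF assms(1), of j]
    by (cases "\<tau> j \<omega> = \<infinity>") (auto simp: top.not_eq_extremum intro: le_less_trans)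
qed

lemma space_policy_past [simp]: "space (policy_past \<tau> k) = space aug_space"
  unfolding policy_past_def strict_past_def by (auto intro!: space_measure_of)

lemma sets_policy_past_later:
  "k \<noteq> 1 \<Longrightarrow> sets (policy_past \<tau> k) = sigma_sets (space aug_space)
    {A \<inter> {\<omega> \<in> space aug_space. t < \<tau> k \<omega>} | A t. A \<in> sets (lifted_left_filtration t)}"
  unfolding policy_past_def strict_past_def by (auto intro!: sets_measure_of)

text \<open>For \<open>k \<noteq> 1\<close> the strict past of the policy does not include the value
  at 0-. The inclusion transfers measurability and agreement from the augmented strict past to every
  index.\<close>

lemma sets_policy_past_subset: "sets (policy_past \<tau> k) \<subseteq> sets (aug_strict_past (\<tau> k))"
proof (cases "k = 1")
  case False
  have "sets (lifted_left_filtration t) \<subseteq> sets (aug_left_filtration t)" for t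
    unfolding sets_lifted_left_filtration using aug_left_filtration_snd by blast
  then show ?thesis
    unfolding sets_policy_past_later[OF False] sets_aug_strict_past by (intro sigma_sets_mono') blast
qed (simp add: policy_past_def)

lemma sets_policy_past_aug_space: "k \<ge> 1 \<Longrightarrow> sets (policy_past \<tau> k) \<subseteq> sets aug_space"
  using sets_policy_past_subset[of k] sets_aug_strict_past_subset[OF measurable_\<tau>[of k]] by blast

lemma measurable_policy_past_aug_space:
  "k \<ge> 1 \<Longrightarrow> f \<in> policy_past \<tau> k \<rightarrow>\<^sub>M N \<Longrightarrow> f \<in> aug_space \<rightarrow>\<^sub>M N"
  using measurable_mono[OF order_refl refl sets_policy_past_aug_space space_policy_past] by blast

lemma agree_policy_past:
  assumes "A \<in> sets (policy_past \<tau> k)" "k \<ge> 1" "agree_before (\<tau> k \<omega>) \<omega> \<omega>'"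
    "\<omega> \<in> space aug_space" "\<omega>' \<in> space aug_space"
  shows "\<omega> \<in> A \<longleftrightarrow> \<omega>' \<in> A"
  using agree_strict_past[OF _ stopping_\<tau>] sets_policy_past_subset assms by blast

text \<open>These events generate in both forms of the strict past, so arguments based on them need
  no distinction between the first and the later interventions.\<close>

lemma policy_past_generator:
  assumes A: "A \<in> sets (left_filtration t)"
  shows "{\<omega> \<in> space aug_space. snd \<omega> \<in> A \<and> t < \<tau> k \<omega>} \<in> sets (policy_past \<tau> k)"
proof -
  let ?a = "{\<omega> \<in> space aug_space. snd \<omega> \<in> A}" and ?b = "{\<omega> \<in> space aug_space. t < \<tau> k \<omega>}"
  have "?a \<inter> ?b \<in> sets (policy_past \<tau> k)"
  proof (cases "k = 1")
    case True
    then show ?thesis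
      unfolding policy_past_def if_P[OF True] sets_aug_strict_past
      using aug_left_filtration_snd[OF A] by (intro sigma_sets.Basic) blast
  next
    case False
    then show ?thesis
      unfolding sets_policy_past_later[OF False] sets_lifted_left_filtration
      using A by (intro sigma_sets.Basic) blast
  qed
  also have "?a \<inter> ?b = {\<omega> \<in> space aug_space. snd \<omega> \<in> A \<and> t < \<tau> k \<omega>}" by blast
  finally show ?thesis .
qed

lemma measurable_\<tau>_policy_past [measurable]: "\<tau> k \<in> policy_past \<tau> k \<rightarrow>\<^sub>M borel"
proof (rule borel_measurableI_greater)
  fix t
  have "{\<omega> \<in> space aug_space. snd \<omega> \<in> space (left_filtration t) \<and> t < \<tau> k \<omega>} \<in> sets (policy_past \<tau> k)"
    by (rule policy_past_generator) (rule sets.top)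
  also have "{\<omega> \<in> space aug_space. snd \<omega> \<in> space (left_filtration t) \<and> t < \<tau> k \<omega>} =
      {\<omega> \<in> space (policy_past \<tau> k). t < \<tau> k \<omega>}"
    by (auto simp: space_aug_space)
  finally show "{\<omega> \<in> space (policy_past \<tau> k). t < \<tau> k \<omega>} \<in> sets (policy_past \<tau> k)" .
qed

lemma measurable_fst_policy_past: "fst \<in> policy_past \<tau> 1 \<rightarrow>\<^sub>M borel"
proof (rule measurableI)
  fix B :: "'e set" assume "B \<in> sets borel"
  then have "{\<omega> \<in> space aug_space. fst \<omega> \<in> B} \<in> sets (policy_past \<tau> 1)"
    unfolding policy_past_def if_P[OF refl] sets_aug_strict_past by (intro sigma_sets.Basic) blast
  then show "fst -` B \<inter> space (policy_past \<tau> 1) \<in> sets (policy_past \<tau> 1)"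
    by (simp add: vimage_def Int_def conj_commute)
qed simp

text \<open>The value at time \<open>s\<close> is not known in the strict past at \<open>s\<close>,
  only in the strict past at any later time. The event that \<open>s\<close> lies before the
  intervention is therefore exhausted by the events that \<open>s + 1 / Suc n\<close> does.\<close>

lemma measurable_value_before:
  "(\<lambda>\<omega>. if 0 \<le> s \<and> ennreal s < \<tau> k \<omega> then snd \<omega> s else c) \<in> policy_past \<tau> k \<rightarrow>\<^sub>M borel"
(is "?h \<in> _")
proof (cases "0 \<le> s")
  case True
  show ?thesis
  proof (rule measurableI)
    fix B :: "'e set" assume B: "B \<in> sets borel"
    let ?E = "\<lambda>n. {\<omega> \<in> space aug_space. snd \<omega> \<in> {p \<in> cadlag_paths. p s \<in> B} \<and> ennreal (s + 1 / Suc n) < \<tau> k \<omega>}"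
    have E: "?E n \<in> sets (policy_past \<tau> k)" for n
    proof (rule policy_past_generator)
      have "s < s + 1 / Suc n" by simp
      then have "ennreal s < ennreal (s + 1 / Suc n)"
        using True by (intro ennreal_lessI add_nonneg_pos) simp_all
      then have "(\<lambda>p. p s) \<in> left_filtration (ennreal (s + 1 / Suc n)) \<rightarrow>\<^sub>M borel"
        unfolding left_filtration_def using True by (intro measurable_path_eval) simp
      from sets_Collect_in[OF this B]
      show "{p \<in> cadlag_paths. p s \<in> B} \<in> sets (left_filtration (ennreal (s + 1 / Suc n)))"
        by simp
    qed
    have ex: "\<exists>n. ennreal (s + 1 / Suc n) < \<tau> k \<omega>" if "ennreal s < \<tau> k \<omega>" for \<omega>
    proof -
      have "(\<lambda>n. ennreal (s + 1 / Suc n)) \<longlonglongrightarrow> ennreal (s + 0)"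
        by (intro tendsto_intros LIMSEQ_Suc[OF lim_1_over_n])
      then have "\<forall>\<^sub>F n in sequentially. ennreal (s + 1 / Suc n) < \<tau> k \<omega>"
        using that by (intro order_tendstoD) simp_all
      then show ?thesis
        by (auto simp: eventually_sequentially)
    qed
    have less: "ennreal s < \<tau> k \<omega>" if "ennreal (s + 1 / Suc n) < \<tau> k \<omega>" for n \<omega>
      using that by (rule le_less_trans[rotated]) (intro ennreal_leI, simp)
    have neg: "{\<omega> \<in> space (policy_past \<tau> k). \<not> ennreal s < \<tau> k \<omega>} \<in> sets (policy_past \<tau> k)"
      by measurable
    have "?h -` B \<inter> space (policy_past \<tau> k) =
        (\<Union>n. ?E n) \<union> (if c \<in> B then {\<omega> \<in> space (policy_past \<tau> k). \<not> ennreal s < \<tau> k \<omega>} else {})"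
    proof (intro set_eqI)
      fix \<omega>
      show "\<omega> \<in> ?h -` B \<inter> space (policy_past \<tau> k) \<longleftrightarrow>
          \<omega> \<in> (\<Union>n. ?E n) \<union> (if c \<in> B then {\<omega> \<in> space (policy_past \<tau> k). \<not> ennreal s < \<tau> k \<omega>} else {})"
      proof (cases "ennreal s < \<tau> k \<omega>")
        case t: True
        then show ?thesis
          using ex[OF t] True by (auto simp: space_aug_space)
      next
        case f: False
        then have "\<omega> \<notin> (\<Union>n. ?E n)"
          using less by blast
        with f show ?thesis by simp blast
      qed
    qed
    also have "\<dots> \<in> sets (policy_past \<tau> k)"
      using E neg by (auto intro!: sets.Un sets.countable_UN)
    finally show "?h -` B \<inter> space (policy_past \<tau> k)
        \<in> sets (policy_past \<tau> k)" .
  qed simp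
qed simp

lemma measurable_left_limit:
  "(\<lambda>\<omega>. left_limit \<omega> (\<tau> k \<omega>)) \<in> restrict_space (policy_past \<tau> k) {\<omega> \<in> space aug_space. \<tau> k \<omega> < \<infinity>} \<rightarrow>\<^sub>M borel"
  if "k \<ge> 1"
proof -
  let ?G = "policy_past \<tau> k" and ?A = "{\<omega> \<in> space aug_space. \<tau> k \<omega> < \<infinity>}"
  let ?r = "\<lambda>\<omega>. enn2real (\<tau> k \<omega>)"
  let ?l = "\<lambda>\<omega>. if \<tau> k \<omega> = 0 \<or> \<tau> k \<omega> = \<infinity> then (if k = 1 then fst \<omega> else undefined) else Lim (at_left (?r \<omega>)) (snd \<omega>)"
  have lim: "(\<lambda>\<omega>. Lim (at_left (?r \<omega>)) (snd \<omega>)) \<in> restrict_space ?G {\<omega>. 0 < \<tau> k \<omega> \<and> \<tau> k \<omega> < \<infinity>} \<rightarrow>\<^sub>M borel"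
  proof (rule borel_measurable_LIMSEQ_metric)
    \<comment> \<open>With \<open>i = \<lceil>r * Suc n\<rceil>\<close> this is the largest multiple
      of \<open>1 / Suc n\<close> strictly below \<open>r\<close>. It is nonnegative when
      \<open>r > 0\<close>, so the path is sampled only at admissible times before the
      intervention.\<close>
    define s where "s n i = (of_int i - 1) / real (Suc n)" for n :: nat and i :: int
    define X where "X u \<omega> = (if 0 \<le> u \<and> ennreal u < \<tau> k \<omega> then snd \<omega> u else undefined)" for u :: real and \<omega>
    show "(\<lambda>\<omega>. X (s n \<lceil>?r \<omega> * Suc n\<rceil>) \<omega>) \<in> restrict_space ?G {\<omega>. 0 < \<tau> k \<omega> \<and> \<tau> k \<omega> < \<infinity>} \<rightarrow>\<^sub>M borel" for n
    proof (rule measurable_restrict_space1, rule measurable_compose_countable[where g = "\<lambda>\<omega>. \<lceil>?r \<omega> * Suc n\<rceil>"])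
      show "X (s n i) \<in> ?G \<rightarrow>\<^sub>M borel" for i
        unfolding X_def by (rule measurable_value_before)
    qed measurable
    fix \<omega> assume "\<omega> \<in> space (restrict_space ?G {\<omega>. 0 < \<tau> k \<omega> \<and> \<tau> k \<omega> < \<infinity>})"
    then have \<omega>: "snd \<omega> \<in> cadlag_paths" and t: "0 < \<tau> k \<omega>" "\<tau> k \<omega> < \<infinity>"
      by (auto simp: space_restrict_space space_aug_space)
    then obtain r where r: "\<tau> k \<omega> = ennreal r" "r > 0"
      by (cases "\<tau> k \<omega>") (auto simp: ennreal_eq_0_iff zero_less_iff_neq_zero)
    have u: "s n \<lceil>r * Suc n\<rceil> < r" "r - 1 / Suc n \<le> s n \<lceil>r * Suc n\<rceil>" for n
    proof -
      have "of_int \<lceil>r * Suc n\<rceil> - 1 < r * Suc n" by linarith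
      then show "s n \<lceil>r * Suc n\<rceil> < r"
        unfolding s_def by (subst pos_divide_less_eq) simp_all
      have "r * Suc n \<le> of_int \<lceil>r * Suc n\<rceil>" by linarith
      then have "r \<le> of_int \<lceil>r * Suc n\<rceil> / Suc n"
        by (subst pos_le_divide_eq) simp_all
      then show "r - 1 / Suc n \<le> s n \<lceil>r * Suc n\<rceil>"
        unfolding s_def diff_divide_distrib by simp
    qed
    have u0: "0 \<le> s n \<lceil>r * Suc n\<rceil>" for n
    proof -
      have "0 < r * Suc n" using r(2) by simp
      then have "1 \<le> \<lceil>r * Suc n\<rceil>" by linarith
      then show ?thesis by (simp add: s_def)
    qed
    have "X (s n \<lceil>?r \<omega> * Suc n\<rceil>) \<omega> = snd \<omega> (s n \<lceil>r * Suc n\<rceil>)" for n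
      using u(1)[of n] u0[of n] r by (simp add: X_def ennreal_lessI)
    moreover have "(\<lambda>n. snd \<omega> (s n \<lceil>r * Suc n\<rceil>)) \<longlonglongrightarrow> Lim (at_left r) (snd \<omega>)"
      by (rule filterlim_compose[OF cadlag_left_lim[OF \<omega> r(2)] filterlim_at_left_sequentially[OF u]])
    ultimately show "(\<lambda>n. X (s n \<lceil>?r \<omega> * Suc n\<rceil>) \<omega>) \<longlonglongrightarrow> Lim (at_left (?r \<omega>)) (snd \<omega>)"
      using r by simp
  qed
  have "?l \<in> ?G \<rightarrow>\<^sub>M borel"
  proof (subst measurable_If_restrict_space_iff)
    show "{\<omega> \<in> space ?G. \<tau> k \<omega> = 0 \<or> \<tau> k \<omega> = \<infinity>} \<in> sets ?G" by measurable
    have eq: "{\<omega>. \<not> (\<tau> k \<omega> = 0 \<or> \<tau> k \<omega> = \<infinity>)} = {\<omega>. 0 < \<tau> k \<omega> \<and> \<tau> k \<omega> < \<infinity>}"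
      by (auto simp: zero_less_iff_neq_zero less_top)
    show "(\<lambda>\<omega>. if k = 1 then fst \<omega> else undefined) \<in> restrict_space ?G {\<omega>. \<tau> k \<omega> = 0 \<or> \<tau> k \<omega> = \<infinity>} \<rightarrow>\<^sub>M borel \<and>
        (\<lambda>\<omega>. Lim (at_left (?r \<omega>)) (snd \<omega>)) \<in> restrict_space ?G {\<omega>. \<not> (\<tau> k \<omega> = 0 \<or> \<tau> k \<omega> = \<infinity>)} \<rightarrow>\<^sub>M borel"
      unfolding eq using lim measurable_fst_policy_past
      by (cases "k = 1") (auto intro!: measurable_restrict_space1)
  qed
  then have "?l \<in> restrict_space ?G ?A \<rightarrow>\<^sub>M borel"
    by (rule measurable_restrict_space1)
  then show ?thesis
  proof (rule measurable_cong[THEN iffD1, rotated])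
    fix \<omega> assume "\<omega> \<in> space (restrict_space ?G ?A)"
    then have \<omega>: "\<omega> \<in> space aug_space" "\<tau> k \<omega> \<noteq> \<infinity>" by (auto simp: space_restrict_space)
    have "k = 1" if "\<tau> k \<omega> = 0"
      using \<tau>_pos[OF \<omega>(1), of k] that \<open>k \<ge> 1\<close> by (cases "k = 1") auto
    with \<omega>(2) show "?l \<omega> = left_limit \<omega> (\<tau> k \<omega>)"
      by (auto simp: left_limit_def)
  qed
qed

text \<open>For \<open>k \<ge> 2\<close> the mark lives on the path space, and the projection to
  that space is measurable between the two strict pasts.\<close>

lemma measurable_Z: "Z k \<in> policy_past \<tau> k \<rightarrow>\<^sub>M S" if "k \<ge> 1"
proof (cases "k = 1")
  case True
  then show ?thesis
    using policy by (simp add: nominal_impulse_policy_def policy_past_def)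
next
  case False
  with that have "k \<ge> 2" by simp
  then obtain \<sigma> \<zeta> where \<sigma>: "\<zeta> \<in> strict_past cadlag_paths left_filtration \<sigma> \<rightarrow>\<^sub>M S"
    "\<And>\<omega>. \<omega> \<in> space aug_space \<Longrightarrow> \<tau> k \<omega> = \<sigma> (snd \<omega>)" "\<And>\<omega>. \<omega> \<in> space aug_space \<Longrightarrow> Z k \<omega> = \<zeta> (snd \<omega>)"
    using later_policy by metis
  have "snd \<in> policy_past \<tau> k \<rightarrow>\<^sub>M strict_past cadlag_paths left_filtration \<sigma>"
    unfolding strict_past_def
  proof (rule measurable_measure_of)
    fix y assume "y \<in> {A \<inter> {p \<in> cadlag_paths. t < \<sigma> p} | A t. A \<in> sets (left_filtration t)}"
    then obtain A t where y: "y = A \<inter> {p \<in> cadlag_paths. t < \<sigma> p}" "A \<in> sets (left_filtration t)" by blast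
    have "snd -` y \<inter> space (policy_past \<tau> k) = {\<omega> \<in> space aug_space. snd \<omega> \<in> A \<and> t < \<tau> k \<omega>}"
      using \<sigma>(2) by (auto simp: y space_aug_space)
    then show "snd -` y \<inter> space (policy_past \<tau> k) \<in> sets (policy_past \<tau> k)"
      using policy_past_generator[OF y(2)] by simp
  qed (auto simp: space_aug_space)
  from measurable_compose[OF this \<sigma>(1)] show ?thesis
    by (subst measurable_cong[OF \<sigma>(3)]) simp_all
qed

end

section \<open>Pasting\<close>

lemma fst_paste [simp]: "fst (paste T w) = fst (fst w)"
  by (simp add: paste_def)

lemma fst_splice [simp]: "fst (splice \<omega> r \<omega>') = fst \<omega>"
  by (simp add: splice_def)

lemma snd_splice: "t \<ge> 0 \<Longrightarrow> snd (splice \<omega> r \<omega>') t = (if t < r then snd \<omega> t else \<omega>' (t - r))"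
  by (simp add: splice_def)

lemma aug_path_eqI:
  assumes "fst a = fst b" "snd a \<in> extensional {0..}" "snd b \<in> extensional {0..}"
    "\<And>t. t \<ge> 0 \<Longrightarrow> snd a t = snd b t"
  shows "a = b"
  using assms by (intro prod_eqI) (auto intro: extensionalityI)

lemma snd_paste_extensional: "snd (paste T w) \<in> extensional {0..}"
  by (simp add: paste_def)

lemma snd_splice_extensional: "snd (splice \<omega> r \<omega>') \<in> extensional {0..}"
  by (simp add: splice_def)

text \<open>Monotone times make the intervals disjoint, so the definite description in
  \<open>paste\<close> has no other candidate than the given index.\<close>

lemma snd_paste:
  assumes T: "mono T" and t: "t \<ge> 0" "T i \<le> ennreal t" "ennreal t < T (Suc i)"
  shows "snd (paste T w) t = piece w i (t - enn2real (T i))"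
proof -
  have "(THE i. T i \<le> ennreal t \<and> ennreal t < T (Suc i)) = i"
  proof (rule the_equality)
    fix j assume j: "T j \<le> ennreal t \<and> ennreal t < T (Suc j)"
    have "\<not> Suc j \<le> i" "\<not> Suc i \<le> j"
      using monoD[OF T, of "Suc j" i] monoD[OF T, of "Suc i" j] t j by (meson leD order_trans)+
    then show "j = i" by simp
  qed (use t in simp)
  then show ?thesis
    using t(1) by (simp add: paste_def Let_def)
qed

lemma interval_of_time:
  fixes T :: "nat \<Rightarrow> 'a::linorder"
  assumes "T 0 \<le> x" "x < T (Suc k)"
  obtains i where "i \<le> k" "T i \<le> x" "x < T (Suc i)"
  using assms(2)
proof (induction k arbitrary: thesis)
  case 0
  then show ?case using assms(1) by blast
next
  case (Suc k)
  show ?case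
  proof (cases "x < T (Suc k)")
    case True
    then show ?thesis
      using Suc.IH Suc.prems(1) le_SucI by metis
  next
    case False
    then show ?thesis
      using Suc.prems by (metis leI order_refl)
  qed
qed

lemma agree_before_splice: "agree_before (ennreal r) \<omega> (splice \<omega> r \<omega>')"
  by (auto simp: agree_before_def snd_splice ennreal_less_iff)

abbreviation stop_after :: "nat \<Rightarrow> (nat \<Rightarrow> ennreal) \<Rightarrow> nat \<Rightarrow> ennreal" where
  "stop_after k T \<equiv> (\<lambda>i. if i \<le> k then T i else \<infinity>)"

lemma mono_stop_after:
  assumes "\<And>i. i < k \<Longrightarrow> T i \<le> T (Suc i)"
  shows "mono (stop_after k T)"
  unfolding mono_iff_le_Suc using assms by simp

lemma agree_paste_stop_after:
  assumes T: "mono T" "T 0 = 0"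
  shows "agree_before (T (Suc k)) (paste T w) (paste (stop_after k T) w)"
  unfolding agree_before_def
proof (intro conjI allI impI)
  fix t :: real assume t: "0 \<le> t" "ennreal t < T (Suc k)"
  then obtain i where i: "i \<le> k" "T i \<le> ennreal t" "ennreal t < T (Suc i)"
    using interval_of_time[of T "ennreal t" k] T(2) by auto
  have "mono (stop_after k T)"
    using T(1) by (intro mono_stop_after) (simp add: monoD)
  from snd_paste[OF this t(1), of i w] snd_paste[OF T(1) t(1) i(2,3), of w] i
  show "snd (paste T w) t = snd (paste (stop_after k T) w) t"
    by simp
qed simp

text \<open>This turns the definite description in \<open>paste\<close> into a recursion by single
  splices, on which the inductions for regularity and measurability run.\<close>

lemma paste_stop_after_Suc:
  assumes T: "\<And>i. i \<le> k \<Longrightarrow> T i \<le> T (Suc i)" "T 0 = 0"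
  shows "paste (stop_after (Suc k) T) w = (if T (Suc k) < \<infinity>
      then splice (paste (stop_after k T) w) (enn2real (T (Suc k))) (piece w (Suc k))
      else paste (stop_after k T) w)"
proof (cases "T (Suc k) = \<infinity>")
  case True
  then have "stop_after (Suc k) T = stop_after k T"
    by (auto simp: le_Suc_eq)
  with True show ?thesis by (simp only:) simp
next
  case False
  then obtain r where r: "T (Suc k) = ennreal r" "r \<ge> 0"
    by (cases "T (Suc k)") auto
  have m: "mono (stop_after (Suc k) T)" "mono (stop_after k T)"
    using T(1) by (intro mono_stop_after; simp)+
  have "paste (stop_after (Suc k) T) w = splice (paste (stop_after k T) w) r (piece w (Suc k))"
  proof (rule aug_path_eqI)
    fix t :: real assume t: "t \<ge> 0"
    show "snd (paste (stop_after (Suc k) T) w) t = snd (splice (paste (stop_after k T) w) r (piece w (Suc k))) t"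
    proof (cases "t < r")
      case True
      then have "ennreal t < T (Suc k)"
        using r t by (simp add: ennreal_lessI)
      then obtain i where i: "i \<le> k" "T i \<le> ennreal t" "ennreal t < T (Suc i)"
        using interval_of_time[of T "ennreal t" k] T(2) by auto
      have "snd (paste (stop_after (Suc k) T) w) t = piece w i (t - enn2real (T i))"
        using snd_paste[OF m(1) t, of i w] i by simp
      moreover have "snd (paste (stop_after k T) w) t = piece w i (t - enn2real (T i))"
        using snd_paste[OF m(2) t, of i w] i by simp
      ultimately show ?thesis
        using t True by (simp add: snd_splice)
    next
      case False
      then have "snd (paste (stop_after (Suc k) T) w) t = piece w (Suc k) (t - r)"
        using snd_paste[OF m(1) t, of "Suc k" w] r by (simp add: ennreal_leI)
      then show ?thesis
        using t False by (simp add: snd_splice)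
    qed
  qed (simp_all add: snd_paste_extensional snd_splice_extensional)
  with r show ?thesis by simp
qed

lemma jump_time_Suc: "jump_time \<tau> w (Suc k) = \<tau> (Suc k) (pasted_path \<tau> k w)"
  by (simp add: pasted_path_def)

declare jump_time.simps(2) [simp del]

definition good_pieces :: "nat \<Rightarrow> 'e::polish_space pieces \<Rightarrow> bool" where
  "good_pieces k w \<longleftrightarrow> (\<forall>i\<le>k. piece w i \<in> cadlag_paths)"

lemma good_pieces_mono: "good_pieces k w \<Longrightarrow> j \<le> k \<Longrightarrow> good_pieces j w"
  by (simp add: good_pieces_def)

lemma pasted_path_0: "good_pieces k w \<Longrightarrow> pasted_path \<tau> 0 w = fst w"
proof -
  assume "good_pieces k w"
  then have e: "snd (fst w) \<in> extensional {0..}"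
    by (auto simp: good_pieces_def piece_def cadlag_paths_def)
  have m: "mono (stop_after 0 (jump_time \<tau> w))"
    by (rule mono_stop_after) simp
  show ?thesis
  proof (rule aug_path_eqI)
    fix t :: real assume "t \<ge> 0"
    with snd_paste[OF m this, of 0 w] show "snd (pasted_path \<tau> 0 w) t = snd (fst w) t"
      by (simp add: pasted_path_def piece_def)
  qed (use e in \<open>simp_all add: pasted_path_def snd_paste_extensional\<close>)
qed

lemma controlled_path_eq: "jump_time \<tau> w \<longlonglongrightarrow> \<infinity> \<Longrightarrow> controlled_path ebar \<tau> w = paste (jump_time \<tau> w) w"
  by (simp add: controlled_path_def)

context impulse_policy
begin

text \<open>The two claims need each other. The properties of the policy apply only to elements of
  the augmented space, so the order of the jump times requires pasted paths to be cadlag; conversely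
  a pasted path is a splice of the previous one only if the times are ordered. The link is that the
  new path agrees with the old one before the last jump time, so \<open>\<tau> (Suc k)\<close> does
  not change when the piece is added. The strict inequality starts at index 1, because the first
  intervention may occur at time 0.\<close>

lemma pasted_path_invariant:
  assumes "good_pieces k w"
  shows "pasted_path \<tau> k w \<in> space aug_space \<and>
    (\<forall>i\<le>k. jump_time \<tau> w i \<le> jump_time \<tau> w (Suc i) \<and>
      (i \<ge> 1 \<longrightarrow> jump_time \<tau> w i < \<infinity> \<longrightarrow> jump_time \<tau> w i < jump_time \<tau> w (Suc i)))"
  using assms
proof (induction k)
  case 0
  then have "fst w \<in> space aug_space"
    by (simp add: space_aug_space good_pieces_def piece_def)
  with 0 show ?case
    by (simp add: pasted_path_0)
next
  case (Suc k)
  let ?T = "jump_time \<tau> w" and ?a = "pasted_path \<tau> k w" and ?b = "pasted_path \<tau> (Suc k) w"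
  have IH: "?a \<in> space aug_space" "\<And>i. i \<le> k \<Longrightarrow> ?T i \<le> ?T (Suc i)"
    "\<And>i. i \<le> k \<Longrightarrow> i \<ge> 1 \<Longrightarrow> ?T i < \<infinity> \<Longrightarrow> ?T i < ?T (Suc i)"
    using Suc.IH good_pieces_mono[OF Suc.prems, of k] by auto
  have b: "?b = (if ?T (Suc k) < \<infinity> then splice ?a (enn2real (?T (Suc k))) (piece w (Suc k)) else ?a)"
    unfolding pasted_path_def by (rule paste_stop_after_Suc) (use IH in simp_all)
  have space: "?b \<in> space aug_space"
    using IH(1) Suc.prems unfolding b
    by (auto simp: space_aug_space good_pieces_def splice_cadlag)
  have "agree_before (?T (Suc k)) ?a ?b"
  proof (cases "?T (Suc k) < \<infinity>")
    case True
    then show ?thesis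
      unfolding b using agree_before_splice[of "enn2real (?T (Suc k))" ?a] by (simp add: less_top)
  qed (simp add: b agree_before_def)
  then have "\<tau> (Suc k) ?b = ?T (Suc k)"
    using \<tau>_agree[of "Suc k" ?a ?b] IH(1) space by (simp add: jump_time_Suc)
  then have "?T (Suc k) < \<infinity> \<Longrightarrow> ?T (Suc k) < ?T (Suc (Suc k))" "?T (Suc k) = \<infinity> \<Longrightarrow> ?T (Suc (Suc k)) = \<infinity>"
    using \<tau>_less[OF space, of "Suc k"] \<tau>_infinite[OF space, of "Suc k"] by (simp_all add: jump_time_Suc[of _ _ "Suc k"])
  then have "?T (Suc k) \<le> ?T (Suc (Suc k))" "?T (Suc k) < \<infinity> \<longrightarrow> ?T (Suc k) < ?T (Suc (Suc k))"
    by (cases "?T (Suc k) = \<infinity>"; simp add: less_top)+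
  with space IH show ?case
    by (auto simp: le_Suc_eq)
qed

lemma pasted_path_in_space: "good_pieces k w \<Longrightarrow> pasted_path \<tau> k w \<in> space aug_space"
  using pasted_path_invariant by blast

lemma pasted_path_Suc:
  assumes "good_pieces k w"
  shows "pasted_path \<tau> (Suc k) w = (if jump_time \<tau> w (Suc k) < \<infinity>
    then splice (pasted_path \<tau> k w) (enn2real (jump_time \<tau> w (Suc k))) (piece w (Suc k)) else pasted_path \<tau> k w)"
  unfolding pasted_path_def
  by (rule paste_stop_after_Suc) (use pasted_path_invariant[OF assms] in simp_all)

lemma pasted_path_cong:
  assumes "good_pieces k w" "fst w = fst w'" "\<And>i. i \<in> {1..k} \<Longrightarrow> snd w i = snd w' i"
  shows "pasted_path \<tau> k w = pasted_path \<tau> k w'"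
  using assms
proof (induction k)
  case 0
  then have "good_pieces 0 w'"
    by (simp add: good_pieces_def piece_def)
  with 0 show ?case by (simp add: pasted_path_0)
next
  case (Suc k)
  have g: "good_pieces k w" using Suc.prems(1) by (rule good_pieces_mono) simp
  have g': "good_pieces k w'"
    using g Suc.prems(2,3) by (auto simp: good_pieces_def piece_def)
  have "pasted_path \<tau> k w = pasted_path \<tau> k w'"
    using Suc g by auto
  then show ?case
    using Suc.prems(3)[of "Suc k"]
    by (simp add: pasted_path_Suc[OF g] pasted_path_Suc[OF g'] jump_time_Suc piece_def)
qed

lemma mono_jump_time:
  assumes "\<And>k. good_pieces k w"
  shows "mono (jump_time \<tau> w)"
  unfolding mono_iff_le_Suc using pasted_path_invariant[OF assms] by blast

lemma agree_controlled_pasted: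
  assumes "\<And>k. good_pieces k w" "jump_time \<tau> w \<longlonglongrightarrow> \<infinity>"
  shows "agree_before (jump_time \<tau> w (Suc k)) (controlled_path ebar \<tau> w) (pasted_path \<tau> k w)"
  using agree_paste_stop_after[OF mono_jump_time[OF assms(1)]] assms(2)
  by (simp add: controlled_path_eq pasted_path_def)

end

section \<open>Regularity and measurability of the controlled path\<close>

lemma const_cadlag: "(\<lambda>t\<in>{0..}. c) \<in> cadlag_paths"
proof -
  have "((\<lambda>t\<in>{0..}. c) \<longlongrightarrow> c) (at_right t)" if "t \<ge> 0" for t :: real
    using eventually_at_right_real[of t "t + 1", simplified] that
    by (intro tendsto_eventually) (erule eventually_mono, simp)
  moreover have "((\<lambda>t\<in>{0..}. c) \<longlongrightarrow> c) (at_left t)" if "t > 0" for t :: real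
    using eventually_at_left_real[OF that]
    by (intro tendsto_eventually) (erule eventually_mono, simp)
  ultimately show ?thesis
    by (auto simp: cadlag_paths_def)
qed

text \<open>One-sided limits are local, so the path of comparison may depend on the time horizon.
  For the right limit at \<open>t\<close> the horizon \<open>t + 1\<close> is used.\<close>

lemma cadlag_if_agree:
  assumes ext: "snd \<omega> \<in> extensional {0..}"
    and agree: "\<And>t. t \<ge> 0 \<Longrightarrow> \<exists>\<omega>'. snd \<omega>' \<in> cadlag_paths \<and> agree_before (ennreal t) \<omega> \<omega>'"
  shows "snd \<omega> \<in> cadlag_paths"
proof -
  have "(snd \<omega> \<longlongrightarrow> snd \<omega> t) (at_right t)" if t: "t \<ge> 0" for t
  proof -
    obtain \<omega>' where \<omega>': "snd \<omega>' \<in> cadlag_paths" "agree_before (ennreal (t + 1)) \<omega> \<omega>'"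
      using agree[of "t + 1"] t by auto
    then have eq: "snd \<omega> s = snd \<omega>' s" if "0 \<le> s" "s < t + 1" for s
      using that by (auto simp: agree_before_def ennreal_lessI)
    have "\<forall>\<^sub>F s in at_right t. s \<in> {t<..<t + 1}"
      by (rule eventually_at_right_real) simp
    then have "\<forall>\<^sub>F s in at_right t. snd \<omega> s = snd \<omega>' s"
      by eventually_elim (use eq t in auto)
    with cadlag_right_lim[OF \<omega>'(1) t] eq[OF t] show ?thesis
      by (simp add: tendsto_cong)
  qed
  moreover have "\<exists>l. (snd \<omega> \<longlongrightarrow> l) (at_left t)" if t: "t > 0" for t
  proof -
    obtain \<omega>' where \<omega>': "snd \<omega>' \<in> cadlag_paths" "agree_before (ennreal t) \<omega> \<omega>'"
      using agree[of t] t by auto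
    have "\<forall>\<^sub>F s in at_left t. s \<in> {0<..<t}"
      by (rule eventually_at_left_real[OF t])
    then have "\<forall>\<^sub>F s in at_left t. snd \<omega> s = snd \<omega>' s"
      by eventually_elim (use \<omega>' in \<open>auto simp: agree_before_def ennreal_lessI\<close>)
    with cadlag_left_lim[OF \<omega>'(1) t] show ?thesis
      by (metis tendsto_cong)
  qed
  ultimately show ?thesis
    using ext by (simp add: cadlag_paths_def)
qed

text \<open>The common form of \<open>product_space\<close> and \<open>initial_space\<close>:
  measurability of pasting is shown once, for every index set that contains the pieces
  involved.\<close>

definition pieces_space :: "nat set \<Rightarrow> 'e::polish_space pieces measure" where
  "pieces_space I = aug_space \<Otimes>\<^sub>M PiM I (\<lambda>_. path_space)"

lemma product_space_eq: "product_space = pieces_space {1..}"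
  by (simp add: product_space_def pieces_space_def)

lemma initial_space_eq: "initial_space k = pieces_space {1..k}"
  by (simp add: initial_space_def pieces_space_def)

lemma good_pieces_space: "w \<in> space (pieces_space I) \<Longrightarrow> {1..k} \<subseteq> I \<Longrightarrow> good_pieces k w"
  by (auto simp: pieces_space_def good_pieces_def piece_def space_pair_measure space_aug_space space_PiM PiE_iff subset_iff)

lemma measurable_fst_pieces [measurable]: "fst \<in> pieces_space I \<rightarrow>\<^sub>M aug_space"
  unfolding pieces_space_def by measurable

lemma measurable_snd_pieces: "i \<in> I \<Longrightarrow> (\<lambda>w. snd w i) \<in> pieces_space I \<rightarrow>\<^sub>M path_space"
  unfolding pieces_space_def by measurable

lemma measurable_piece: "i = 0 \<or> i \<in> I \<Longrightarrow> (\<lambda>w. piece w i) \<in> pieces_space I \<rightarrow>\<^sub>M path_space"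
  unfolding piece_def using measurable_snd_pieces[of i I] by (cases "i = 0") auto

lemma measurable_initial_part: "{1..k} \<subseteq> I \<Longrightarrow> initial_part k \<in> pieces_space I \<rightarrow>\<^sub>M initial_space k"
  unfolding initial_space_def initial_part_def
  by (intro measurable_Pair measurable_fst_pieces measurable_restrict measurable_snd_pieces) auto

context impulse_policy
begin

lemma measurable_pasted_path: "{1..k} \<subseteq> I \<Longrightarrow> pasted_path \<tau> k \<in> pieces_space I \<rightarrow>\<^sub>M aug_space"
proof (induction k)
  case 0
  have "fst \<in> pieces_space I \<rightarrow>\<^sub>M (aug_space :: ('e \<times> 'e path) measure)" by measurable
  then show ?case
    by (rule measurable_cong[THEN iffD2, rotated]) (rule pasted_path_0[OF good_pieces_space[where k = 0 and I = I]], auto)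
next
  case (Suc k)
  have I: "{1..k} \<subseteq> I" "Suc k \<in> I" using Suc.prems by auto
  have p [measurable]: "pasted_path \<tau> k \<in> pieces_space I \<rightarrow>\<^sub>M aug_space" by (rule Suc.IH[OF I(1)])
  have T [measurable]: "(\<lambda>w. jump_time \<tau> w (Suc k)) \<in> pieces_space I \<rightarrow>\<^sub>M borel"
    unfolding jump_time_Suc by measurable
  have "(\<lambda>w. splice (pasted_path \<tau> k w) (enn2real (jump_time \<tau> w (Suc k))) (piece w (Suc k))) \<in> pieces_space I \<rightarrow>\<^sub>M aug_space"
  proof (rule measurable_splice)
    show "snd (pasted_path \<tau> k w) \<in> cadlag_paths" if "w \<in> space (pieces_space I)" for w
      using measurable_space[OF p that] by (simp add: space_aug_space)
    show "(\<lambda>w. snd (pasted_path \<tau> k w) s) \<in> restrict_space (pieces_space I) {w. s < enn2real (jump_time \<tau> w (Suc k))} \<rightarrow>\<^sub>M borel"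
      if "0 \<le> s" for s
      using that by (intro measurable_restrict_space1) measurable
    show "(\<lambda>w. fst (pasted_path \<tau> k w)) \<in> pieces_space I \<rightarrow>\<^sub>M borel"
      by (rule measurable_compose[OF p measurable_aug_fst])
    show "(\<lambda>w. enn2real (jump_time \<tau> w (Suc k))) \<in> pieces_space I \<rightarrow>\<^sub>M borel"
      by measurable
    show "(\<lambda>w. piece w (Suc k)) \<in> pieces_space I \<rightarrow>\<^sub>M path_space"
      using I by (intro measurable_piece) simp
  qed
  then have "(\<lambda>w. if jump_time \<tau> w (Suc k) < \<infinity>
      then splice (pasted_path \<tau> k w) (enn2real (jump_time \<tau> w (Suc k))) (piece w (Suc k)) else pasted_path \<tau> k w)
      \<in> pieces_space I \<rightarrow>\<^sub>M aug_space"
    by measurable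
  then show ?case
    by (rule measurable_cong[THEN iffD2, rotated]) (rule pasted_path_Suc[OF good_pieces_space[OF _ I(1)]])
qed

lemma measurable_jump_time_Suc: "{1..k} \<subseteq> I \<Longrightarrow> (\<lambda>w. jump_time \<tau> w (Suc k)) \<in> pieces_space I \<rightarrow>\<^sub>M borel"
  unfolding jump_time_Suc using measurable_compose[OF measurable_pasted_path measurable_\<tau>] by simp

lemma good_pieces_product_space: "w \<in> space product_space \<Longrightarrow> good_pieces k w"
  unfolding product_space_eq by (rule good_pieces_space) auto

lemma measurable_jump_time: "(\<lambda>w. jump_time \<tau> w k) \<in> product_space \<rightarrow>\<^sub>M borel"
  unfolding product_space_eq by (cases k) (auto intro!: measurable_jump_time_Suc)

text \<open>Before any fixed time only finitely many pieces are used, provided that the jump times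
  tend to infinity; otherwise the path is constant by definition.\<close>

lemma controlled_path_in_space:
  assumes w: "w \<in> space product_space"
  shows "controlled_path ebar \<tau> w \<in> space aug_space"
proof (cases "jump_time \<tau> w \<longlonglongrightarrow> \<infinity>")
  case True
  have "snd (controlled_path ebar \<tau> w) \<in> cadlag_paths"
  proof (rule cadlag_if_agree)
    show "snd (controlled_path ebar \<tau> w) \<in> extensional {0..}"
      using True by (simp add: controlled_path_eq snd_paste_extensional)
    fix t :: real
    have "\<forall>\<^sub>F k in sequentially. ennreal t < jump_time \<tau> w k"
      using order_tendstoD(1)[OF True, of "ennreal t"] by simp
    then obtain k where "ennreal t < jump_time \<tau> w (Suc k)"
      unfolding eventually_sequentially by (meson le_SucI order_refl)
    then have "agree_before (ennreal t) (controlled_path ebar \<tau> w) (pasted_path \<tau> k w)"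
      using agree_before_mono[OF agree_controlled_pasted[OF good_pieces_product_space[OF w] True, of k ebar]] by simp
    then show "\<exists>\<omega>'. snd \<omega>' \<in> cadlag_paths \<and> agree_before (ennreal t) (controlled_path ebar \<tau> w) \<omega>'"
      using pasted_path_in_space[OF good_pieces_product_space[OF w], of k]
      by (intro exI[of _ "pasted_path \<tau> k w"]) (simp add: space_aug_space)
  qed
  then show ?thesis by (simp add: space_aug_space)
qed (simp add: controlled_path_def space_aug_space const_cadlag)

text \<open>The jump times increase, so convergence to infinity is the condition that a countable
  supremum is infinite.\<close>

lemma pred_nonexplosive: "Measurable.pred product_space (\<lambda>w. jump_time \<tau> w \<longlonglongrightarrow> \<infinity>)"
proof -
  have [measurable]: "(\<lambda>w. jump_time \<tau> w k) \<in> product_space \<rightarrow>\<^sub>M borel" for k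
    by (rule measurable_jump_time)
  have "Measurable.pred product_space (\<lambda>w. (SUP k. jump_time \<tau> w k) = \<infinity>)"
    by measurable
  moreover have "jump_time \<tau> w \<longlonglongrightarrow> \<infinity> \<longleftrightarrow> (SUP k. jump_time \<tau> w k) = \<infinity>" if "w \<in> space product_space" for w
    using LIMSEQ_SUP[OF mono_jump_time[OF good_pieces_product_space[OF that]]] LIMSEQ_unique by metis
  ultimately show ?thesis
    by (rule measurable_cong[THEN iffD2, rotated])
qed

text \<open>At a fixed time, the values of the pasted paths are eventually equal to the value of the
  controlled path, so each coordinate is a pointwise limit of measurable functions.\<close>

lemma measurable_controlled_path: "controlled_path ebar \<tau> \<in> product_space \<rightarrow>\<^sub>M aug_space"
proof (rule measurable_aug_spaceI)
  note pred_nonexplosive [measurable]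
  have p [measurable]: "pasted_path \<tau> k \<in> product_space \<rightarrow>\<^sub>M aug_space" for k
    unfolding product_space_eq by (rule measurable_pasted_path) simp
  have f [measurable]: "fst \<in> product_space \<rightarrow>\<^sub>M (aug_space :: ('e \<times> 'e path) measure)"
    unfolding product_space_eq by measurable
  show "snd (controlled_path ebar \<tau> w) \<in> cadlag_paths" if "w \<in> space product_space" for w
    using controlled_path_in_space[OF that] by (simp add: space_aug_space)
  have "(\<lambda>w. if jump_time \<tau> w \<longlonglongrightarrow> \<infinity> then fst (fst w) else ebar) \<in> product_space \<rightarrow>\<^sub>M borel"
    by measurable
  then show "(\<lambda>w. fst (controlled_path ebar \<tau> w)) \<in> product_space \<rightarrow>\<^sub>M borel"
    by (simp add: controlled_path_def if_distrib[of fst] cong: if_cong)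
  fix s :: real assume s: "s \<ge> 0"
  show "(\<lambda>w. snd (controlled_path ebar \<tau> w) s) \<in> product_space \<rightarrow>\<^sub>M borel"
  proof (rule borel_measurable_LIMSEQ_metric)
    show "(\<lambda>w. if jump_time \<tau> w \<longlonglongrightarrow> \<infinity> then snd (pasted_path \<tau> k w) s else ebar) \<in> product_space \<rightarrow>\<^sub>M borel" for k
      using s by measurable
    fix w :: "'e pieces" assume w: "w \<in> space product_space"
    show "(\<lambda>k. if jump_time \<tau> w \<longlonglongrightarrow> \<infinity> then snd (pasted_path \<tau> k w) s else ebar) \<longlonglongrightarrow> snd (controlled_path ebar \<tau> w) s"
    proof (cases "jump_time \<tau> w \<longlonglongrightarrow> \<infinity>")
      case True
      have "\<forall>\<^sub>F k in sequentially. ennreal s < jump_time \<tau> w (Suc k)"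
        using order_tendstoD(1)[OF LIMSEQ_Suc[OF True], of "ennreal s"] by simp
      then have "\<forall>\<^sub>F k in sequentially. snd (pasted_path \<tau> k w) s = snd (controlled_path ebar \<tau> w) s"
        using agree_controlled_pasted[OF good_pieces_product_space[OF w] True, of _ ebar] s
        by (auto elim!: eventually_mono simp: agree_before_def)
      with True show ?thesis
        by (auto intro: tendsto_eventually)
    next
      case False
      then show ?thesis using s by (simp add: controlled_path_def)
    qed
  qed
qed

end

section \<open>Measurability of the jump kernels\<close>

lemma sets_restrict_space_Collect:
  "sets (restrict_space M {x \<in> space M. P x}) = sets (restrict_space M {x. P x})"
  unfolding sets_restrict_space by (rule image_cong) (auto dest: sets.sets_into_space)

text \<open>The jump kernel as a function of a path instead of a sequence of pieces. In this form it
  is measurable for the strict past of the time, hence equal on paths that agree before the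
  time.\<close>

definition jump_law :: "('e::polish_space \<times> 'z \<Rightarrow> 'e measure) \<Rightarrow> 'e \<Rightarrow> (nat \<Rightarrow> 'e \<times> 'e path \<Rightarrow> ennreal) \<Rightarrow>
    (nat \<Rightarrow> 'e \<times> 'e path \<Rightarrow> 'z) \<Rightarrow> nat \<Rightarrow> 'e \<times> 'e path \<Rightarrow> 'e measure" where
  "jump_law Q ebar \<tau> Z k \<omega> = (if \<tau> k \<omega> < \<infinity> then Q (left_limit \<omega> (\<tau> k \<omega>), Z k \<omega>) else return borel ebar)"

lemma jump_kernel_eq: "jump_kernel Q ebar zbar \<tau> Z k w = jump_law Q ebar \<tau> Z (Suc k) (pasted_path \<tau> k w)"
  by (simp add: jump_kernel_def jump_law_def pre_jump_value_def impulse_value_def jump_time_Suc)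

context impulse_policy
begin

lemma measurable_jump_distribution:
  assumes "Q \<in> borel \<Otimes>\<^sub>M S \<rightarrow>\<^sub>M prob_algebra borel" "k \<ge> 1"
  shows "(\<lambda>\<omega>. Q (left_limit \<omega> (\<tau> k \<omega>), Z k \<omega>))
    \<in> restrict_space (policy_past \<tau> k) {\<omega> \<in> space aug_space. \<tau> k \<omega> < \<infinity>} \<rightarrow>\<^sub>M prob_algebra borel"
  by (rule measurable_compose[OF measurable_Pair[OF measurable_left_limit[OF assms(2)]
        measurable_restrict_space1[OF measurable_Z[OF assms(2)]]] assms(1)])

lemma measurable_jump_law:
  assumes "Q \<in> borel \<Otimes>\<^sub>M S \<rightarrow>\<^sub>M prob_algebra borel" "k \<ge> 1"
  shows "jump_law Q ebar \<tau> Z k \<in> policy_past \<tau> k \<rightarrow>\<^sub>M prob_algebra borel"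
  unfolding jump_law_def
proof (subst measurable_If_restrict_space_iff)
  show "{\<omega> \<in> space (policy_past \<tau> k). \<tau> k \<omega> < \<infinity>} \<in> sets (policy_past \<tau> k)" by measurable
  have "return borel ebar \<in> space (prob_algebra borel)"
    by (simp add: space_prob_algebra prob_space_return)
  then show "(\<lambda>\<omega>. Q (left_limit \<omega> (\<tau> k \<omega>), Z k \<omega>)) \<in> restrict_space (policy_past \<tau> k) {\<omega>. \<tau> k \<omega> < \<infinity>} \<rightarrow>\<^sub>M prob_algebra borel \<and>
      (\<lambda>\<omega>. return borel ebar) \<in> restrict_space (policy_past \<tau> k) {\<omega>. \<not> \<tau> k \<omega> < \<infinity>} \<rightarrow>\<^sub>M prob_algebra borel"
    using measurable_jump_distribution[OF assms]
    by (simp add: measurable_cong_sets[OF sets_restrict_space_Collect[of "policy_past \<tau> k", simplified] refl])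
qed

lemma measurable_jump_kernel:
  assumes "Q \<in> borel \<Otimes>\<^sub>M S \<rightarrow>\<^sub>M prob_algebra borel"
  shows "jump_kernel Q ebar zbar \<tau> Z k \<in> initial_space k \<rightarrow>\<^sub>M prob_algebra borel"
  unfolding jump_kernel_eq initial_space_eq
  by (rule measurable_compose[OF measurable_pasted_path[OF order_refl]
        measurable_policy_past_aug_space[OF _ measurable_jump_law[OF assms]]]) simp_all

end

section \<open>Universally measurable kernels and the theorem of Ionescu Tulcea\<close>

text \<open>Every generating event has its own null set off which its mass equals a measurable
  function, and the union over the countable generator is still null. Replacing the kernel there by
  the constant \<open>P c\<close> makes the masses of all generating events measurable; for
  probability measures and an intersection-stable generator this gives measurability of the
  kernel.\<close>

lemma kernel_modification:
  fixes P :: "'a \<Rightarrow> 'b measure"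
  assumes P: "\<And>x. prob_space (P x)" "\<And>x. sets (P x) = sets M"
    and G: "countable G" "Int_stable G" "G \<subseteq> Pow (space M)" "sets M = sigma_sets (space M) G"
    and um: "\<And>F. F \<in> G \<Longrightarrow> (\<lambda>x. emeasure (P x) F) \<in> borel_measurable (completion \<mu>)"
  obtains N where "N \<in> null_sets \<mu>" "(\<lambda>x. if x \<in> N then P c else P x) \<in> \<mu> \<rightarrow>\<^sub>M prob_algebra M"
proof -
  have "\<exists>N g. N \<in> null_sets \<mu> \<and> g \<in> borel_measurable \<mu> \<and> (\<forall>x\<in>space \<mu> - N. emeasure (P x) F = g x)" if F: "F \<in> G" for F
  proof -
    obtain g where g: "g \<in> borel_measurable \<mu>" "AE x in \<mu>. emeasure (P x) F = g x"
      using completion_ex_borel_measurable[OF um[OF F]] by blast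
    from g(2) obtain N where "{x \<in> space \<mu>. emeasure (P x) F \<noteq> g x} \<subseteq> N" "N \<in> null_sets \<mu>"
      by (auto elim!: AE_E)
    with g(1) show ?thesis
      by (intro exI[of _ N] exI[of _ g]) blast
  qed
  then obtain N g where N: "\<And>F. F \<in> G \<Longrightarrow> N F \<in> null_sets \<mu>"
    and g: "\<And>F. F \<in> G \<Longrightarrow> g F \<in> borel_measurable \<mu>"
    and eq: "\<And>F x. F \<in> G \<Longrightarrow> x \<in> space \<mu> - N F \<Longrightarrow> emeasure (P x) F = g F x"
    by metis
  let ?N = "\<Union>F\<in>G. N F"
  have null: "?N \<in> null_sets \<mu>"
    using null_sets_UN'[OF G(1) N] by simp
  have "(\<lambda>x. if x \<in> ?N then P c else P x) \<in> \<mu> \<rightarrow>\<^sub>M prob_algebra M"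
  proof (rule measurable_prob_algebra_generated[OF G(4,2,3)])
    fix F assume F: "F \<in> G"
    have [measurable]: "?N \<in> sets \<mu>" "g F \<in> borel_measurable \<mu>"
      using null g[OF F] by auto
    have "(\<lambda>x. if x \<in> ?N then emeasure (P c) F else g F x) \<in> borel_measurable \<mu>"
      by measurable
    then show "(\<lambda>x. emeasure (if x \<in> ?N then P c else P x) F) \<in> borel_measurable \<mu>"
      by (rule measurable_cong[THEN iffD1, rotated]) (use eq[OF F] F in auto)
  qed (use P in auto)
  with null show thesis
    by (rule that)
qed

section \<open>Composition of probability kernels\<close>

lemma bind_prob_algebra_assoc:
  assumes "M \<in> space (prob_algebra A)" "f \<in> A \<rightarrow>\<^sub>M prob_algebra B" "g \<in> B \<rightarrow>\<^sub>M prob_algebra C"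
  shows "(M \<bind> f) \<bind> g = M \<bind> (\<lambda>x. f x \<bind> g)"
proof -
  have "sets M = sets A" using assms(1) by (simp add: space_prob_algebra)
  then have "f \<in> M \<rightarrow>\<^sub>M subprob_algebra B"
    using measurable_prob_algebraD[OF assms(2)] measurable_cong_sets[OF _ refl] by blast
  then show ?thesis
    by (rule bind_assoc) (rule measurable_prob_algebraD[OF assms(3)])
qed

lemma space_prob_algebraD:
  assumes "M \<in> space (prob_algebra A)"
  shows "prob_space M" "sets M = sets A" "space M = space A" "space M \<noteq> {}"
  using assms by (auto simp: space_prob_algebra dest: sets_eq_imp_space_eq prob_space.not_empty)

lemma measurable_sets_eq: "f \<in> A \<rightarrow>\<^sub>M B \<Longrightarrow> sets M = sets A \<Longrightarrow> f \<in> M \<rightarrow>\<^sub>M B"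
  by (simp cong: measurable_cong_sets)

lemma nn_integral_bind_prob_algebra:
  assumes "M \<in> space (prob_algebra A)" "K \<in> A \<rightarrow>\<^sub>M prob_algebra B" "f \<in> borel_measurable B"
  shows "(\<integral>\<^sup>+x. f x \<partial>(M \<bind> K)) = (\<integral>\<^sup>+x. \<integral>\<^sup>+y. f y \<partial>K x \<partial>M)"
  by (rule nn_integral_bind[OF assms(3)])
    (rule measurable_sets_eq[OF measurable_prob_algebraD[OF assms(2)] space_prob_algebraD(2)[OF assms(1)]])

lemma AE_bind_prob_algebra:
  assumes "M \<in> space (prob_algebra A)" "K \<in> A \<rightarrow>\<^sub>M prob_algebra B" "Measurable.pred B P"
  shows "(AE x in M \<bind> K. P x) \<longleftrightarrow> (AE x in M. AE y in K x. P y)"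
  by (rule AE_bind[OF _ assms(3)])
    (rule measurable_sets_eq[OF measurable_prob_algebraD[OF assms(2)] space_prob_algebraD(2)[OF assms(1)]])

lemma distr_bind_prob_algebra:
  assumes "M \<in> space (prob_algebra A)" "K \<in> A \<rightarrow>\<^sub>M prob_algebra B" "f \<in> B \<rightarrow>\<^sub>M C"
  shows "distr (M \<bind> K) C f = M \<bind> (\<lambda>x. distr (K x) C f)"
  by (rule distr_bind[OF _ _ assms(3)])
    (use measurable_sets_eq[OF measurable_prob_algebraD[OF assms(2)]] space_prob_algebraD[OF assms(1)] in auto)

lemma bind_distr_prob_algebra:
  assumes "M \<in> space (prob_algebra A)" "f \<in> A \<rightarrow>\<^sub>M B" "K \<in> B \<rightarrow>\<^sub>M prob_algebra C"
  shows "distr M B f \<bind> K = M \<bind> (\<lambda>x. K (f x))"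
  using space_prob_algebraD[OF assms(1)] measurable_sets_eq[OF assms(2)] measurable_prob_algebraD[OF assms(3)]
  by (intro bind_distr)

lemma bind_in_prob_algebra:
  "M \<in> space (prob_algebra A) \<Longrightarrow> K \<in> A \<rightarrow>\<^sub>M prob_algebra B \<Longrightarrow> M \<bind> K \<in> space (prob_algebra B)"
  unfolding space_prob_algebra[of B] by (simp add: prob_space_bind' sets_bind')

lemma distr_in_prob_algebra:
  "M \<in> space (prob_algebra A) \<Longrightarrow> f \<in> A \<rightarrow>\<^sub>M B \<Longrightarrow> distr M B f \<in> space (prob_algebra B)"
  by (rule measurable_space[OF measurable_distr_prob_space])

lemma space_path_space_nonempty: "(\<lambda>t\<in>{0..}. c) \<in> space path_space"
  by (simp add: const_cadlag)

definition append_piece :: "nat \<Rightarrow> 'e pieces \<Rightarrow> 'e path \<Rightarrow> 'e pieces" where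
  "append_piece k w f = (fst w, (snd w)(Suc k := f))"

lemma atLeastAtMost_Suc_insert: "{1..Suc k} = {1..k} \<union> {Suc k}"
  by auto

lemma measurable_append_piece:
  "(\<lambda>(w, f). append_piece k w f) \<in> initial_space k \<Otimes>\<^sub>M path_space \<rightarrow>\<^sub>M initial_space (Suc k)"
  unfolding append_piece_def initial_space_def split_beta'
  by (intro measurable_Pair measurable_fun_upd[OF atLeastAtMost_Suc_insert]) measurable

lemma measurable_append_piece1:
  "w \<in> space (initial_space k) \<Longrightarrow> append_piece k w \<in> path_space \<rightarrow>\<^sub>M initial_space (Suc k)"
  using measurable_compose[OF measurable_Pair1' measurable_append_piece] by fastforce

definition extend_law :: "nat \<Rightarrow> ('e::polish_space pieces \<Rightarrow> 'e path measure) \<Rightarrow> 'e pieces \<Rightarrow> 'e pieces measure" where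
  "extend_law k K w = distr (K w) (initial_space (Suc k)) (append_piece k w)"

lemma measurable_extend_law:
  "K \<in> initial_space k \<rightarrow>\<^sub>M prob_algebra path_space \<Longrightarrow>
    extend_law k K \<in> initial_space k \<rightarrow>\<^sub>M prob_algebra (initial_space (Suc k))"
  unfolding extend_law_def by (rule measurable_distr_prob_space2[OF _ measurable_append_piece])

primrec prefix_law :: "(nat \<Rightarrow> 'e::polish_space pieces \<Rightarrow> 'e path measure) \<Rightarrow> nat \<Rightarrow> 'e \<times> 'e path \<Rightarrow> 'e pieces measure" where
  "prefix_law K 0 a = return (initial_space 0) (a, \<lambda>_. undefined)"
| "prefix_law K (Suc k) a = prefix_law K k a \<bind> extend_law k (K k)"

lemma measurable_empty_pieces: "(\<lambda>a. (a, \<lambda>_. undefined)) \<in> aug_space \<rightarrow>\<^sub>M initial_space 0"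
  unfolding initial_space_def by (intro measurable_Pair measurable_ident measurable_const) (auto simp: space_PiM)

lemma measurable_prefix_law:
  assumes K: "\<And>k. K k \<in> initial_space k \<rightarrow>\<^sub>M prob_algebra path_space"
  shows "prefix_law K k \<in> aug_space \<rightarrow>\<^sub>M prob_algebra (initial_space k)"
proof (induction k)
  case 0
  show ?case
    using measurable_compose[OF measurable_empty_pieces measurable_return_prob_space] by simp
next
  case (Suc k)
  show ?case
    using measurable_bind_prob_space[OF Suc measurable_extend_law[OF K]] by simp
qed

section \<open>Cylinder events and measures determined by initial parts\<close>

definition cylinders :: "'e::polish_space pieces set set" where
  "cylinders = {initial_part k -` B \<inter> space product_space | k B. B \<in> sets (initial_space k)}"

lemma measurable_initial_part_product: "initial_part k \<in> product_space \<rightarrow>\<^sub>M initial_space k"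
  unfolding product_space_eq by (rule measurable_initial_part) simp

lemma initial_part_initial_part: "k \<le> j \<Longrightarrow> initial_part k (initial_part j w) = initial_part k w"
  by (simp add: initial_part_def min_def)

lemma Int_stable_cylinders: "Int_stable cylinders"
proof (rule Int_stableI)
  have *: "(initial_part k -` B \<inter> space product_space) \<inter> (initial_part j -` C \<inter> space product_space) \<in> cylinders"
    if "k \<le> j" "B \<in> sets (initial_space k)" "C \<in> sets (initial_space j)" for k j B and C :: "'a pieces set"
  proof -
    have "initial_part k \<in> initial_space j \<rightarrow>\<^sub>M (initial_space k :: 'a pieces measure)"
      unfolding initial_space_eq[of j] using that(1) by (intro measurable_initial_part) auto
    then have "initial_part k -` B \<inter> space (initial_space j) \<in> sets (initial_space j)"
      using that(2) by (rule measurable_sets)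
    then have "(initial_part k -` B \<inter> space (initial_space j)) \<inter> C \<in> sets (initial_space j)"
      using that(3) by simp
    moreover have "(initial_part k -` B \<inter> space product_space) \<inter> (initial_part j -` C \<inter> space product_space) =
        initial_part j -` ((initial_part k -` B \<inter> space (initial_space j)) \<inter> C) \<inter> space product_space"
    proof (rule set_eqI)
      fix w :: "'a pieces"
      show "w \<in> (initial_part k -` B \<inter> space product_space) \<inter> (initial_part j -` C \<inter> space product_space) \<longleftrightarrow>
          w \<in> initial_part j -` ((initial_part k -` B \<inter> space (initial_space j)) \<inter> C) \<inter> space product_space"
        using measurable_space[OF measurable_initial_part_product[of j], of w]
        by (cases "w \<in> space product_space") (simp_all add: initial_part_initial_part[OF that(1)])
    qed
    ultimately show ?thesis
      unfolding cylinders_def by blast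
  qed
  fix a b :: "'a pieces set" assume "a \<in> cylinders" "b \<in> cylinders"
  then obtain k B j C where
    "a = initial_part k -` B \<inter> space product_space" "B \<in> sets (initial_space k)"
    "b = initial_part j -` C \<inter> space product_space" "C \<in> sets (initial_space j)"
    unfolding cylinders_def by blast
  then show "a \<inter> b \<in> cylinders"
    using *[of k j B C] *[of j k C B] by (metis Int_commute nle_le)
qed

lemma cylinders_subset: "cylinders \<subseteq> Pow (space product_space)"
  by (auto simp: cylinders_def)

lemma space_in_cylinders: "space product_space \<in> (cylinders :: 'e::polish_space pieces set set)"
proof -
  have "initial_part 0 -` space (initial_space 0) \<inter> space product_space \<in> (cylinders :: 'e pieces set set)"
    unfolding cylinders_def by blast
  moreover have "initial_part 0 -` space (initial_space 0) \<inter> space product_space = (space product_space :: 'e pieces set)"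
    using measurable_space[OF measurable_initial_part_product[of 0]] by blast
  ultimately show ?thesis by (simp only:)
qed

text \<open>Each coordinate factors through an initial part, so the identity is measurable from the
  \<sigma>-algebra of the cylinders to the product.\<close>

lemma sets_product_space_cylinders: "sets product_space = sigma_sets (space product_space) cylinders"
proof
  let ?N = "sigma (space product_space) cylinders :: 'a pieces measure"
  have sp: "space ?N = space product_space" and se: "sets ?N = sigma_sets (space product_space) cylinders"
    by (simp_all add: space_measure_of_conv sets_measure_of_conv cylinders_subset)
  have ip: "initial_part k \<in> ?N \<rightarrow>\<^sub>M initial_space k" for k
  proof (rule measurableI)
    fix B :: "'a pieces set" assume "B \<in> sets (initial_space k)"
    then have "initial_part k -` B \<inter> space product_space \<in> cylinders"
      unfolding cylinders_def by blast
    then show "initial_part k -` B \<inter> space ?N \<in> sets ?N"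
      unfolding sp se by (rule sigma_sets.Basic)
  qed (simp add: sp measurable_space[OF measurable_initial_part_product])
  have 1: "fst \<in> ?N \<rightarrow>\<^sub>M (aug_space :: ('a \<times> 'a path) measure)"
    using measurable_compose[OF ip[of 0] measurable_fst_pieces[of "{1..0}", folded initial_space_eq]]
    by (simp add: initial_part_def)
  have 2: "(\<lambda>w. snd w i) \<in> ?N \<rightarrow>\<^sub>M (path_space :: 'a path measure)" if "i \<in> {1..}" for i
    using measurable_compose[OF ip[of i] measurable_snd_pieces[of i "{1..i}", folded initial_space_eq]] that
    by (simp add: initial_part_def)
  have "(\<lambda>w i. snd w i) \<in> ?N \<rightarrow>\<^sub>M PiM {1..} (\<lambda>_. path_space :: 'a path measure)"
    by (rule measurable_PiM_single'[OF 2], assumption, unfold sp)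
      (auto simp: product_space_def space_pair_measure space_PiM)
  with 1 have id: "(\<lambda>w. w) \<in> ?N \<rightarrow>\<^sub>M product_space"
    unfolding product_space_def by (simp add: measurable_pair_iff comp_def)
  show "sets product_space \<subseteq> sigma_sets (space product_space) (cylinders :: 'a pieces set set)"
  proof
    fix A :: "'a pieces set" assume A: "A \<in> sets product_space"
    have "(\<lambda>w. w) -` A \<inter> space ?N = A"
      using sets.sets_into_space[OF A] by (simp add: sp Int_absorb2)
    with measurable_sets[OF id A] se show "A \<in> sigma_sets (space product_space) cylinders" by simp
  qed
  show "sigma_sets (space product_space) cylinders \<subseteq> (sets product_space :: 'a pieces set set)"
    unfolding cylinders_def
    by (rule sets.sigma_sets_subset) (auto intro: measurable_sets[OF measurable_initial_part_product])
qed

lemma measurable_fst_product: "fst \<in> product_space \<rightarrow>\<^sub>M aug_space"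
  unfolding product_space_eq by (rule measurable_fst_pieces)

lemma emeasure_initial_part:
  assumes "\<mu> \<in> space (prob_algebra product_space)" "B \<in> sets (initial_space k)"
  shows "emeasure (distr \<mu> (initial_space k) (initial_part k)) B = emeasure \<mu> (initial_part k -` B \<inter> space product_space)"
  using emeasure_distr[OF measurable_sets_eq[OF measurable_initial_part_product] assms(2)]
    space_prob_algebraD[OF assms(1)] by simp

lemma measure_eqI_initial_parts:
  assumes \<mu>: "\<mu> \<in> space (prob_algebra product_space)" "\<mu>' \<in> space (prob_algebra product_space)"
    and eq: "\<And>k. distr \<mu> (initial_space k) (initial_part k) = distr \<mu>' (initial_space k) (initial_part k)"
  shows "\<mu> = \<mu>'"
proof (rule measure_eqI_generator_eq_countable[OF Int_stable_cylinders cylinders_subset])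
  fix X :: "'a pieces set" assume "X \<in> cylinders"
  then obtain k B where X: "X = initial_part k -` B \<inter> space product_space" "B \<in> sets (initial_space k)"
    unfolding cylinders_def by blast
  then show "emeasure \<mu> X = emeasure \<mu>' X"
    using eq[of k] emeasure_initial_part[OF \<mu>(1)] emeasure_initial_part[OF \<mu>(2)] by metis
next
  show "sets \<mu> = sigma_sets (space product_space) cylinders" "sets \<mu>' = sigma_sets (space product_space) cylinders"
    using \<mu> by (simp_all add: space_prob_algebra sets_product_space_cylinders)
  show "{space product_space} \<subseteq> cylinders" "\<Union>{space product_space} = space product_space" "countable {space product_space}"
    using space_in_cylinders by simp_all
  show "emeasure \<mu> a \<noteq> \<infinity>" if "a \<in> {space product_space}" for a
    using finite_measure.emeasure_finite[OF prob_space.finite_measure[OF space_prob_algebraD(1)[OF \<mu>(1)]]] by simp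
qed

text \<open>The coordinate with index 0 has another type than the remaining ones. It is therefore
  frozen at \<open>a\<close>: the projective family consists of paths only, its coordinate 0 is the
  dummy path \<open>c\<close>, and \<open>\<phi>\<close> puts \<open>a\<close> in place of the dummy
  before the kernels are applied.\<close>

lemma Ionescu_Tulcea_pointwise:
  assumes K: "\<And>k. K k \<in> initial_space k \<rightarrow>\<^sub>M prob_algebra path_space" and a: "a \<in> space aug_space"
  obtains \<Lambda> where "\<Lambda> \<in> space (prob_algebra product_space)"
    "\<And>k. distr \<Lambda> (initial_space k) (initial_part k) = prefix_law K k a"
proof -
  define c :: "'a path" where "c = (\<lambda>t\<in>{0..}. undefined)"
  have c: "c \<in> space path_space"
    unfolding c_def by (rule space_path_space_nonempty)
  define \<phi> where "\<phi> k w = (a, restrict w {1..k})" for k :: nat and w :: "nat \<Rightarrow> 'a path"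
  define R where "R i w = (case i of 0 \<Rightarrow> return path_space c | Suc k \<Rightarrow> K k (\<phi> k w))" for i w
  have \<phi>: "\<phi> k \<in> PiM I (\<lambda>_. path_space) \<rightarrow>\<^sub>M initial_space k" if "{1..k} \<subseteq> I" for k I
    unfolding \<phi>_def initial_space_def using that a by (intro measurable_Pair measurable_const measurable_restrict_subset)
  have R: "R i \<in> PiM {0..<i} (\<lambda>_. path_space) \<rightarrow>\<^sub>M prob_algebra path_space" for i
  proof (cases i)
    case 0
    then have "R i = (\<lambda>_. return path_space c)"
      by (simp add: R_def fun_eq_iff)
    then show ?thesis
      using c by (simp add: space_prob_algebra prob_space_return)
  next
    case (Suc k)
    have "(\<lambda>w. K k (\<phi> k w)) \<in> PiM {0..<i} (\<lambda>_. path_space) \<rightarrow>\<^sub>M prob_algebra path_space"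
      by (rule measurable_compose[OF \<phi> K]) (auto simp: Suc)
    moreover have "R i = (\<lambda>w. K k (\<phi> k w))"
      by (simp add: R_def Suc fun_eq_iff)
    ultimately show ?thesis by simp
  qed
  interpret IT: Ionescu_Tulcea R "\<lambda>_. path_space :: 'a path measure"
  proof (rule Ionescu_Tulcea.intro)
    show "R i \<in> PiM {0..<i} (\<lambda>_. path_space) \<rightarrow>\<^sub>M subprob_algebra path_space" for i
      by (rule measurable_prob_algebraD[OF R])
    show "prob_space (R i x)" if "x \<in> space (PiM {0..<i} (\<lambda>_. path_space))" for i x
      using measurable_space[OF R that] by (simp add: space_prob_algebra)
  qed
  note IT.C.simps [simp del]
  have eP: "IT.eP n \<in> PiM {0..<n} (\<lambda>_. path_space) \<rightarrow>\<^sub>M prob_algebra (PiM {0..<Suc n} (\<lambda>_. path_space))" for n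
    using IT.measurable_eP IT.prob_space_eP by (intro measurable_prob_algebraI)
  have C: "IT.C 0 n (\<lambda>_. undefined) \<in> space (prob_algebra (PiM {0..<n} (\<lambda>_. path_space)))" for n
    using IT.sets_C[of "\<lambda>_. undefined" 0 n] IT.prob_space_C[of "\<lambda>_. undefined" 0 n]
    by (simp add: space_prob_algebra space_PiM)
  \<comment> \<open>The index set \<open>{0..<Suc k}\<close> consists of the dummy coordinate and
    the pieces 1 to \<open>k\<close>, which accounts for the shift between the two sides.\<close>
  have prefix: "distr (IT.C 0 (Suc k) (\<lambda>_. undefined)) (initial_space k) (\<phi> k) = prefix_law K k a" for k
  proof (induction k)
    case 0
    have "\<phi> 0 = (\<lambda>_. (a, \<lambda>_. undefined))"
      by (auto simp: \<phi>_def fun_eq_iff)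
    moreover have "(a, \<lambda>_. undefined) \<in> space (initial_space 0)"
      using a by (simp add: initial_space_def space_pair_measure space_PiM)
    ultimately show ?case
      using prob_space.distr_const[OF space_prob_algebraD(1)[OF C]] by simp
  next
    case (Suc k)
    let ?C = "IT.C 0 (Suc k) (\<lambda>_. undefined)"
    have 1: "distr (IT.C 0 (Suc (Suc k)) (\<lambda>_. undefined)) (initial_space (Suc k)) (\<phi> (Suc k)) =
        ?C \<bind> (\<lambda>w. distr (IT.eP (Suc k) w) (initial_space (Suc k)) (\<phi> (Suc k)))"
      unfolding IT.C.simps(2)[of 0 "Suc k"] add_0 by (rule distr_bind_prob_algebra[OF C eP \<phi>]) auto
    have 2: "distr (IT.eP (Suc k) w) (initial_space (Suc k)) (\<phi> (Suc k)) = extend_law k (K k) (\<phi> k w)"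
      if w: "w \<in> space (PiM {0..<Suc k} (\<lambda>_. path_space))" for w
    proof -
      have eq: "\<phi> (Suc k) (w(Suc k := f)) = append_piece k (\<phi> k w) f" for f
        by (auto simp: \<phi>_def append_piece_def restrict_def)
      have s: "sets (R (Suc k) w) = sets path_space"
        using IT.sets_P[OF w] .
      have "(\<lambda>f. w(Suc k := f)) \<in> R (Suc k) w \<rightarrow>\<^sub>M PiM {0..<Suc (Suc k)} (\<lambda>_. path_space)"
        by (rule measurable_sets_eq[OF _ s])
          (intro measurable_fun_upd[where J = "{0..<Suc k}"] measurable_const measurable_ident w; auto)
      then have "distr (IT.eP (Suc k) w) (initial_space (Suc k)) (\<phi> (Suc k)) =
          distr (R (Suc k) w) (initial_space (Suc k)) (\<phi> (Suc k) \<circ> (\<lambda>f. w(Suc k := f)))"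
        unfolding IT.eP_def by (intro distr_distr \<phi>) auto
      then show ?thesis
        by (simp add: extend_law_def comp_def eq R_def)
    qed
    have "distr (IT.C 0 (Suc (Suc k)) (\<lambda>_. undefined)) (initial_space (Suc k)) (\<phi> (Suc k)) =
        ?C \<bind> (\<lambda>w. extend_law k (K k) (\<phi> k w))"
      unfolding 1 by (rule bind_cong) (use 2 space_prob_algebraD(3)[OF C] in auto)
    also have "\<dots> = distr ?C (initial_space k) (\<phi> k) \<bind> extend_law k (K k)"
      by (rule bind_distr_prob_algebra[OF C \<phi> measurable_extend_law[OF K], symmetric]) auto
    finally show ?case
      by (simp add: Suc)
  qed
  let ?\<Phi> = "\<lambda>w. (a, restrict w {1..})"
  have lim: "IT.PF.lim \<in> space (prob_algebra (PiM UNIV (\<lambda>_. path_space)))"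
  proof -
    have s: "sets IT.PF.lim = sets (PiM UNIV (\<lambda>_. path_space))"
      by simp
    have "prob_space (distr IT.PF.lim (PiM {0..<0} (\<lambda>_. path_space)) (\<lambda>w. restrict w {0..<0}))"
      unfolding IT.distr_lim[OF finite_atLeastLessThan] by (rule IT.PF.prob_space_P) simp_all
    then have "prob_space IT.PF.lim"
      by (rule prob_space_distrD[OF measurable_sets_eq[OF measurable_restrict_subset[OF subset_UNIV] s]])
    with s show ?thesis by (simp add: space_prob_algebra)
  qed
  have \<Phi>: "?\<Phi> \<in> PiM UNIV (\<lambda>_. path_space) \<rightarrow>\<^sub>M product_space"
    unfolding product_space_def using a by (intro measurable_Pair measurable_const measurable_restrict_subset) auto
  show thesis
  proof
    show "distr IT.PF.lim product_space ?\<Phi> \<in> space (prob_algebra product_space)"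
      by (rule distr_in_prob_algebra[OF lim \<Phi>])
    fix k
    let ?J = "{0..<Suc k}"
    have "distr (distr IT.PF.lim product_space ?\<Phi>) (initial_space k) (initial_part k) =
        distr IT.PF.lim (initial_space k) (initial_part k \<circ> ?\<Phi>)"
      by (rule distr_distr[OF measurable_initial_part_product measurable_sets_eq[OF \<Phi> space_prob_algebraD(2)[OF lim]]])
    also have "initial_part k \<circ> ?\<Phi> = \<phi> k \<circ> (\<lambda>w. restrict w ?J)"
      by (auto simp: initial_part_def \<phi>_def fun_eq_iff restrict_def)
    also have "distr IT.PF.lim (initial_space k) (\<phi> k \<circ> (\<lambda>w. restrict w ?J)) =
        distr (distr IT.PF.lim (PiM ?J (\<lambda>_. path_space)) (\<lambda>w. restrict w ?J)) (initial_space k) (\<phi> k)"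
      by (rule distr_distr[symmetric, OF \<phi> measurable_sets_eq[OF measurable_restrict_subset space_prob_algebraD(2)[OF lim]]]) auto
    also have "distr IT.PF.lim (PiM ?J (\<lambda>_. path_space)) (\<lambda>w. restrict w ?J) = IT.CI ?J"
      by (rule IT.distr_lim) simp
    also have "IT.CI ?J = IT.C 0 (Suc k) (\<lambda>_. undefined)"
    proof -
      \<comment> \<open>A marginal of the projective family is a projection of the law of the first
        \<open>up_to ?J\<close> coordinates. For this initial segment nothing is projected
        away.\<close>
      have up: "IT.up_to ?J = Suc k"
        unfolding IT.up_to_def by (rule Least_equality) (auto simp: not_less_eq_eq[symmetric])
      have "IT.CI ?J = distr (IT.C 0 (Suc k) (\<lambda>_. undefined)) (PiM ?J (\<lambda>_. path_space)) (\<lambda>w. w)"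
        unfolding IT.CI_def up
        by (rule distr_cong[OF refl refl]) (auto simp: space_prob_algebraD(3)[OF C] space_PiM)
      then show ?thesis
        using distr_id2[OF space_prob_algebraD(2)[OF C, symmetric], of "Suc k"] by simp
    qed
    finally show "distr (distr IT.PF.lim product_space ?\<Phi>) (initial_space k) (initial_part k) = prefix_law K k a"
      by (simp only: prefix)
  qed
qed

text \<open>The laws are chosen separately for each \<open>a\<close>, yet on a cylinder they are
  given by \<open>prefix_law\<close>, which is measurable in \<open>a\<close>. The cylinders form an
  intersection-stable generator, so the choice is automatically a kernel.\<close>

theorem Ionescu_Tulcea_kernel:
  assumes K: "\<And>k. K k \<in> initial_space k \<rightarrow>\<^sub>M prob_algebra path_space"
  obtains \<Lambda> where "\<Lambda> \<in> aug_space \<rightarrow>\<^sub>M prob_algebra product_space"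
    "\<And>k a. a \<in> space aug_space \<Longrightarrow> distr (\<Lambda> a) (initial_space k) (initial_part k) = prefix_law K k a"
proof -
  have "\<forall>a\<in>space aug_space. \<exists>\<Lambda>. \<Lambda> \<in> space (prob_algebra product_space) \<and>
      (\<forall>k. distr \<Lambda> (initial_space k) (initial_part k) = prefix_law K k a)"
    using Ionescu_Tulcea_pointwise[OF K] by metis
  then obtain \<Lambda> where \<Lambda>: "\<And>a. a \<in> space aug_space \<Longrightarrow> \<Lambda> a \<in> space (prob_algebra product_space)"
    "\<And>k a. a \<in> space aug_space \<Longrightarrow> distr (\<Lambda> a) (initial_space k) (initial_part k) = prefix_law K k a"
    by metis
  have "\<Lambda> \<in> aug_space \<rightarrow>\<^sub>M prob_algebra product_space"
  proof (rule measurable_prob_algebra_generated[OF sets_product_space_cylinders Int_stable_cylinders cylinders_subset])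
    fix X :: "'a pieces set" assume "X \<in> cylinders"
    then obtain k B where X: "X = initial_part k -` B \<inter> space product_space" "B \<in> sets (initial_space k)"
      unfolding cylinders_def by blast
    have "emeasure (\<Lambda> a) X = emeasure (prefix_law K k a) B" if a: "a \<in> space aug_space" for a
      using X emeasure_initial_part[OF \<Lambda>(1)[OF a] X(2)] by (simp add: \<Lambda>(2)[OF a])
    moreover have "(\<lambda>a. emeasure (prefix_law K k a) B) \<in> borel_measurable aug_space"
      by (rule measurable_compose[OF measurable_prob_algebraD[OF measurable_prefix_law[OF K]]
            measurable_emeasure_subprob_algebra[OF X(2)]])
    ultimately show "(\<lambda>a. emeasure (\<Lambda> a) X) \<in> borel_measurable aug_space"
      by (subst measurable_cong)
  qed (use \<Lambda>(1) in \<open>auto simp: space_prob_algebra\<close>)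
  with \<Lambda>(2) that show thesis by blast
qed

lemma initial_part_append_piece:
  assumes "w \<in> space (initial_space k)"
  shows "initial_part k (append_piece k w f) = w" "snd (append_piece k w f) (Suc k) = f"
  using assms
  by (auto simp: initial_part_def append_piece_def initial_space_def space_pair_measure space_PiM PiE_iff
      restrict_def extensional_def fun_eq_iff)

lemma append_piece_initial_part: "append_piece k (initial_part k w) (piece w (Suc k)) = initial_part (Suc k) w"
  by (auto simp: append_piece_def initial_part_def piece_def restrict_def)

text \<open>The integrand sees only coordinates up to \<open>Suc k\<close>, so the integral can be
  computed on the marginal that \<open>step\<close> disintegrates. The measure is left general
  because this is applied both to the laws from fixed points and to their mixture.\<close>

lemma nn_integral_next_piece:
  assumes \<mu>: "\<mu> \<in> space (prob_algebra product_space)"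
    and step: "distr \<mu> (initial_space (Suc k)) (initial_part (Suc k)) =
      distr \<mu> (initial_space k) (initial_part k) \<bind> extend_law k K"
    and K: "K \<in> initial_space k \<rightarrow>\<^sub>M prob_algebra path_space"
    and H: "(\<lambda>(w, f). H w f) \<in> borel_measurable (initial_space k \<Otimes>\<^sub>M path_space)"
  shows "(\<integral>\<^sup>+w. H (initial_part k w) (piece w (Suc k)) \<partial>\<mu>) =
    (\<integral>\<^sup>+w. \<integral>\<^sup>+f. H (initial_part k w) f \<partial>K (initial_part k w) \<partial>\<mu>)"
proof -
  let ?H = "\<lambda>w. H (initial_part k w) (snd w (Suc k))"
  note ip = measurable_sets_eq[OF measurable_initial_part_product space_prob_algebraD(2)[OF \<mu>]]
  have "initial_part k \<in> initial_space (Suc k) \<rightarrow>\<^sub>M (initial_space k :: 'a pieces measure)"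
    "(\<lambda>w. snd w (Suc k)) \<in> initial_space (Suc k) \<rightarrow>\<^sub>M (path_space :: 'a path measure)"
    unfolding initial_space_eq[of "Suc k"] by (intro measurable_initial_part measurable_snd_pieces; auto)+
  from measurable_compose[OF measurable_Pair[OF this] H]
  have H': "?H \<in> borel_measurable (initial_space (Suc k))"
    by simp
  have "(\<integral>\<^sup>+w. H (initial_part k w) (piece w (Suc k)) \<partial>\<mu>) = (\<integral>\<^sup>+w. ?H (initial_part (Suc k) w) \<partial>\<mu>)"
    by (simp add: initial_part_initial_part) (simp add: initial_part_def piece_def)
  also have "\<dots> = (\<integral>\<^sup>+w. ?H w \<partial>distr \<mu> (initial_space (Suc k)) (initial_part (Suc k)))"
    using H' by (intro nn_integral_distr[symmetric] ip) simp
  also have "\<dots> = (\<integral>\<^sup>+w. \<integral>\<^sup>+w'. ?H w' \<partial>extend_law k K w \<partial>distr \<mu> (initial_space k) (initial_part k))"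
    unfolding step
    by (rule nn_integral_bind_prob_algebra[OF distr_in_prob_algebra[OF \<mu> measurable_initial_part_product]
          measurable_extend_law[OF K] H'])
  also have "\<dots> = (\<integral>\<^sup>+w. \<integral>\<^sup>+w'. ?H w' \<partial>extend_law k K (initial_part k w) \<partial>\<mu>)"
  proof (rule nn_integral_distr[OF ip])
    show "(\<lambda>w. \<integral>\<^sup>+w'. ?H w' \<partial>extend_law k K w) \<in> borel_measurable (distr \<mu> (initial_space k) (initial_part k))"
      using measurable_compose[OF measurable_prob_algebraD[OF measurable_extend_law[OF K]]
          nn_integral_measurable_subprob_algebra[OF H']] by simp
  qed
  also have "\<dots> = (\<integral>\<^sup>+w. \<integral>\<^sup>+f. H (initial_part k w) f \<partial>K (initial_part k w) \<partial>\<mu>)"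
  proof (rule nn_integral_cong)
    fix w assume "w \<in> space \<mu>"
    then have w: "initial_part k w \<in> space (initial_space k)"
      by (rule measurable_space[OF ip])
    have "sets (K (initial_part k w)) = sets path_space"
      using measurable_space[OF K w] by (simp add: space_prob_algebra)
    then have "(\<integral>\<^sup>+w'. ?H w' \<partial>extend_law k K (initial_part k w)) =
        (\<integral>\<^sup>+f. ?H (append_piece k (initial_part k w) f) \<partial>K (initial_part k w))"
      unfolding extend_law_def
      by (intro nn_integral_distr measurable_sets_eq[OF measurable_append_piece1[OF w]]) (use H' in simp_all)
    then show "(\<integral>\<^sup>+w'. ?H w' \<partial>extend_law k K (initial_part k w)) = (\<integral>\<^sup>+f. H (initial_part k w) f \<partial>K (initial_part k w))"
      by (simp add: initial_part_append_piece[OF w])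
  qed
  finally show ?thesis .
qed

section \<open>The law of the pieces\<close>

text \<open>A fixed member of the family is used on the exceptional set, so that all values remain
  probability laws on paths.\<close>

definition modify :: "('a \<Rightarrow> 'b) \<Rightarrow> 'a set \<Rightarrow> 'a \<Rightarrow> 'b" where
  "modify P N v = (if v \<in> N then P undefined else P v)"

lemma markov_familyD:
  assumes "markov_family P"
  shows "prob_space (P x)" "sets (P x) = sets path_space" "space (P x) = cadlag_paths"
    "F \<in> sets path_space \<Longrightarrow> universally_measurable borel (\<lambda>x. emeasure (P x) F)"
    "emeasure (P x) {\<omega> \<in> cadlag_paths. \<omega> 0 = x} = 1"
proof -
  show s: "sets (P x) = sets path_space"
    using assms by (simp add: markov_family_def)
  show "space (P x) = cadlag_paths"
    using sets_eq_imp_space_eq[OF s] by simp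
qed (use assms in \<open>simp_all add: markov_family_def\<close>)

lemma markov_family_modification:
  fixes P :: "'e::polish_space \<Rightarrow> 'e path measure"
  assumes P: "markov_family P" and \<mu>: "prob_space \<mu>" "sets \<mu> = sets borel"
  shows "\<exists>N. N \<in> null_sets \<mu> \<and> modify P N \<in> borel \<rightarrow>\<^sub>M prob_algebra path_space"
proof -
  obtain G :: "'e path set set" where G: "countable G" "Int_stable G" "G \<subseteq> Pow cadlag_paths"
    "sets path_space = sigma_sets cadlag_paths G"
    by (rule path_space_countably_generated)
  have "(\<lambda>x. emeasure (P x) F) \<in> borel_measurable (completion \<mu>)" if "F \<in> G" for F
  proof -
    have "F \<in> sets path_space"
      unfolding G(4) using that by (rule sigma_sets.Basic)
    then show ?thesis
      using markov_familyD(4)[OF P] \<mu> unfolding universally_measurable_def by blast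
  qed
  then obtain N where "N \<in> null_sets \<mu>" "(\<lambda>x. if x \<in> N then P undefined else P x) \<in> \<mu> \<rightarrow>\<^sub>M prob_algebra path_space"
    using kernel_modification[of P path_space G \<mu> undefined] G markov_familyD[OF P] by auto
  then have "N \<in> null_sets \<mu>" "modify P N \<in> \<mu> \<rightarrow>\<^sub>M prob_algebra path_space"
    by (simp_all add: modify_def[abs_def])
  then show ?thesis
    using measurable_cong_sets[OF \<mu>(2) refl] by blast
qed

text \<open>Comparison with an existing measure spares a direct proof that \<open>f\<close> is
  countably additive.\<close>

lemma measure_of_eqI:
  assumes "\<And>A. A \<in> sets M \<Longrightarrow> f A = emeasure M A"
  shows "measure_of (space M) (sets M) f = M"
proof -
  have "measure_of (space M) (sets M) f = measure_of (space M) (sets M) (emeasure M)"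
    by (rule measure_of_eq) (use assms sets.space_closed in \<open>auto simp: sets.sigma_sets_eq\<close>)
  then show ?thesis by (simp add: measure_of_of_measure)
qed

locale controlled_process = impulse_policy S \<tau> Z
  for S :: "'z measure" and \<tau> :: "nat \<Rightarrow> 'e::polish_space \<times> 'e path \<Rightarrow> ennreal"
    and Z :: "nat \<Rightarrow> 'e \<times> 'e path \<Rightarrow> 'z" +
  fixes P :: "'e \<Rightarrow> 'e path measure"
    and Q :: "'e \<times> 'z \<Rightarrow> 'e measure"
    and ebar :: 'e and zbar :: 'z
    and \<nu> :: "'e measure"
  assumes markov: "markov_family P"
    and Q: "Q \<in> borel \<Otimes>\<^sub>M S \<rightarrow>\<^sub>M prob_algebra borel"
    and \<nu>: "prob_space \<nu>" "sets \<nu> = sets borel"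
begin

abbreviation jump :: "nat \<Rightarrow> 'e pieces \<Rightarrow> 'e measure" where
  "jump \<equiv> jump_kernel Q ebar zbar \<tau> Z"

definition exceptional :: "'e measure \<Rightarrow> 'e set" where
  "exceptional \<mu> = (SOME N. N \<in> null_sets \<mu> \<and> modify P N \<in> borel \<rightarrow>\<^sub>M prob_algebra path_space)"

text \<open>The exceptional set of a kernel depends on the law of the piece before it, hence the
  recursion. Only with these sets removed are the kernels measurable.\<close>

primrec stage :: "nat \<Rightarrow> 'e pieces measure" where
  "stage 0 = (\<nu> \<bind> aug_law (modify P (exceptional \<nu>))) \<bind> (\<lambda>a. return (initial_space 0) (a, \<lambda>_. undefined))"
| "stage (Suc k) = stage k \<bind> extend_law k (\<lambda>w. jump k w \<bind> modify P (exceptional (stage k \<bind> jump k)))"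

text \<open>\<open>stage k \<bind> jump k\<close> is the law of the point drawn by the jump kernel,
  from which piece \<open>Suc k\<close> is started.\<close>

definition kernel_null :: "nat \<Rightarrow> 'e set" where
  "kernel_null k = exceptional (stage k \<bind> jump k)"

definition start_null :: "'e set" where
  "start_null = exceptional \<nu>"

definition kernel :: "nat \<Rightarrow> 'e pieces \<Rightarrow> 'e path measure" where
  "kernel k w = jump k w \<bind> modify P (kernel_null k)"

lemma exceptional:
  assumes "\<mu> \<in> space (prob_algebra borel)"
  shows "exceptional \<mu> \<in> null_sets \<mu>" "modify P (exceptional \<mu>) \<in> borel \<rightarrow>\<^sub>M prob_algebra path_space"
  using someI_ex[OF markov_family_modification[OF markov], of \<mu>] assms
  unfolding exceptional_def by (auto simp: space_prob_algebra)

lemma \<nu>_in: "\<nu> \<in> space (prob_algebra borel)"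
  using \<nu> by (simp add: space_prob_algebra)

lemma measurable_jump: "jump k \<in> initial_space k \<rightarrow>\<^sub>M prob_algebra borel"
  by (rule measurable_jump_kernel[OF Q])

lemma measurable_start: "aug_law (modify P start_null) \<in> borel \<rightarrow>\<^sub>M prob_algebra aug_space"
proof -
  note exceptional(2)[OF \<nu>_in, measurable]
  show ?thesis
    unfolding aug_law_def[abs_def] aug_space_def start_null_def by measurable
qed

lemma start_in: "\<nu> \<bind> aug_law (modify P start_null) \<in> space (prob_algebra aug_space)"
  by (rule bind_in_prob_algebra[OF \<nu>_in measurable_start])

lemma stage_Suc: "stage (Suc k) = stage k \<bind> extend_law k (kernel k)"
  by (simp add: kernel_def[abs_def] kernel_null_def)

lemma stage_in: "stage k \<in> space (prob_algebra (initial_space k))"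
  and measurable_modify: "modify P (kernel_null k) \<in> borel \<rightarrow>\<^sub>M prob_algebra path_space"
  and kernel_null_null: "kernel_null k \<in> null_sets (stage k \<bind> jump k)"
  and measurable_kernel: "kernel k \<in> initial_space k \<rightarrow>\<^sub>M prob_algebra path_space"
proof -
  have kernel: "modify P (kernel_null k) \<in> borel \<rightarrow>\<^sub>M prob_algebra path_space"
    "kernel_null k \<in> null_sets (stage k \<bind> jump k)"
    "kernel k \<in> initial_space k \<rightarrow>\<^sub>M prob_algebra path_space"
    if "stage k \<in> space (prob_algebra (initial_space k))" for k
  proof -
    have "stage k \<bind> jump k \<in> space (prob_algebra borel)"
      by (rule bind_in_prob_algebra[OF that measurable_jump])
    from exceptional[OF this] show
      n: "modify P (kernel_null k) \<in> borel \<rightarrow>\<^sub>M prob_algebra path_space"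
      "kernel_null k \<in> null_sets (stage k \<bind> jump k)"
      by (simp_all add: kernel_null_def)
    show "kernel k \<in> initial_space k \<rightarrow>\<^sub>M prob_algebra path_space"
      unfolding kernel_def[abs_def] by (rule measurable_bind_prob_space[OF measurable_jump n(1)])
  qed
  have stage: "stage k \<in> space (prob_algebra (initial_space k))" for k
  proof (induction k)
    case 0
    show ?case
      using bind_in_prob_algebra[OF start_in measurable_compose[OF measurable_empty_pieces measurable_return_prob_space]] by (simp add: start_null_def)
  next
    case (Suc k)
    show ?case
      unfolding stage_Suc by (rule bind_in_prob_algebra[OF Suc measurable_extend_law[OF kernel(3)[OF Suc]]])
  qed
  show "stage k \<in> space (prob_algebra (initial_space k))"
    by (rule stage)
  show "modify P (kernel_null k) \<in> borel \<rightarrow>\<^sub>M prob_algebra path_space"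
    "kernel_null k \<in> null_sets (stage k \<bind> jump k)"
    "kernel k \<in> initial_space k \<rightarrow>\<^sub>M prob_algebra path_space"
    using kernel[OF stage] .
qed

lemma sets_kernel_null: "kernel_null k \<in> sets borel"
  using kernel_null_null[of k] space_prob_algebraD(2)[OF bind_in_prob_algebra[OF stage_in measurable_jump]] by auto

lemma sets_start_null: "start_null \<in> sets borel"
  using exceptional(1)[OF \<nu>_in] \<nu> by (auto simp: start_null_def)

section \<open>The law of all pieces under the modified kernels\<close>

definition continuation :: "'e \<times> 'e path \<Rightarrow> 'e pieces measure" where
  "continuation = (SOME \<Lambda>. \<Lambda> \<in> aug_space \<rightarrow>\<^sub>M prob_algebra product_space \<and>
    (\<forall>k. \<forall>a\<in>space aug_space. distr (\<Lambda> a) (initial_space k) (initial_part k) = prefix_law kernel k a))"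

lemma continuation: "continuation \<in> aug_space \<rightarrow>\<^sub>M prob_algebra product_space"
  "a \<in> space aug_space \<Longrightarrow> distr (continuation a) (initial_space k) (initial_part k) = prefix_law kernel k a"
proof -
  have "\<exists>\<Lambda>. \<Lambda> \<in> aug_space \<rightarrow>\<^sub>M prob_algebra product_space \<and>
    (\<forall>k. \<forall>a\<in>space aug_space. distr (\<Lambda> a) (initial_space k) (initial_part k) = prefix_law kernel k a)"
    using Ionescu_Tulcea_kernel[of kernel, OF measurable_kernel] by metis
  from someI_ex[OF this]
  show "continuation \<in> aug_space \<rightarrow>\<^sub>M prob_algebra product_space"
    "a \<in> space aug_space \<Longrightarrow> distr (continuation a) (initial_space k) (initial_part k) = prefix_law kernel k a"
    unfolding continuation_def by blast+
qed

text \<open>The kernels depend on \<open>\<nu>\<close> through their exceptional sets. The result is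
  measurable in every initial point, but is claimed to be the prescribed law only for
  \<open>\<nu>\<close>-almost every one.\<close>

definition law :: "'e \<Rightarrow> 'e pieces measure" where
  "law x = aug_law (modify P start_null) x \<bind> continuation"

definition total_law :: "'e pieces measure" where
  "total_law = \<nu> \<bind> law"

lemma measurable_law: "law \<in> borel \<rightarrow>\<^sub>M prob_algebra product_space"
  unfolding law_def[abs_def] by (rule measurable_bind_prob_space[OF measurable_start continuation(1)])

lemma total_law_eq: "total_law = (\<nu> \<bind> aug_law (modify P start_null)) \<bind> continuation"
  unfolding total_law_def law_def[abs_def]
  by (rule bind_prob_algebra_assoc[OF \<nu>_in measurable_start continuation(1), symmetric])

lemma total_law_in: "total_law \<in> space (prob_algebra product_space)"
  unfolding total_law_def by (rule bind_in_prob_algebra[OF \<nu>_in measurable_law])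

lemma law_in: "law x \<in> space (prob_algebra product_space)"
  using measurable_space[OF measurable_law, of x] by simp

lemma start_law_in: "aug_law (modify P start_null) x \<in> space (prob_algebra aug_space)"
  using measurable_space[OF measurable_start, of x] by simp

text \<open>The initial law is arbitrary here, so the same facts serve the process from a fixed
  point and the process with initial law \<open>\<nu>\<close>.\<close>

lemma distr_continuation:
  assumes \<rho>: "\<rho> \<in> space (prob_algebra aug_space)"
  shows "distr (\<rho> \<bind> continuation) (initial_space k) (initial_part k) = \<rho> \<bind> prefix_law kernel k"
proof -
  have "distr (\<rho> \<bind> continuation) (initial_space k) (initial_part k) =
      \<rho> \<bind> (\<lambda>a. distr (continuation a) (initial_space k) (initial_part k))"
    by (rule distr_bind_prob_algebra[OF \<rho> continuation(1) measurable_initial_part_product])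
  also have "\<dots> = \<rho> \<bind> prefix_law kernel k"
    by (rule bind_cong[OF refl]) (simp add: continuation(2) space_prob_algebraD(3)[OF \<rho>])
  finally show ?thesis .
qed

lemma continuation_step:
  assumes \<rho>: "\<rho> \<in> space (prob_algebra aug_space)"
  shows "distr (\<rho> \<bind> continuation) (initial_space (Suc k)) (initial_part (Suc k)) =
    distr (\<rho> \<bind> continuation) (initial_space k) (initial_part k) \<bind> extend_law k (kernel k)"
  unfolding distr_continuation[OF \<rho>] prefix_law.simps
  by (rule bind_prob_algebra_assoc[OF \<rho> measurable_prefix_law[OF measurable_kernel]
        measurable_extend_law[OF measurable_kernel], symmetric])

lemma distr_continuation_fst:
  assumes \<rho>: "\<rho> \<in> space (prob_algebra aug_space)"
  shows "distr (\<rho> \<bind> continuation) aug_space fst = \<rho>"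
proof -
  let ?f = "fst :: 'e pieces \<Rightarrow> 'e \<times> 'e path"
  have f: "?f \<in> initial_space 0 \<rightarrow>\<^sub>M aug_space"
    unfolding initial_space_eq by measurable
  have in': "\<rho> \<bind> continuation \<in> space (prob_algebra product_space)"
    by (rule bind_in_prob_algebra[OF \<rho> continuation(1)])
  have "distr (\<rho> \<bind> continuation) aug_space (?f \<circ> initial_part 0) = distr (\<rho> \<bind> prefix_law kernel 0) aug_space ?f"
    unfolding distr_continuation[OF \<rho>, symmetric]
    by (rule distr_distr[symmetric, OF f measurable_sets_eq[OF measurable_initial_part_product space_prob_algebraD(2)[OF in']]])
  also have "\<dots> = \<rho> \<bind> (\<lambda>a. distr (prefix_law kernel 0 a) aug_space ?f)"
    by (rule distr_bind_prob_algebra[OF \<rho> measurable_prefix_law[OF measurable_kernel] f])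
  also have "\<dots> = \<rho> \<bind> return aug_space"
  proof (rule bind_cong[OF refl])
    fix a assume "a \<in> space \<rho>"
    then have "(a, \<lambda>_. undefined) \<in> space (initial_space 0 :: 'e pieces measure)"
      using space_prob_algebraD(3)[OF \<rho>] by (auto simp: initial_space_def space_pair_measure space_PiM)
    then show "distr (prefix_law kernel 0 a) aug_space ?f = return aug_space a"
      using distr_return[OF f] by simp
  qed
  also have "\<dots> = \<rho>"
    by (rule bind_return''[OF space_prob_algebraD(2)[OF \<rho>]])
  finally show ?thesis
    by (simp add: initial_part_def comp_def)
qed

lemma distr_total_law: "distr total_law (initial_space k) (initial_part k) = stage k"
proof (induction k)
  case 0
  show ?case
    unfolding total_law_eq distr_continuation[OF start_in] by (simp add: start_null_def prefix_law.simps(1)[abs_def])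
next
  case (Suc k)
  then show ?case
    unfolding total_law_eq continuation_step[OF start_in] stage_Suc by simp
qed

lemma pred_null_jump: "Measurable.pred (initial_space k) (\<lambda>w. emeasure (jump k w) (kernel_null k) = 0)"
  using measurable_emeasure_subprob_algebra[OF sets_kernel_null] measurable_prob_algebraD[OF measurable_jump]
  by measurable

lemma pred_null_jump_product:
  "Measurable.pred product_space (\<lambda>w. emeasure (jump k (initial_part k w)) (kernel_null k) = 0)"
  using measurable_compose[OF measurable_initial_part_product pred_null_jump] by simp

text \<open>The mass of the exceptional set under the composed law is the integral of its masses
  under the jump kernel. Since the integral is 0, almost all of these masses vanish.\<close>

lemma AE_total_jump: "AE w in total_law. emeasure (jump k (initial_part k w)) (kernel_null k) = 0"
proof -
  have "(\<integral>\<^sup>+w. emeasure (jump k w) (kernel_null k) \<partial>stage k) = emeasure (stage k \<bind> jump k) (kernel_null k)"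
    by (rule emeasure_bind_prob_algebra[OF stage_in measurable_jump sets_kernel_null, symmetric])
  also have "\<dots> = 0"
    using kernel_null_null[of k] by auto
  finally have "AE w in stage k. emeasure (jump k w) (kernel_null k) = 0"
    using measurable_sets_eq[OF measurable_compose[OF measurable_prob_algebraD[OF measurable_jump]
        measurable_emeasure_subprob_algebra[OF sets_kernel_null]] space_prob_algebraD(2)[OF stage_in]]
    by (subst (asm) nn_integral_0_iff_AE)
  then show ?thesis
    unfolding distr_total_law[symmetric]
    using pred_null_jump[of k]
    by (subst (asm) AE_distr_iff[OF measurable_sets_eq[OF measurable_initial_part_product space_prob_algebraD(2)[OF total_law_in]]])
      (simp_all add: pred_def)
qed

lemma AE_law_jump: "AE x in \<nu>. \<forall>k. AE w in law x. emeasure (jump k (initial_part k w)) (kernel_null k) = 0"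
  unfolding AE_all_countable
  using AE_total_jump unfolding total_law_def
  by (subst (asm) AE_bind_prob_algebra[OF \<nu>_in measurable_law pred_null_jump_product]) simp

lemma AE_start: "AE x in \<nu>. x \<notin> start_null"
  using exceptional(1)[OF \<nu>_in] unfolding start_null_def by (rule AE_not_in)

lemma jump_in: "w \<in> space (initial_space k) \<Longrightarrow> jump k w \<in> space (prob_algebra borel)"
  by (rule measurable_space[OF measurable_jump])

section \<open>Identification with the prescribed law of the pieces\<close>

abbreviation raw_kernel :: "nat \<Rightarrow> 'e pieces \<Rightarrow> 'e path measure" where
  "raw_kernel \<equiv> path_kernel P Q ebar zbar \<tau> Z"

abbreviation next_event :: "nat \<Rightarrow> 'e pieces set \<Rightarrow> 'e path set \<Rightarrow> 'e pieces set" where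
  "next_event k A F \<equiv> {w \<in> space product_space. initial_part k w \<in> A \<and> piece w (Suc k) \<in> F}"

text \<open>A jump law that does not charge the exceptional set cannot distinguish the original
  family from the modified one under the integral.\<close>

lemma path_kernel_eq:
  assumes w: "w \<in> space (initial_space k)" and null: "emeasure (jump k w) (kernel_null k) = 0"
  shows "raw_kernel k w = kernel k w"
proof -
  have "sets (kernel k w) = sets path_space"
    using measurable_space[OF measurable_kernel w] by (simp add: space_prob_algebra)
  then have s: "sets path_space = sets (kernel k w)" "space path_space = space (kernel k w)"
    by (auto dest: sets_eq_imp_space_eq)
  have "kernel_null k \<in> null_sets (jump k w)"
    using null sets_kernel_null space_prob_algebraD(2)[OF jump_in[OF w]] by (auto simp: null_sets_def)
  then have AE: "AE v in jump k w. v \<notin> kernel_null k"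
    by (rule AE_not_in)
  show ?thesis
    unfolding path_kernel_def s
  proof (rule measure_of_eqI)
    fix F assume F: "F \<in> sets (kernel k w)"
    have "(\<integral>\<^sup>+v. emeasure (P v) F \<partial>completion (jump k w)) = (\<integral>\<^sup>+v. emeasure (modify P (kernel_null k) v) F \<partial>jump k w)"
      unfolding nn_integral_completion by (rule nn_integral_cong_AE) (use AE in eventually_elim, simp add: modify_def)
    also have "\<dots> = emeasure (kernel k w) F"
      unfolding kernel_def
      by (rule emeasure_bind_prob_algebra[symmetric, OF jump_in[OF w] measurable_modify]) (use F s in simp)
    finally show "(\<integral>\<^sup>+v. emeasure (P v) F \<partial>completion (jump k w)) = emeasure (kernel k w) F" .
  qed
qed

lemma measurable_piece_product: "(\<lambda>w. piece w k) \<in> product_space \<rightarrow>\<^sub>M path_space"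
  unfolding product_space_eq by (rule measurable_piece) auto

lemma measurable_part_piece:
  "(\<lambda>w. (initial_part k w, piece w (Suc k))) \<in> product_space \<rightarrow>\<^sub>M initial_space k \<Otimes>\<^sub>M path_space"
  by (intro measurable_Pair measurable_initial_part_product measurable_piece_product)

lemma emeasure_next_piece:
  assumes \<mu>: "\<mu> \<in> space (prob_algebra product_space)"
    and step: "distr \<mu> (initial_space (Suc k)) (initial_part (Suc k)) =
      distr \<mu> (initial_space k) (initial_part k) \<bind> extend_law k (kernel k)"
    and null: "AE w in \<mu>. emeasure (jump k (initial_part k w)) (kernel_null k) = 0"
    and A: "A \<in> sets (initial_space k)" and F: "F \<in> sets path_space"
  shows "emeasure \<mu> (next_event k A F) =
    (\<integral>\<^sup>+w. indicator A (initial_part k w) *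
       emeasure (raw_kernel k (initial_part k w)) F \<partial>completion \<mu>)"
proof -
  note m = space_prob_algebraD[OF \<mu>]
  have sets: "(next_event k A F) \<in> sets \<mu>"
    using sets_Collect_in[OF measurable_part_piece pair_measureI[OF A F]] m(2) by simp
  have "emeasure \<mu> (next_event k A F) =
      (\<integral>\<^sup>+w. indicator (next_event k A F) w \<partial>\<mu>)"
    using sets by simp
  also have "\<dots> = (\<integral>\<^sup>+w. indicator A (initial_part k w) * indicator F (piece w (Suc k)) \<partial>\<mu>)"
    by (rule nn_integral_cong) (auto simp: m(3) split: split_indicator)
  also have "\<dots> = (\<integral>\<^sup>+w. \<integral>\<^sup>+f. indicator A (initial_part k w) * indicator F f \<partial>kernel k (initial_part k w) \<partial>\<mu>)"
  proof (rule nn_integral_next_piece[OF \<mu> step measurable_kernel])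
    show "(\<lambda>(w, f). indicator A w * indicator F f :: ennreal) \<in> borel_measurable (initial_space k \<Otimes>\<^sub>M path_space)"
      using A F by measurable
  qed
  also have "\<dots> = (\<integral>\<^sup>+w. indicator A (initial_part k w) *
       emeasure (raw_kernel k (initial_part k w)) F \<partial>\<mu>)"
  proof (rule nn_integral_cong_AE)
    show "AE w in \<mu>. (\<integral>\<^sup>+f. indicator A (initial_part k w) * indicator F f \<partial>kernel k (initial_part k w)) =
        indicator A (initial_part k w) * emeasure (raw_kernel k (initial_part k w)) F"
      using null
    proof (rule AE_mp, intro AE_I2 impI)
      fix w assume "w \<in> space \<mu>" and null: "emeasure (jump k (initial_part k w)) (kernel_null k) = 0"
      then have w: "initial_part k w \<in> space (initial_space k)"
        using measurable_space[OF measurable_initial_part_product] m(3) by blast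
      have "F \<in> sets (kernel k (initial_part k w))"
        using measurable_space[OF measurable_kernel w] F by (simp add: space_prob_algebra)
      then show "(\<integral>\<^sup>+f. indicator A (initial_part k w) * indicator F f \<partial>kernel k (initial_part k w)) =
          indicator A (initial_part k w) * emeasure (raw_kernel k (initial_part k w)) F"
        by (simp add: path_kernel_eq[OF w null] nn_integral_cmult)
    qed
  qed
  finally show ?thesis
    by (simp add: nn_integral_completion)
qed

lemma law_step: "distr (law x) (initial_space (Suc k)) (initial_part (Suc k)) =
    distr (law x) (initial_space k) (initial_part k) \<bind> extend_law k (kernel k)"
  unfolding law_def by (rule continuation_step[OF start_law_in])

text \<open>Existence comes from the modified kernels. For uniqueness, a competing law is compared
  with \<open>law x\<close> on initial parts, by induction: the defining identity fixes the joint
  law of an initial part and the next piece.\<close>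

lemma pieces_law_eq:
  assumes x: "x \<notin> start_null"
    and null: "\<And>k. AE w in law x. emeasure (jump k (initial_part k w)) (kernel_null k) = 0"
  shows "pieces_law P Q ebar zbar \<tau> Z x = law x"
  unfolding pieces_law_def
proof (rule the_equality)
  have start: "aug_law (modify P start_null) x = aug_law P x"
    using x by (simp add: aug_law_def modify_def)
  have law_start: "distr (law x) aug_space fst = aug_law P x"
    unfolding law_def distr_continuation_fst[OF start_law_in] by (rule start)
  show "prob_space (law x) \<and> sets (law x) = sets product_space \<and>
     distr (law x) aug_space fst = aug_law P x \<and>
     (\<forall>k. \<forall>A\<in>sets (initial_space k). \<forall>F\<in>sets path_space.
        emeasure (law x) (next_event k A F) =
        (\<integral>\<^sup>+w. indicator A (initial_part k w) *
           emeasure (raw_kernel k (initial_part k w)) F \<partial>completion (law x)))"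
    using space_prob_algebraD[OF law_in] law_start emeasure_next_piece[OF law_in law_step null] by blast
  fix \<mu> :: "'e pieces measure"
  assume \<mu>: "prob_space \<mu> \<and> sets \<mu> = sets product_space \<and>
     distr \<mu> aug_space fst = aug_law P x \<and>
     (\<forall>k. \<forall>A\<in>sets (initial_space k). \<forall>F\<in>sets path_space.
        emeasure \<mu> (next_event k A F) =
        (\<integral>\<^sup>+w. indicator A (initial_part k w) *
           emeasure (raw_kernel k (initial_part k w)) F \<partial>completion \<mu>))"
  then have \<mu>_in: "\<mu> \<in> space (prob_algebra product_space)"
    by (simp add: space_prob_algebra)
  note m = space_prob_algebraD[OF \<mu>_in] and l = space_prob_algebraD[OF law_in, of x]
  have "distr \<mu> (initial_space k) (initial_part k) = distr (law x) (initial_space k) (initial_part k)" for k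
  proof (induction k)
    case 0
    have "distr \<mu>' (initial_space 0) (initial_part 0) = distr (distr \<mu>' aug_space fst) (initial_space 0) (\<lambda>a. (a, \<lambda>_. undefined))"
      if "sets \<mu>' = sets product_space" for \<mu>' :: "'e pieces measure"
    proof -
      have "initial_part 0 = (\<lambda>a. (a, \<lambda>_. undefined)) \<circ> (fst :: 'e pieces \<Rightarrow> _)"
        by (simp add: initial_part_def fun_eq_iff)
      then show ?thesis
        using distr_distr[OF measurable_empty_pieces measurable_sets_eq[OF measurable_fst_product that]] by simp
    qed
    with m(2) l(2) \<mu> law_start show ?case by simp
  next
    case (Suc k)
    let ?g = "\<lambda>w. (initial_part k w, piece w (Suc k))" and ?M = "initial_space k \<Otimes>\<^sub>M path_space :: ('e pieces \<times> 'e path) measure"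
    note g\<mu> = measurable_sets_eq[OF measurable_part_piece m(2), of k]
      and gl = measurable_sets_eq[OF measurable_part_piece l(2), of k]
    let ?E = "{a \<times> b | a b. a \<in> sets (initial_space k :: 'e pieces measure) \<and> b \<in> sets (path_space :: 'e path measure)}"
    \<comment> \<open>The competing law is not assumed to avoid the exceptional sets. The condition
      concerns only the initial part up to \<open>k\<close>, whose law is already known to be the
      same by the induction hypothesis.\<close>
    have null\<mu>: "AE w in \<mu>. emeasure (jump k (initial_part k w)) (kernel_null k) = 0"
    proof -
      have "AE w in distr (law x) (initial_space k) (initial_part k). emeasure (jump k w) (kernel_null k) = 0"
        using pred_null_jump[of k] null[of k]
        by (subst AE_distr_iff[OF measurable_sets_eq[OF measurable_initial_part_product l(2)]]) (simp_all add: pred_def)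
      then show ?thesis
        unfolding Suc[symmetric] using pred_null_jump[of k]
        by (subst (asm) AE_distr_iff[OF measurable_sets_eq[OF measurable_initial_part_product m(2)]]) (simp_all add: pred_def)
    qed
    have int: "(\<integral>\<^sup>+w. indicator A (initial_part k w) * emeasure (raw_kernel k (initial_part k w)) F \<partial>completion \<mu>') =
        (\<integral>\<^sup>+w. indicator A w * emeasure (kernel k w) F \<partial>distr \<mu>' (initial_space k) (initial_part k))"
      if \<mu>': "sets \<mu>' = sets product_space" "AE w in \<mu>'. emeasure (jump k (initial_part k w)) (kernel_null k) = 0"
        and A: "A \<in> sets (initial_space k)" and F: "F \<in> sets path_space" for A F and \<mu>' :: "'e pieces measure"
    proof -
      have "(\<integral>\<^sup>+w. indicator A (initial_part k w) * emeasure (raw_kernel k (initial_part k w)) F \<partial>completion \<mu>') =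
          (\<integral>\<^sup>+w. indicator A (initial_part k w) * emeasure (kernel k (initial_part k w)) F \<partial>\<mu>')"
        unfolding nn_integral_completion
      proof (rule nn_integral_cong_AE)
        show "AE w in \<mu>'. indicator A (initial_part k w) * emeasure (raw_kernel k (initial_part k w)) F =
            indicator A (initial_part k w) * emeasure (kernel k (initial_part k w)) F"
          using \<mu>'(2) AE_space
        proof eventually_elim
          case (elim w)
          then have "initial_part k w \<in> space (initial_space k)"
            using measurable_space[OF measurable_initial_part_product] sets_eq_imp_space_eq[OF \<mu>'(1)] by blast
          then show ?case
            using path_kernel_eq elim by simp
        qed
      qed
      also have "\<dots> = (\<integral>\<^sup>+w. indicator A w * emeasure (kernel k w) F \<partial>distr \<mu>' (initial_space k) (initial_part k))"
      proof (rule nn_integral_distr[symmetric, OF measurable_sets_eq[OF measurable_initial_part_product \<mu>'(1)]])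
        have [measurable]: "(\<lambda>w. emeasure (kernel k w) F) \<in> borel_measurable (initial_space k)"
          by (rule measurable_compose[OF measurable_prob_algebraD[OF measurable_kernel]
                measurable_emeasure_subprob_algebra[OF F]])
        show "(\<lambda>w. indicator A w * emeasure (kernel k w) F) \<in> borel_measurable (distr \<mu>' (initial_space k) (initial_part k))"
          using A by measurable
      qed
      finally show ?thesis .
    qed
    \<comment> \<open>The defining identity gives the masses of all measurable rectangles, which
      determine the joint law; appending the piece then yields the next initial part.\<close>
    have "distr \<mu> ?M ?g = distr (law x) ?M ?g"
    proof (rule measure_eqI_generator_eq_countable[OF Int_stable_pair_measure_generator[of "initial_space k" path_space]])
      show "?E \<subseteq> Pow (space (initial_space k) \<times> space path_space)"
        using sets.space_closed[of "initial_space k :: 'e pieces measure"] sets.space_closed[of "path_space :: 'e path measure"]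
        by blast
      fix X assume "X \<in> ?E"
      then obtain A F where X: "X = A \<times> F" and A: "A \<in> sets (initial_space k)" and F: "F \<in> sets path_space"
        by blast
      have eq: "?g -` X \<inter> space product_space = next_event k A F"
        by (auto simp: X)
      have "emeasure (distr \<mu> ?M ?g) X = emeasure \<mu> (next_event k A F)"
        using emeasure_distr[OF g\<mu>, of X] pair_measureI[OF A F] m(3) eq X by simp
      also have "\<dots> = (\<integral>\<^sup>+w. indicator A w * emeasure (kernel k w) F \<partial>distr \<mu> (initial_space k) (initial_part k))"
        using \<mu> A F int[OF m(2) null\<mu> A F] by simp
      also have "\<dots> = (\<integral>\<^sup>+w. indicator A w * emeasure (kernel k w) F \<partial>distr (law x) (initial_space k) (initial_part k))"
        by (simp add: Suc)
      also have "\<dots> = emeasure (law x) (next_event k A F)"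
        using int[OF l(2) null A F] emeasure_next_piece[OF law_in law_step null A F] by simp
      also have "\<dots> = emeasure (distr (law x) ?M ?g) X"
        using emeasure_distr[OF gl, of X] pair_measureI[OF A F] l(3) eq X by simp
      finally show "emeasure (distr \<mu> ?M ?g) X = emeasure (distr (law x) ?M ?g) X" .
    next
      show "sets (distr \<mu> ?M ?g) = sigma_sets (space (initial_space k) \<times> space path_space) ?E"
        "sets (distr (law x) ?M ?g) = sigma_sets (space (initial_space k) \<times> space path_space) ?E"
        by (simp_all add: sets_pair_measure)
      show "{space (initial_space k) \<times> space path_space} \<subseteq> ?E" by blast
      show "emeasure (distr \<mu> ?M ?g) a \<noteq> \<infinity>" if "a \<in> {space (initial_space k) \<times> space path_space}" for a
        using finite_measure.emeasure_finite[OF prob_space.finite_measure[OF prob_space.prob_space_distr[OF m(1) g\<mu>]]] by simp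
    qed simp_all
    moreover have "distr \<mu>' (initial_space (Suc k)) (initial_part (Suc k)) =
        distr (distr \<mu>' ?M ?g) (initial_space (Suc k)) (\<lambda>(w, f). append_piece k w f)"
      if "sets \<mu>' = sets product_space" for \<mu>' :: "'e pieces measure"
    proof -
      have "initial_part (Suc k) = (\<lambda>(w, f). append_piece k w f) \<circ> ?g"
        by (simp add: fun_eq_iff append_piece_initial_part)
      then show ?thesis
        using distr_distr[OF measurable_append_piece measurable_sets_eq[OF measurable_part_piece that]] by metis
    qed
    ultimately show ?case
      using m(2) l(2) by simp
  qed
  then show "\<mu> = law x"
    by (rule measure_eqI_initial_parts[OF \<mu>_in law_in])
qed

lemma AE_pieces_law: "AE x in \<nu>. pieces_law P Q ebar zbar \<tau> Z x = law x"
  using AE_law_jump AE_start by eventually_elim (rule pieces_law_eq, blast+)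

text \<open>The initial point is integrated out, so equality of \<open>pieces_law\<close> and
  \<open>law\<close> for \<open>\<nu>\<close>-almost every point suffices.\<close>

lemma initial_controlled_law_eq:
  "initial_controlled_law P Q ebar zbar \<tau> Z \<nu> = distr total_law aug_space (controlled_path ebar \<tau>)"
proof -
  let ?M = "distr total_law aug_space (controlled_path ebar \<tau>)"
  have s: "sets aug_space = sets ?M" "space aug_space = space ?M" by simp_all
  show ?thesis
    unfolding initial_controlled_law_def s(1) s(2)
  proof (rule measure_of_eqI)
    fix F assume "F \<in> sets ?M"
    then have F: "F \<in> sets aug_space" by simp
    let ?V = "controlled_path ebar \<tau> -` F \<inter> space product_space"
    have V: "?V \<in> sets product_space"
      by (rule measurable_sets[OF measurable_controlled_path F])
    have e: "emeasure (distr \<mu> aug_space (controlled_path ebar \<tau>)) F = emeasure \<mu> ?V"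
      if "\<mu> \<in> space (prob_algebra product_space)" for \<mu>
      using emeasure_distr[OF measurable_sets_eq[OF measurable_controlled_path] F] space_prob_algebraD[OF that] by simp
    have "(\<integral>\<^sup>+x. emeasure (controlled_law P Q ebar zbar \<tau> Z x) F \<partial>completion \<nu>) = (\<integral>\<^sup>+x. emeasure (law x) ?V \<partial>\<nu>)"
      unfolding nn_integral_completion
      by (rule nn_integral_cong_AE) (use AE_pieces_law in eventually_elim, simp add: controlled_law_def e[OF law_in])
    also have "\<dots> = emeasure total_law ?V"
      unfolding total_law_def by (rule emeasure_bind_prob_algebra[OF \<nu>_in measurable_law V, symmetric])
    also have "\<dots> = emeasure ?M F"
      by (rule e[OF total_law_in, symmetric])
    finally show "(\<integral>\<^sup>+x. emeasure (controlled_law P Q ebar zbar \<tau> Z x) F \<partial>completion \<nu>) = emeasure ?M F" .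
  qed
qed

lemma AE_total_nonexplosive:
  assumes "nonexplosive P Q ebar zbar \<tau> Z"
  shows "AE w in total_law. jump_time \<tau> w \<longlonglongrightarrow> \<infinity>"
  unfolding total_law_def
proof (subst AE_bind_prob_algebra[OF \<nu>_in measurable_law pred_nonexplosive])
  show "AE x in \<nu>. AE w in law x. jump_time \<tau> w \<longlonglongrightarrow> \<infinity>"
    using AE_pieces_law
  proof eventually_elim
    case (elim x)
    then show ?case
      using assms unfolding nonexplosive_def by metis
  qed
qed

end

section \<open>The present at an intervention time\<close>

lemma (in finite_measure) sigma_finite_subalgebraI:
  "subalgebra M F \<Longrightarrow> sigma_finite_subalgebra M F"
  by (intro finite_measure_subalgebra_is_sigma_finite finite_measure_subalgebra.intro
      finite_measure_axioms finite_measure_subalgebra_axioms.intro)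

context impulse_policy
begin

text \<open>A level set of \<open>f\<close> is an event of the strict past and does not separate the
  two paths.\<close>

lemma policy_past_fun_agree:
  fixes f :: "'e \<times> 'e path \<Rightarrow> ennreal"
  assumes f: "f \<in> policy_past \<tau> k \<rightarrow>\<^sub>M borel" and k: "k \<ge> 1" and agree: "agree_before (\<tau> k \<omega>) \<omega> \<omega>'"
    and \<omega>: "\<omega> \<in> space aug_space" "\<omega>' \<in> space aug_space"
  shows "f \<omega>' = f \<omega>"
proof -
  have "f -` {f \<omega>} \<inter> space (policy_past \<tau> k) \<in> sets (policy_past \<tau> k)"
    by (rule measurable_sets[OF f]) simp
  from agree_policy_past[OF this k agree \<omega>] show ?thesis
    using \<omega> by auto
qed

abbreviation value_events :: "nat \<Rightarrow> ('e \<times> 'e path) set set" where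
  "value_events k \<equiv> {{\<omega> \<in> space aug_space. \<tau> k \<omega> < \<infinity> \<and> snd \<omega> (enn2real (\<tau> k \<omega>)) \<in> B} | B. B \<in> sets borel}"

lemma space_policy_present [simp]: "space (policy_present \<tau> k) = space aug_space"
  unfolding policy_present_def
  by (rule space_measure_of) (use sets.space_closed[of "policy_past \<tau> k"] in auto)

lemma sets_policy_present: "sets (policy_present \<tau> k) = sigma_sets (space aug_space)
     (initial_events \<union> sets (policy_past \<tau> k) \<union> value_events k)"
  unfolding policy_present_def
  by (rule sets_measure_of) (use sets.space_closed[of "policy_past \<tau> k"] in auto)

text \<open>At an infinite time \<open>enn2real\<close> returns 0, so the value is then that at time
  0. It carries no meaning there, but keeps the function total and measurable on the augmented
  space.\<close>

definition value_at :: "nat \<Rightarrow> 'e \<times> 'e path \<Rightarrow> 'e" where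
  "value_at k \<omega> = snd \<omega> (enn2real (\<tau> k \<omega>))"

lemma measurable_value_at: "k \<ge> 1 \<Longrightarrow> value_at k \<in> aug_space \<rightarrow>\<^sub>M borel"
  unfolding value_at_def[abs_def]
  by (rule measurable_path_eval_random[OF measurable_aug_snd]) auto

lemma sets_policy_past_present: "sets (policy_past \<tau> k) \<subseteq> sets (policy_present \<tau> k)"
  unfolding sets_policy_present by (blast intro: sigma_sets.Basic)

lemma measurable_policy_past_present: "f \<in> policy_past \<tau> k \<rightarrow>\<^sub>M N \<Longrightarrow> f \<in> policy_present \<tau> k \<rightarrow>\<^sub>M N"
  using measurable_mono[OF order_refl refl sets_policy_past_present] by fastforce

lemma sets_policy_present_aug_space:
  assumes k: "k \<ge> 1"
  shows "sets (policy_present \<tau> k) \<subseteq> sets aug_space"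
  unfolding sets_policy_present
proof (rule sets.sigma_sets_subset, intro Un_least)
  show "initial_events \<subseteq> sets aug_space"
    by auto
  show "sets (policy_past \<tau> k) \<subseteq> sets aug_space"
    by (rule sets_policy_past_aug_space[OF k])
  show "value_events k \<subseteq> sets aug_space"
  proof safe
    fix B :: "'e set" assume [measurable]: "B \<in> sets borel"
    note measurable_value_at[OF k, measurable] measurable_\<tau>[OF k, measurable]
    have "{\<omega> \<in> space aug_space. \<tau> k \<omega> < \<infinity> \<and> value_at k \<omega> \<in> B} \<in> sets aug_space"
      by measurable
    then show "{\<omega> \<in> space aug_space. \<tau> k \<omega> < \<infinity> \<and> snd \<omega> (enn2real (\<tau> k \<omega>)) \<in> B} \<in> sets aug_space"
      by (simp add: value_at_def)
  qed
qed

text \<open>The counterpart of Galmarini's test for the present: besides the path before the time,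
  one further value has to coincide.\<close>

lemma agree_policy_present:
  assumes A: "A \<in> sets (policy_present \<tau> k)" and k: "k \<ge> 1" and agree: "agree_before (\<tau> k \<omega>) \<omega> \<omega>'"
    and "value_at k \<omega> = value_at k \<omega>'" and \<omega>: "\<omega> \<in> space aug_space" "\<omega>' \<in> space aug_space"
  shows "\<omega> \<in> A \<longleftrightarrow> \<omega>' \<in> A"
proof (rule sigma_sets_same_atom[OF A[unfolded sets_policy_present] \<omega>])
  fix g assume "g \<in> initial_events \<union> sets (policy_past \<tau> k) \<union> value_events k"
  then consider B where "g = {\<omega> \<in> space aug_space. fst \<omega> \<in> B}" | "g \<in> sets (policy_past \<tau> k)"
    | B where "g = {\<omega> \<in> space aug_space. \<tau> k \<omega> < \<infinity> \<and> value_at k \<omega> \<in> B}"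
    unfolding value_at_def by blast
  then show "\<omega> \<in> g \<longleftrightarrow> \<omega>' \<in> g"
  proof cases
    case 1
    with agree \<omega> show ?thesis by (simp add: agree_before_def)
  next
    case 2
    then show ?thesis by (rule agree_policy_past[OF _ k agree \<omega>])
  next
    case 3
    with assms(4) \<tau>_agree[OF k agree \<omega>] \<omega> show ?thesis by simp
  qed
qed

lemma measurable_value_at_present:
  "(\<lambda>\<omega>. if \<tau> k \<omega> < \<infinity> then value_at k \<omega> else c) \<in> policy_present \<tau> k \<rightarrow>\<^sub>M borel"
proof (rule measurableI)
  fix B :: "'e set" assume B: "B \<in> sets borel"
  have 1: "{\<omega> \<in> space aug_space. \<tau> k \<omega> < \<infinity> \<and> value_at k \<omega> \<in> B} \<in> sets (policy_present \<tau> k)"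
    unfolding sets_policy_present value_at_def using B by (intro sigma_sets.Basic) blast
  have "{\<omega> \<in> space (policy_past \<tau> k). \<not> \<tau> k \<omega> < \<infinity>} \<in> sets (policy_past \<tau> k)"
    by measurable
  then have 2: "{\<omega> \<in> space aug_space. \<not> \<tau> k \<omega> < \<infinity>} \<in> sets (policy_present \<tau> k)"
    using sets_policy_past_present by (simp only: space_policy_past) blast
  have "(\<lambda>\<omega>. if \<tau> k \<omega> < \<infinity> then value_at k \<omega> else c) -` B \<inter> space (policy_present \<tau> k) =
      {\<omega> \<in> space aug_space. \<tau> k \<omega> < \<infinity> \<and> value_at k \<omega> \<in> B} \<union>
      (if c \<in> B then {\<omega> \<in> space aug_space. \<not> \<tau> k \<omega> < \<infinity>} else {})"
    by (auto split: if_split_asm)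
  also have "\<dots> \<in> sets (policy_present \<tau> k)"
    using sets.Un[OF 1 2] 1 by (cases "c \<in> B") (simp_all only: if_True if_False Un_empty_right)
  finally show "(\<lambda>\<omega>. if \<tau> k \<omega> < \<infinity> then value_at k \<omega> else c) -` B \<inter> space (policy_present \<tau> k) \<in> sets (policy_present \<tau> k)" .
qed simp

lemma measurable_fst_present: "fst \<in> policy_present \<tau> k \<rightarrow>\<^sub>M borel"
proof (rule measurableI)
  fix B :: "'e set" assume "B \<in> sets borel"
  then have "{\<omega> \<in> space aug_space. fst \<omega> \<in> B} \<in> sets (policy_present \<tau> k)"
    unfolding sets_policy_present by (intro sigma_sets.Basic) blast
  then show "fst -` B \<inter> space (policy_present \<tau> k) \<in> sets (policy_present \<tau> k)"
    by (simp add: vimage_def Int_def conj_commute)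
qed simp

text \<open>The splice forgets the path from the intervention time on, and what remains is known in
  the strict past together with the value at 0-. This is why the prescribed conditional probability
  can be measurable for the present although it is written in terms of the whole path.\<close>

lemma measurable_splice_present:
  "(\<lambda>(\<omega>, f). splice \<omega> (enn2real (\<tau> k \<omega>)) f) \<in> policy_present \<tau> k \<Otimes>\<^sub>M path_space \<rightarrow>\<^sub>M aug_space"
  unfolding split_beta'
proof (rule measurable_splice)
  let ?G = "policy_present \<tau> k" and ?N = "policy_present \<tau> k \<Otimes>\<^sub>M (path_space :: 'e path measure)"
  have \<tau>: "\<tau> k \<in> ?G \<rightarrow>\<^sub>M borel"
    by (rule measurable_policy_past_present) measurable
  show "(\<lambda>x. fst (fst x)) \<in> ?N \<rightarrow>\<^sub>M borel"
    by (rule measurable_compose[OF measurable_fst measurable_fst_present])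
  show "snd (fst x) \<in> cadlag_paths" if "x \<in> space ?N" for x
    using that by (auto simp: space_pair_measure space_aug_space)
  show "(\<lambda>x. enn2real (\<tau> k (fst x))) \<in> borel_measurable ?N"
    using measurable_compose[OF measurable_fst \<tau>] by measurable
  show "snd \<in> ?N \<rightarrow>\<^sub>M path_space"
    by measurable
  fix s :: real assume s: "s \<ge> 0"
  have "(\<lambda>x. if 0 \<le> s \<and> ennreal s < \<tau> k (fst x) then snd (fst x) s else undefined) \<in> ?N \<rightarrow>\<^sub>M borel"
    by (rule measurable_compose[OF measurable_fst measurable_policy_past_present[OF measurable_value_before]])
  then have "(\<lambda>x. if 0 \<le> s \<and> ennreal s < \<tau> k (fst x) then snd (fst x) s else undefined)
      \<in> restrict_space ?N {x. s < enn2real (\<tau> k (fst x))} \<rightarrow>\<^sub>M borel"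
    by (rule measurable_restrict_space1)
  \<comment> \<open>An infinite \<open>t\<close> satisfies the premise for no nonnegative
    \<open>s\<close>, because \<open>enn2real\<close> sends it to 0.\<close>
  moreover have "ennreal s < t" if "s < enn2real t" for t
    using that s by (cases t) (auto simp: ennreal_lessI)
  ultimately show "(\<lambda>x. snd (fst x) s) \<in> restrict_space ?N {x. s < enn2real (\<tau> k (fst x))} \<rightarrow>\<^sub>M borel"
    using s by (subst measurable_cong[of _ _ "\<lambda>x. if 0 \<le> s \<and> ennreal s < \<tau> k (fst x) then snd (fst x) s else undefined"])
      (auto simp: space_restrict_space)
qed

definition between_event :: "nat \<Rightarrow> nat \<Rightarrow> (nat \<Rightarrow> real) \<Rightarrow> (nat \<Rightarrow> 'e set) \<Rightarrow> 'e \<times> 'e path \<Rightarrow> 'e path set" where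
  "between_event k n t B \<omega> = {\<omega>' \<in> cadlag_paths.
     \<tau> (Suc k) (splice \<omega> (enn2real (\<tau> k \<omega>)) \<omega>') - \<tau> k \<omega> > ennreal (t n) \<and> (\<forall>i\<in>{1..n}. \<omega>' (t i) \<in> B i)}"

lemma between_event_agree:
  assumes k: "k \<ge> 1" and agree: "agree_before (\<tau> k \<omega>) \<omega> \<omega>'" and fin: "\<tau> k \<omega> < \<infinity>"
    and \<omega>: "\<omega> \<in> space aug_space" "\<omega>' \<in> space aug_space"
  shows "between_event k n t B \<omega>' = between_event k n t B \<omega>"
proof -
  obtain r where r: "\<tau> k \<omega> = ennreal r" "r \<ge> 0"
    using fin by (cases "\<tau> k \<omega>") auto
  have "splice \<omega>' r f = splice \<omega> r f" for f
    using agree r by (intro aug_path_eqI)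
      (auto simp: snd_splice_extensional snd_splice agree_before_def ennreal_less_iff)
  with r \<tau>_agree[OF k agree \<omega>] show ?thesis
    by (simp add: between_event_def)
qed

text \<open>The events for the different \<open>\<omega>\<close> are the sections of one measurable
  set. In this form their masses under a kernel that itself varies with \<open>\<omega>\<close> are
  measurable.\<close>

lemma sets_between_event_present:
  assumes t: "\<And>i. i \<in> {1..n} \<Longrightarrow> 0 \<le> t i" and B: "\<And>i. i \<in> {1..n} \<Longrightarrow> B i \<in> sets borel"
  shows "(SIGMA \<omega>:space (policy_present \<tau> k). between_event k n t B \<omega>) \<in> sets (policy_present \<tau> k \<Otimes>\<^sub>M path_space)"
proof -
  let ?N = "policy_present \<tau> k \<Otimes>\<^sub>M (path_space :: 'e path measure)"
  have [measurable]: "(\<lambda>x. \<tau> (Suc k) (splice (fst x) (enn2real (\<tau> k (fst x))) (snd x))) \<in> ?N \<rightarrow>\<^sub>M borel"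
    using measurable_compose[OF measurable_splice_present measurable_\<tau>] by (simp add: split_beta')
  have [measurable]: "(\<lambda>x. \<tau> k (fst x)) \<in> ?N \<rightarrow>\<^sub>M borel"
    by (rule measurable_compose[OF measurable_fst measurable_policy_past_present]) measurable
  have "{x \<in> space ?N. \<forall>i\<in>{1..n}. snd x (t i) \<in> B i} \<in> sets ?N"
    by (rule sets_Collect_Ball_in[OF measurable_compose[OF measurable_snd measurable_path_space_eval]])
      (use t B in auto)
  moreover have "{x \<in> space ?N. \<tau> (Suc k) (splice (fst x) (enn2real (\<tau> k (fst x))) (snd x)) - \<tau> k (fst x) > ennreal (t n)} \<in> sets ?N"
    by measurable
  ultimately have "{x \<in> space ?N. \<forall>i\<in>{1..n}. snd x (t i) \<in> B i} \<inter>
      {x \<in> space ?N. \<tau> (Suc k) (splice (fst x) (enn2real (\<tau> k (fst x))) (snd x)) - \<tau> k (fst x) > ennreal (t n)} \<in> sets ?N"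
    by (rule sets.Int)
  also have "{x \<in> space ?N. \<forall>i\<in>{1..n}. snd x (t i) \<in> B i} \<inter>
      {x \<in> space ?N. \<tau> (Suc k) (splice (fst x) (enn2real (\<tau> k (fst x))) (snd x)) - \<tau> k (fst x) > ennreal (t n)} =
      (SIGMA \<omega>:space (policy_present \<tau> k). between_event k n t B \<omega>)"
    by (auto simp: between_event_def space_pair_measure)
  finally show ?thesis .
qed

end

section \<open>Disintegration of a piece by its starting value\<close>

context controlled_process
begin

abbreviation modified :: "nat \<Rightarrow> 'e \<Rightarrow> 'e path measure" where
  "modified k \<equiv> modify P (kernel_null k)"

lemma modified_in: "modified k v \<in> space (prob_algebra path_space)"
  using measurable_space[OF measurable_modify, of v k] by simp

lemma AE_P_start: "AE f in P v. f 0 = v"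
proof (rule prob_space.AE_prob_1[OF markov_familyD(1)[OF markov], THEN AE_mp])
  have "{f \<in> cadlag_paths. f 0 = v} \<in> sets (path_space :: 'e path measure)"
    using sets_Collect_in[OF measurable_path_space_eval[of 0], of "{v}"] by simp
  show "measure (P v) {f \<in> cadlag_paths. f 0 = v} = 1"
    using markov_familyD(5)[OF markov, of v] by (simp add: measure_def)
qed auto

text \<open>Off the exceptional set the modified law is \<open>P v\<close>, whose paths start at
  \<open>v\<close> almost surely. The value at 0 of the next piece can thus be exchanged with the
  drawn point, which almost surely is not exceptional.\<close>

lemma nn_integral_next_start:
  assumes J [measurable]: "(\<lambda>(w, v, f). J w v f) \<in> borel_measurable (initial_space k \<Otimes>\<^sub>M borel \<Otimes>\<^sub>M path_space)"
  shows "(\<integral>\<^sup>+w. J (initial_part k w) (piece w (Suc k) 0) (piece w (Suc k)) \<partial>total_law) =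
    (\<integral>\<^sup>+w. \<integral>\<^sup>+v. \<integral>\<^sup>+f. J (initial_part k w) v f \<partial>modified k v \<partial>jump k (initial_part k w) \<partial>total_law)"
proof -
  note m = space_prob_algebraD[OF total_law_in]
  have H: "(\<lambda>(w, f). J w (f 0) f) \<in> borel_measurable (initial_space k \<Otimes>\<^sub>M path_space)"
  proof -
    have "(\<lambda>x. (fst x, snd x 0, snd x)) \<in> initial_space k \<Otimes>\<^sub>M path_space \<rightarrow>\<^sub>M initial_space k \<Otimes>\<^sub>M borel \<Otimes>\<^sub>M (path_space :: 'e path measure)"
      by (intro measurable_Pair measurable_fst measurable_snd measurable_compose[OF measurable_snd measurable_path_space_eval]) simp
    from measurable_compose[OF this J] show ?thesis
      by (simp add: split_beta')
  qed
  have "(\<integral>\<^sup>+w. J (initial_part k w) (piece w (Suc k) 0) (piece w (Suc k)) \<partial>total_law) =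
      (\<integral>\<^sup>+w. \<integral>\<^sup>+f. J (initial_part k w) (f 0) f \<partial>kernel k (initial_part k w) \<partial>total_law)"
    using nn_integral_next_piece[OF total_law_in _ measurable_kernel H]
      continuation_step[OF start_in, of k] by (simp add: total_law_eq)
  also have "\<dots> = (\<integral>\<^sup>+w. \<integral>\<^sup>+v. \<integral>\<^sup>+f. J (initial_part k w) v f \<partial>modified k v \<partial>jump k (initial_part k w) \<partial>total_law)"
  proof (rule nn_integral_cong_AE)
    show "AE w in total_law. (\<integral>\<^sup>+f. J (initial_part k w) (f 0) f \<partial>kernel k (initial_part k w)) =
        (\<integral>\<^sup>+v. \<integral>\<^sup>+f. J (initial_part k w) v f \<partial>modified k v \<partial>jump k (initial_part k w))"
      using AE_total_jump[of k] AE_space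
    proof eventually_elim
      case (elim w)
      then have w: "initial_part k w \<in> space (initial_space k)"
        using measurable_space[OF measurable_initial_part_product] m(3) by blast
      have H1: "(\<lambda>f. J (initial_part k w) (f 0) f) \<in> borel_measurable path_space"
        using measurable_compose[OF measurable_Pair1'[OF w] H] by simp
      have "kernel_null k \<in> null_sets (jump k (initial_part k w))"
        using elim sets_kernel_null space_prob_algebraD(2)[OF jump_in[OF w]] by (auto simp: null_sets_def)
      then have AE: "AE v in jump k (initial_part k w). v \<notin> kernel_null k"
        by (rule AE_not_in)
      have "(\<integral>\<^sup>+f. J (initial_part k w) (f 0) f \<partial>kernel k (initial_part k w)) =
          (\<integral>\<^sup>+v. \<integral>\<^sup>+f. J (initial_part k w) (f 0) f \<partial>modified k v \<partial>jump k (initial_part k w))"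
        unfolding kernel_def by (rule nn_integral_bind_prob_algebra[OF jump_in[OF w] measurable_modify H1])
      also have "\<dots> = (\<integral>\<^sup>+v. \<integral>\<^sup>+f. J (initial_part k w) v f \<partial>modified k v \<partial>jump k (initial_part k w))"
      proof (rule nn_integral_cong_AE)
        show "AE v in jump k (initial_part k w). (\<integral>\<^sup>+f. J (initial_part k w) (f 0) f \<partial>modified k v) =
            (\<integral>\<^sup>+f. J (initial_part k w) v f \<partial>modified k v)"
          using AE
        proof eventually_elim
          case (elim v)
          then have eq: "modified k v = P v" by (simp add: modify_def)
          show ?case
            unfolding eq by (rule nn_integral_cong_AE) (use AE_P_start in eventually_elim, simp)
        qed
      qed
      finally show ?case .
    qed
  qed
  finally show ?thesis .
qed

text \<open>Averaging over the path first gives the function \<open>J'\<close> of the earlier pieces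
  and the drawn point. Using the preceding lemma once for \<open>J\<close> and once, backwards, for
  \<open>J'\<close> replaces the drawn point by the starting value of the piece.\<close>

lemma nn_integral_given_start:
  assumes J [measurable]: "(\<lambda>(w, v, f). J w v f) \<in> borel_measurable (initial_space k \<Otimes>\<^sub>M borel \<Otimes>\<^sub>M path_space)"
  shows "(\<integral>\<^sup>+w. J (initial_part k w) (piece w (Suc k) 0) (piece w (Suc k)) \<partial>total_law) =
    (\<integral>\<^sup>+w. \<integral>\<^sup>+f. J (initial_part k w) (piece w (Suc k) 0) f \<partial>modified k (piece w (Suc k) 0) \<partial>total_law)"
proof -
  define J' where "J' w v = (\<integral>\<^sup>+f. J w v f \<partial>modified k v)" for w v
  have J2: "(\<lambda>(x, f). J (fst x) (snd x) f) \<in> borel_measurable ((initial_space k \<Otimes>\<^sub>M borel) \<Otimes>\<^sub>M path_space)"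
  proof -
    have "(\<lambda>x. (fst (fst x), snd (fst x), snd x)) \<in> (initial_space k \<Otimes>\<^sub>M borel) \<Otimes>\<^sub>M path_space \<rightarrow>\<^sub>M
        initial_space k \<Otimes>\<^sub>M (borel :: 'e measure) \<Otimes>\<^sub>M (path_space :: 'e path measure)"
      by measurable
    from measurable_compose[OF this J] show ?thesis
      by (simp add: split_beta')
  qed
  have "(\<lambda>x. J' (fst x) (snd x)) \<in> borel_measurable (initial_space k \<Otimes>\<^sub>M borel)"
    unfolding J'_def
    by (rule nn_integral_measurable_subprob_algebra2[OF J2])
      (rule measurable_compose[OF measurable_snd measurable_prob_algebraD[OF measurable_modify]])
  then have J'': "(\<lambda>(w, v, f). J' w v) \<in> borel_measurable (initial_space k \<Otimes>\<^sub>M borel \<Otimes>\<^sub>M (path_space :: 'e path measure))"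
  proof -
    assume J': "(\<lambda>x. J' (fst x) (snd x)) \<in> borel_measurable (initial_space k \<Otimes>\<^sub>M borel)"
    have "(\<lambda>x. (fst x, fst (snd x))) \<in> initial_space k \<Otimes>\<^sub>M borel \<Otimes>\<^sub>M (path_space :: 'e path measure) \<rightarrow>\<^sub>M
        initial_space k \<Otimes>\<^sub>M (borel :: 'e measure)"
      by measurable
    from measurable_compose[OF this J'] show ?thesis
      by (simp add: split_beta')
  qed
  \<comment> \<open>The function \<open>J'\<close> does not depend on the path, so the innermost
    integral in the second use is over a constant.\<close>
  have const: "(\<integral>\<^sup>+f. c \<partial>modified k v) = c" for c v
    using prob_space.emeasure_space_1[OF space_prob_algebraD(1)[OF modified_in]] by simp
  show ?thesis
    using nn_integral_next_start[OF J] nn_integral_next_start[OF J'']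
    by (simp add: J'_def const del: nn_integral_const)
qed

end

section \<open>The controlled process\<close>

locale nonexplosive_process = controlled_process S \<tau> Z P Q ebar zbar \<nu>
  for S :: "'z measure" and \<tau> :: "nat \<Rightarrow> 'e::polish_space \<times> 'e path \<Rightarrow> ennreal"
    and Z :: "nat \<Rightarrow> 'e \<times> 'e path \<Rightarrow> 'z" and P Q ebar zbar \<nu> +
  assumes nonexplosive: "nonexplosive P Q ebar zbar \<tau> Z"
begin

abbreviation X :: "'e pieces \<Rightarrow> 'e \<times> 'e path" where
  "X \<equiv> controlled_path ebar \<tau>"

abbreviation T :: "'e pieces \<Rightarrow> nat \<Rightarrow> ennreal" where
  "T \<equiv> jump_time \<tau>"

definition M :: "('e \<times> 'e path) measure" where
  "M = distr total_law aug_space X"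

definition regular :: "'e pieces \<Rightarrow> bool" where
  "regular w \<longleftrightarrow> w \<in> space product_space \<and> T w \<longlonglongrightarrow> \<infinity>"

lemma AE_regular: "AE w in total_law. regular w"
  using AE_total_nonexplosive[OF nonexplosive] AE_space
  by eventually_elim (simp add: regular_def space_prob_algebraD(3)[OF total_law_in])

lemma measurable_X: "X \<in> total_law \<rightarrow>\<^sub>M aug_space"
  by (rule measurable_sets_eq[OF measurable_controlled_path space_prob_algebraD(2)[OF total_law_in]])

lemma prob_space_M: "prob_space M"
  unfolding M_def by (rule prob_space.prob_space_distr[OF space_prob_algebraD(1)[OF total_law_in] measurable_X])

lemma sets_M [simp]: "sets M = sets aug_space" and space_M [simp]: "space M = space aug_space"
  by (simp_all add: M_def)

lemma sigma_finite_subalgebra_M: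
  "space G = space aug_space \<Longrightarrow> sets G \<subseteq> sets aug_space \<Longrightarrow> sigma_finite_subalgebra M G"
  by (intro finite_measure.sigma_finite_subalgebraI prob_space.finite_measure[OF prob_space_M])
    (simp add: subalgebra_def)

lemma nn_integral_M: "\<phi> \<in> borel_measurable aug_space \<Longrightarrow> (\<integral>\<^sup>+\<omega>. \<phi> \<omega> \<partial>M) = (\<integral>\<^sup>+w. \<phi> (X w) \<partial>total_law)"
  unfolding M_def by (rule nn_integral_distr[OF measurable_X]) simp

lemma good_pieces_regular: "regular w \<Longrightarrow> good_pieces k w"
  by (simp add: regular_def good_pieces_product_space)

lemma X_in_space: "regular w \<Longrightarrow> X w \<in> space aug_space"
  by (simp add: regular_def controlled_path_in_space)

lemma pasted_in_space: "regular w \<Longrightarrow> pasted_path \<tau> k w \<in> space aug_space"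
  by (rule pasted_path_in_space[OF good_pieces_regular])

lemma agree_X: "regular w \<Longrightarrow> agree_before (T w (Suc k)) (pasted_path \<tau> k w) (X w)"
  using agree_controlled_pasted good_pieces_regular by (subst agree_before_sym) (simp add: regular_def)

lemma agree_X_\<tau>: "regular w \<Longrightarrow> agree_before (\<tau> (Suc k) (pasted_path \<tau> k w)) (pasted_path \<tau> k w) (X w)"
  using agree_X[of w k] by (simp add: jump_time_Suc)

lemma \<tau>_X: "regular w \<Longrightarrow> \<tau> (Suc k) (X w) = T w (Suc k)"
  using \<tau>_agree[OF _ agree_X_\<tau> pasted_in_space X_in_space] by (simp add: jump_time_Suc)

lemma snd_X:
  assumes w: "regular w" and t: "t \<ge> 0" and fin: "T w (Suc k) < \<infinity>"
    and less: "ennreal (enn2real (T w (Suc k)) + t) < T w (Suc (Suc k))"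
  shows "snd (X w) (enn2real (T w (Suc k)) + t) = piece w (Suc k) t"
proof -
  have "snd (X w) (enn2real (T w (Suc k)) + t) = snd (pasted_path \<tau> (Suc k) w) (enn2real (T w (Suc k)) + t)"
    using agree_X[OF w, of "Suc k"] less t by (simp add: agree_before_def)
  then show ?thesis
    using t fin by (simp add: pasted_path_Suc[OF good_pieces_regular[OF w]] snd_splice)
qed

lemma T_less: "regular w \<Longrightarrow> T w (Suc k) < \<infinity> \<Longrightarrow> T w (Suc k) < T w (Suc (Suc k))"
  using pasted_path_invariant[OF good_pieces_regular, of w "Suc k"] by auto

lemma value_at_X: "regular w \<Longrightarrow> T w (Suc k) < \<infinity> \<Longrightarrow> value_at (Suc k) (X w) = piece w (Suc k) 0"
  using snd_X[of w 0 k] T_less[of w k] by (simp add: value_at_def \<tau>_X less_top)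

lemma pasted_initial_part: "regular w \<Longrightarrow> pasted_path \<tau> k (initial_part k w) = pasted_path \<tau> k w"
  using pasted_path_cong[of k w "initial_part k w", OF good_pieces_regular] by (simp add: initial_part_def)

lemma T_initial_part: "regular w \<Longrightarrow> T (initial_part k w) (Suc k) = T w (Suc k)"
  by (simp add: jump_time_Suc pasted_initial_part)

lemma X_mem_past:
  "B \<in> sets (policy_past \<tau> (Suc k)) \<Longrightarrow> regular w \<Longrightarrow> X w \<in> B \<longleftrightarrow> pasted_path \<tau> k w \<in> B"
  using agree_policy_past[OF _ _ agree_X_\<tau> pasted_in_space X_in_space] by simp

lemma measurable_pasted_initial: "pasted_path \<tau> k \<in> initial_space k \<rightarrow>\<^sub>M aug_space"
  unfolding initial_space_eq by (rule measurable_pasted_path) simp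

lemma measurable_T_initial: "(\<lambda>w. T w (Suc k)) \<in> initial_space k \<rightarrow>\<^sub>M borel"
  unfolding initial_space_eq by (rule measurable_jump_time_Suc) simp

lemma distr_start_fst: "distr (aug_law (modify P start_null) x) borel fst = return borel x"
proof -
  have "prob_space (modify P start_null x)"
    using markov_familyD(1)[OF markov] by (simp add: modify_def)
  from prob_space.distr_pair_fst[OF this, of "return borel x"] show ?thesis
    unfolding aug_law_def by (simp cong: distr_cong)
qed

lemma distr_M_fst: "distr M borel fst = \<nu>"
proof -
  let ?s = "aug_law (modify P start_null)"
  note ft = measurable_sets_eq[OF measurable_fst_product space_prob_algebraD(2)[OF total_law_in]]
  have "distr M borel fst = distr total_law borel (fst \<circ> X)"
    unfolding M_def by (rule distr_distr[OF measurable_aug_fst measurable_X])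
  also have "\<dots> = distr total_law borel (fst \<circ> fst)"
  proof (rule distr_cong_AE[OF refl refl])
    show "AE w in total_law. (fst \<circ> X) w = (fst \<circ> fst) w"
      using AE_regular by eventually_elim (simp add: regular_def controlled_path_eq)
  qed (use measurable_comp[OF measurable_X measurable_aug_fst] measurable_comp[OF ft measurable_aug_fst] in simp_all)
  also have "\<dots> = distr (distr total_law aug_space fst) borel fst"
    by (rule distr_distr[OF measurable_aug_fst ft, symmetric])
  also have "\<dots> = distr (\<nu> \<bind> ?s) borel fst"
    unfolding total_law_eq distr_continuation_fst[OF start_in] ..
  also have "\<dots> = \<nu> \<bind> (\<lambda>x. distr (?s x) borel fst)"
    by (rule distr_bind_prob_algebra[OF \<nu>_in measurable_start measurable_aug_fst])
  also have "\<dots> = \<nu> \<bind> return borel"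
    by (simp only: distr_start_fst)
  also have "\<dots> = \<nu>"
    by (rule bind_return''[OF \<nu>(2)])
  finally show ?thesis .
qed

lemma AE_start_M: "AE \<omega> in M. fst \<omega> \<notin> start_null"
proof -
  have "AE x in distr M borel fst. x \<notin> start_null"
    unfolding distr_M_fst by (rule AE_start)
  then show ?thesis
    using sets_start_null by (subst (asm) AE_distr_iff) (auto cong: measurable_cong_sets)
qed

text \<open>At a finite time the value is the starting value of a new piece. This is what allows the
  passage from the modified family back to \<open>P\<close> in the conditional probabilities after
  an intervention.\<close>

lemma AE_value_at_M: "AE \<omega> in M. \<tau> (Suc k) \<omega> < \<infinity> \<longrightarrow> value_at (Suc k) \<omega> \<notin> kernel_null k"
proof -
  note [measurable] = sets_kernel_null measurable_\<tau>[of "Suc k"] measurable_value_at[of "Suc k"]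
  have J: "(\<lambda>(w, v, f). indicator (kernel_null k) v :: ennreal) \<in> borel_measurable (initial_space k \<Otimes>\<^sub>M borel \<Otimes>\<^sub>M (path_space :: 'e path measure))"
    by measurable
  have "(\<integral>\<^sup>+w. indicator (kernel_null k) (piece w (Suc k) 0) \<partial>total_law) =
      (\<integral>\<^sup>+w. \<integral>\<^sup>+v. \<integral>\<^sup>+f. indicator (kernel_null k) v \<partial>modified k v \<partial>jump k (initial_part k w) \<partial>total_law)"
    using nn_integral_next_start[OF J] .
  also have "\<dots> = (\<integral>\<^sup>+w. emeasure (jump k (initial_part k w)) (kernel_null k) \<partial>total_law)"
  proof (rule nn_integral_cong)
    fix w assume "w \<in> space total_law"
    then have "initial_part k w \<in> space (initial_space k)"
      using measurable_space[OF measurable_initial_part_product] space_prob_algebraD(3)[OF total_law_in] by blast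
    then have "kernel_null k \<in> sets (jump k (initial_part k w))"
      using space_prob_algebraD(2)[OF jump_in] by simp
    then show "(\<integral>\<^sup>+v. \<integral>\<^sup>+f. indicator (kernel_null k) v \<partial>modified k v \<partial>jump k (initial_part k w)) =
        emeasure (jump k (initial_part k w)) (kernel_null k)"
      using prob_space.emeasure_space_1[OF space_prob_algebraD(1)[OF modified_in]] by simp
  qed
  also have "\<dots> = (\<integral>\<^sup>+w. 0 \<partial>total_law)"
    by (rule nn_integral_cong_AE[OF AE_total_jump])
  finally have "(\<integral>\<^sup>+w. indicator (kernel_null k) (piece w (Suc k) 0) \<partial>total_law) = 0"
    by simp
  moreover have "(\<lambda>w. indicator (kernel_null k) (piece w (Suc k) 0) :: ennreal) \<in> borel_measurable total_law"
    using measurable_compose[OF measurable_sets_eq[OF measurable_piece_product space_prob_algebraD(2)[OF total_law_in]]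
        measurable_path_space_eval[of 0], of "Suc k"] by measurable
  ultimately have "AE w in total_law. (indicator (kernel_null k) (piece w (Suc k) 0) :: ennreal) = 0"
    by (simp add: nn_integral_0_iff_AE)
  then have "AE w in total_law. \<tau> (Suc k) (X w) < \<infinity> \<longrightarrow> value_at (Suc k) (X w) \<notin> kernel_null k"
    using AE_regular by eventually_elim (auto simp: value_at_X \<tau>_X split: split_indicator_asm)
  then show ?thesis
    unfolding M_def by (subst AE_distr_iff[OF measurable_X]) (simp_all, measurable)
qed

text \<open>The event is decided by the initial piece, so the claim is about \<open>aug_law\<close>
  alone: it puts the value at 0- at its starting point and thereby disintegrates the law of the
  initial piece by that value.\<close>

theorem fundamental_first: "fundamental_between P \<tau> M 1"
  unfolding fundamental_between_def if_P[OF refl] Let_def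
proof (intro allI impI)
  fix n :: nat and t :: "nat \<Rightarrow> real" and B :: "nat \<Rightarrow> 'e set"
  assume n: "n \<ge> 1" and t: "0 \<le> t 1" "strict_mono_on {1..n} t" and B: "\<forall>i\<in>{1..n}. B i \<in> sets borel"
  have t': "0 \<le> t i" "t i \<le> t n" if "i \<in> {1..n}" for i
    using that t n strict_mono_on_leD[OF t(2), of 1 i] strict_mono_on_leD[OF t(2), of i n] by auto
  let ?E = "{\<omega> \<in> space aug_space. \<tau> 1 \<omega> > ennreal (t n) \<and> (\<forall>i\<in>{1..n}. snd \<omega> (t i) \<in> B i)}"
  let ?G = "vimage_algebra (space aug_space) fst borel :: ('e \<times> 'e path) measure"
  let ?s = "aug_law (modify P start_null)"
  have E: "?E \<in> sets aug_space"
  proof -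
    have "{\<omega> \<in> space aug_space. \<forall>i\<in>{1..n}. snd \<omega> (t i) \<in> B i} \<in> sets aug_space"
      by (rule sets_Collect_Ball_in[OF measurable_compose[OF measurable_aug_snd measurable_path_space_eval]])
        (use t' B in auto)
    moreover have "{\<omega> \<in> space aug_space. \<tau> 1 \<omega> > ennreal (t n)} \<in> sets aug_space"
      by measurable
    ultimately have "{\<omega> \<in> space aug_space. \<forall>i\<in>{1..n}. snd \<omega> (t i) \<in> B i} \<inter> {\<omega> \<in> space aug_space. \<tau> 1 \<omega> > ennreal (t n)} \<in> sets aug_space"
      by (rule sets.Int)
    also have "{\<omega> \<in> space aug_space. \<forall>i\<in>{1..n}. snd \<omega> (t i) \<in> B i} \<inter> {\<omega> \<in> space aug_space. \<tau> 1 \<omega> > ennreal (t n)} = ?E"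
      by blast
    finally show ?thesis .
  qed
  \<comment> \<open>No sampled time exceeds \<open>t n\<close>, so on the event that the first
    intervention comes after \<open>t n\<close> all samples are taken before it.\<close>
  have mem: "X w \<in> ?E \<longleftrightarrow> fst w \<in> ?E" if w: "regular w" for w
  proof -
    have p: "pasted_path \<tau> 0 w = fst w"
      by (rule pasted_path_0[OF good_pieces_regular[OF w, of 0]])
    have sp: "fst w \<in> space aug_space"
      using pasted_in_space[OF w, of 0] by (simp add: p)
    have agree: "agree_before (\<tau> 1 (fst w)) (fst w) (X w)"
      using agree_X_\<tau>[OF w, of 0] by (simp add: p)
    have \<tau>: "\<tau> 1 (X w) = \<tau> 1 (fst w)"
      using \<tau>_X[OF w, of 0] by (simp add: jump_time_Suc p)
    have "snd (X w) (t i) = snd (fst w) (t i)" if "ennreal (t n) < \<tau> 1 (fst w)" "i \<in> {1..n}" for i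
      using agree t'[OF that(2)] le_less_trans[OF ennreal_leI that(1)] by (auto simp: agree_before_def)
    then show ?thesis
      using \<tau> sp X_in_space[OF w] by auto
  qed
  have fG: "fst \<in> ?G \<rightarrow>\<^sub>M borel"
    by (rule measurable_vimage_algebra1) simp
  have sG: "sets ?G \<subseteq> sets aug_space"
    by (subst sets_vimage_algebra2) (auto intro: measurable_sets[OF measurable_aug_fst])
  interpret G: sigma_finite_subalgebra M ?G
    by (rule sigma_finite_subalgebra_M) (use sG in simp_all)
  have s: "(\<lambda>x. emeasure (?s x) ?E) \<in> borel_measurable borel"
    by (rule measurable_compose[OF measurable_prob_algebraD[OF measurable_start] measurable_emeasure_subprob_algebra[OF E]])
  \<comment> \<open>The characterization of conditional expectations needs a measurable candidate,
    hence the modified start; the two agree off \<open>start_null\<close>.\<close>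
  have "AE \<omega> in M. emeasure (?s (fst \<omega>)) ?E = nn_cond_exp M ?G (indicator ?E) \<omega>"
  proof (rule G.nn_cond_exp_charact)
    show "indicator ?E \<in> borel_measurable M"
      by (rule measurable_sets_eq[OF borel_measurable_indicator[OF E] sets_M])
    show "(\<lambda>\<omega>. emeasure (?s (fst \<omega>)) ?E) \<in> borel_measurable ?G"
      by (rule measurable_compose[OF fG s])
    fix D assume "D \<in> sets ?G"
    then obtain A where D: "D = fst -` A \<inter> space aug_space" and A: "A \<in> sets borel"
      by (subst (asm) sets_vimage_algebra2) auto
    have D': "D \<in> sets aug_space"
      unfolding D by (rule measurable_sets[OF measurable_aug_fst A])
    let ?H = "\<lambda>a. indicator ?E a * indicator A (fst a) :: ennreal"
    have H: "?H \<in> borel_measurable aug_space"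
      using E A by measurable
    have "(\<integral>\<^sup>+\<omega>. indicator ?E \<omega> * indicator D \<omega> \<partial>M) = (\<integral>\<^sup>+w. indicator ?E (X w) * indicator D (X w) \<partial>total_law)"
      by (intro nn_integral_M borel_measurable_times_ennreal borel_measurable_indicator E D')
    also have "\<dots> = (\<integral>\<^sup>+w. ?H (fst w) \<partial>total_law)"
    proof (rule nn_integral_cong_AE)
      show "AE w in total_law. indicator ?E (X w) * indicator D (X w) = ?H (fst w)"
        using AE_regular
      proof eventually_elim
        case (elim w)
        then have "fst (X w) = fst (fst w)"
          by (simp add: regular_def controlled_path_eq)
        then have "X w \<in> D \<longleftrightarrow> fst (fst w) \<in> A"
          using X_in_space[OF elim] by (simp add: D)
        with mem[OF elim] show ?case
          unfolding indicator_def by presburger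
      qed
    qed
    also have "\<dots> = (\<integral>\<^sup>+a. ?H a \<partial>distr total_law aug_space fst)"
      by (rule nn_integral_distr[symmetric]) (use measurable_sets_eq[OF measurable_fst_product space_prob_algebraD(2)[OF total_law_in]] H in simp_all)
    also have "distr total_law aug_space fst = \<nu> \<bind> ?s"
      unfolding total_law_eq by (rule distr_continuation_fst[OF start_in])
    also have "(\<integral>\<^sup>+a. ?H a \<partial>(\<nu> \<bind> ?s)) = (\<integral>\<^sup>+x. \<integral>\<^sup>+a. ?H a \<partial>?s x \<partial>\<nu>)"
      by (rule nn_integral_bind_prob_algebra[OF \<nu>_in measurable_start H])
    \<comment> \<open>Under \<open>?s x\<close> the value at 0- is almost surely \<open>x\<close>,
      which takes the indicator of \<open>A\<close> out of the inner integral.\<close>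
    also have "\<dots> = (\<integral>\<^sup>+x. emeasure (?s x) ?E * indicator A x \<partial>\<nu>)"
    proof (rule nn_integral_cong)
      fix x :: 'e
      note sx = space_prob_algebraD[OF start_law_in, of x]
      note distr_start_fst[of x]
      moreover have "AE y in return borel x. y = x"
        by (subst AE_return) auto
      ultimately have "AE y in distr (?s x) borel fst. y = x"
        by (simp only:)
      then have "AE a in ?s x. fst a = x"
        by (subst (asm) AE_distr_iff[OF measurable_sets_eq[OF measurable_aug_fst sx(2)]]) simp_all
      then have "AE a in ?s x. ?H a = indicator ?E a * indicator A x"
        by eventually_elim simp
      then have "(\<integral>\<^sup>+a. ?H a \<partial>?s x) = (\<integral>\<^sup>+a. indicator ?E a * indicator A x \<partial>?s x)"
        by (rule nn_integral_cong_AE)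
      also have "\<dots> = emeasure (?s x) ?E * indicator A x"
        using E sx(2) by (subst nn_integral_multc[OF measurable_sets_eq[OF borel_measurable_indicator[OF E] sx(2)]]) simp
      finally show "(\<integral>\<^sup>+a. ?H a \<partial>?s x) = emeasure (?s x) ?E * indicator A x" .
    qed
    also have "\<dots> = (\<integral>\<^sup>+x. emeasure (?s x) ?E * indicator A x \<partial>distr M borel fst)"
      by (simp add: distr_M_fst)
    also have "\<dots> = (\<integral>\<^sup>+\<omega>. emeasure (?s (fst \<omega>)) ?E * indicator A (fst \<omega>) \<partial>M)"
      by (rule nn_integral_distr) (use s A in \<open>simp_all cong: measurable_cong_sets\<close>)
    also have "\<dots> = (\<integral>\<^sup>+\<omega>. emeasure (?s (fst \<omega>)) ?E * indicator D \<omega> \<partial>M)"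
      by (rule nn_integral_cong) (simp add: D indicator_def)
    finally show "(\<integral>\<^sup>+\<omega>\<in>D. indicator ?E \<omega> \<partial>M) = (\<integral>\<^sup>+\<omega>\<in>D. emeasure (?s (fst \<omega>)) ?E \<partial>M)" .
  qed
  then show "AE \<omega> in M. nn_cond_exp M ?G (indicator ?E) \<omega> = emeasure (aug_law P (fst \<omega>)) ?E"
    using AE_start_M by eventually_elim (simp add: aug_law_def modify_def)
qed

text \<open>The strict past and the finiteness of the time depend on the pieces before the jump
  only, while the value at the time is the starting value of the next piece. Given those pieces,
  that value has the law \<open>jump k\<close>, which is a function of the strict past.\<close>

theorem jump_distribution:
  "regular_cond_distr_on M (policy_past \<tau> (Suc k)) {\<omega> \<in> space aug_space. \<tau> (Suc k) \<omega> < \<infinity>}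
    (\<lambda>\<omega>. snd \<omega> (enn2real (\<tau> (Suc k) \<omega>))) borel (\<lambda>\<omega>. Q (left_limit \<omega> (\<tau> (Suc k) \<omega>), Z (Suc k) \<omega>))"
  unfolding regular_cond_distr_on_def
proof (intro conjI ballI)
  let ?G = "policy_past \<tau> (Suc k)" and ?A = "{\<omega> \<in> space aug_space. \<tau> (Suc k) \<omega> < \<infinity>}"
  have "{\<omega> \<in> space ?G. \<tau> (Suc k) \<omega> < \<infinity>} \<in> sets ?G"
    by measurable
  then show A: "?A \<in> sets ?G" by simp
  show "(\<lambda>\<omega>. Q (left_limit \<omega> (\<tau> (Suc k) \<omega>), Z (Suc k) \<omega>)) \<in> restrict_space ?G ?A \<rightarrow>\<^sub>M prob_algebra borel"
    by (rule measurable_jump_distribution[OF Q]) simp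
  fix \<Gamma> :: "'e set" assume \<Gamma>: "\<Gamma> \<in> sets borel"
  note measurable_\<tau>[of "Suc k", measurable] measurable_value_at[of "Suc k", measurable]
  let ?f = "indicator {\<omega> \<in> ?A. value_at (Suc k) \<omega> \<in> \<Gamma>} :: _ \<Rightarrow> ennreal"
  let ?L = "jump_law Q ebar \<tau> Z (Suc k)"
  \<comment> \<open>The value 0 at infinite times matches \<open>?f\<close>, which vanishes there,
    so the identity can be tested on all events of the strict past and not merely on those inside
    \<open>?A\<close>.\<close>
  define g where "g \<omega> = (if \<tau> (Suc k) \<omega> < \<infinity> then emeasure (?L \<omega>) \<Gamma> else 0)" for \<omega>
  have L: "?L \<in> ?G \<rightarrow>\<^sub>M prob_algebra borel"
    by (rule measurable_jump_law[OF Q]) simp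
  have [measurable]: "(\<lambda>\<omega>. emeasure (?L \<omega>) \<Gamma>) \<in> borel_measurable ?G"
    by (rule measurable_compose[OF measurable_prob_algebraD[OF L] measurable_emeasure_subprob_algebra[OF \<Gamma>]])
  have g: "g \<in> borel_measurable ?G"
    unfolding g_def by measurable
  interpret G: sigma_finite_subalgebra M ?G
    by (rule sigma_finite_subalgebra_M) (use sets_policy_past_aug_space[of "Suc k"] in simp_all)
  have "{\<omega> \<in> space aug_space. \<tau> (Suc k) \<omega> < \<infinity> \<and> value_at (Suc k) \<omega> \<in> \<Gamma>} \<in> sets aug_space"
    using \<Gamma> by measurable
  then have F: "{\<omega> \<in> ?A. value_at (Suc k) \<omega> \<in> \<Gamma>} \<in> sets aug_space"
    by simp
  have "AE \<omega> in M. g \<omega> = nn_cond_exp M ?G ?f \<omega>"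
  proof (rule G.nn_cond_exp_charact[OF _ _ g])
    show "?f \<in> borel_measurable M"
      by (rule measurable_sets_eq[OF borel_measurable_indicator[OF F] sets_M])
    fix B assume B: "B \<in> sets ?G"
    have B': "B \<in> sets aug_space"
      using B sets_policy_past_aug_space[of "Suc k"] by auto
    \<comment> \<open>The first two factors are read off the earlier pieces; only the last one looks
      at the drawn point.\<close>
    define J where "J w v = (indicator B (pasted_path \<tau> k w) * indicator {w. T w (Suc k) < \<infinity>} w * indicator \<Gamma> v :: ennreal)" for w v
    have J: "(\<lambda>(w, v, f). J w v) \<in> borel_measurable (initial_space k \<Otimes>\<^sub>M borel \<Otimes>\<^sub>M (path_space :: 'e path measure))"
    proof -
      have [measurable]: "(\<lambda>w. indicator B (pasted_path \<tau> k w) :: ennreal) \<in> borel_measurable (initial_space k)"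
        by (rule measurable_compose[OF measurable_pasted_initial borel_measurable_indicator[OF B']])
      have [measurable]: "(\<lambda>w. indicator {w. T w (Suc k) < \<infinity>} w :: ennreal) \<in> borel_measurable (initial_space k)"
        using measurable_T_initial unfolding indicator_def by measurable
      show ?thesis
        unfolding J_def using \<Gamma> by measurable
    qed
    have "(\<integral>\<^sup>+\<omega>. ?f \<omega> * indicator B \<omega> \<partial>M) = (\<integral>\<^sup>+w. ?f (X w) * indicator B (X w) \<partial>total_law)"
      by (intro nn_integral_M borel_measurable_times_ennreal borel_measurable_indicator F B')
    also have "\<dots> = (\<integral>\<^sup>+w. J (initial_part k w) (piece w (Suc k) 0) \<partial>total_law)"
    proof (rule nn_integral_cong_AE)
      show "AE w in total_law. ?f (X w) * indicator B (X w) = J (initial_part k w) (piece w (Suc k) 0)"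
        using AE_regular
      proof eventually_elim
        case (elim w)
        then show ?case
          using X_mem_past[OF B elim] X_in_space[OF elim] value_at_X[OF elim, of k]
          by (auto simp: J_def pasted_initial_part T_initial_part \<tau>_X indicator_def)
      qed
    qed
    also have "\<dots> = (\<integral>\<^sup>+w. \<integral>\<^sup>+v. \<integral>\<^sup>+f. J (initial_part k w) v \<partial>modified k v \<partial>jump k (initial_part k w) \<partial>total_law)"
      using nn_integral_next_start[OF J] .
    also have "\<dots> = (\<integral>\<^sup>+w. g (X w) * indicator B (X w) \<partial>total_law)"
    proof (rule nn_integral_cong_AE)
      show "AE w in total_law. (\<integral>\<^sup>+v. \<integral>\<^sup>+f. J (initial_part k w) v \<partial>modified k v \<partial>jump k (initial_part k w)) =
          g (X w) * indicator B (X w)"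
        using AE_regular
      proof eventually_elim
        case (elim w)
        then have "initial_part k w \<in> space (initial_space k)"
          by (simp add: regular_def measurable_space[OF measurable_initial_part_product])
        then have s: "sets (jump k (initial_part k w)) = sets borel"
          using space_prob_algebraD(2)[OF jump_in] by simp
        have gX: "g (X w) = g (pasted_path \<tau> k w)"
          by (rule policy_past_fun_agree[OF g _ agree_X_\<tau>[OF elim] pasted_in_space[OF elim] X_in_space[OF elim]]) simp
        have j: "jump k (initial_part k w) = ?L (pasted_path \<tau> k w)"
          by (simp add: jump_kernel_eq pasted_initial_part[OF elim])
        have "(\<integral>\<^sup>+v. \<integral>\<^sup>+f. J (initial_part k w) v \<partial>modified k v \<partial>jump k (initial_part k w)) =
            (\<integral>\<^sup>+v. indicator B (pasted_path \<tau> k w) * indicator {w. T w (Suc k) < \<infinity>} w * indicator \<Gamma> v \<partial>jump k (initial_part k w))"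
          using prob_space.emeasure_space_1[OF space_prob_algebraD(1)[OF modified_in]]
          by (simp add: J_def pasted_initial_part[OF elim] T_initial_part[OF elim] indicator_def)
        also have "\<dots> = indicator B (pasted_path \<tau> k w) * indicator {w. T w (Suc k) < \<infinity>} w * emeasure (jump k (initial_part k w)) \<Gamma>"
          using \<Gamma> s by (subst nn_integral_cmult[OF measurable_sets_eq[OF borel_measurable_indicator[OF \<Gamma>] s]]) simp
        also have "\<dots> = g (X w) * indicator B (X w)"
          using X_mem_past[OF B elim] unfolding gX j
          by (simp add: g_def jump_time_Suc indicator_def)
        finally show ?case .
      qed
    qed
    also have "\<dots> = (\<integral>\<^sup>+\<omega>. g \<omega> * indicator B \<omega> \<partial>M)"
      by (rule nn_integral_M[symmetric])
        (use measurable_policy_past_aug_space[OF _ g] B' in measurable)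
    finally show "(\<integral>\<^sup>+\<omega>\<in>B. ?f \<omega> \<partial>M) = (\<integral>\<^sup>+\<omega>\<in>B. g \<omega> \<partial>M)" .
  qed
  then show "AE \<omega> in M. \<omega> \<in> ?A \<longrightarrow> nn_cond_exp M ?G (indicator {\<omega> \<in> ?A. snd \<omega> (enn2real (\<tau> (Suc k) \<omega>)) \<in> \<Gamma>}) \<omega> =
      emeasure (Q (left_limit \<omega> (\<tau> (Suc k) \<omega>), Z (Suc k) \<omega>)) \<Gamma>"
    by eventually_elim (auto simp: g_def jump_law_def value_at_def)
qed

text \<open>The event is decided by the earlier pieces and piece \<open>?m\<close>, and the
  conditioning by the earlier pieces and the starting value of piece \<open>?m\<close>. Given the
  latter data, the piece has the law \<open>modified k\<close> from its starting value.\<close>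

theorem fundamental_later: "fundamental_between P \<tau> M (Suc (Suc k))"
proof -
  let ?m = "Suc k"
  let ?G = "policy_present \<tau> ?m"
  note measurable_\<tau>[of "Suc k", measurable] measurable_\<tau>[of "Suc (Suc k)", measurable]
    measurable_value_at[of "Suc k", measurable]
  have "AE \<omega> in M. \<tau> ?m \<omega> < \<infinity> \<longrightarrow>
      nn_cond_exp M ?G (indicator {\<omega> \<in> space aug_space. \<tau> ?m \<omega> < \<infinity> \<and>
        \<tau> (Suc ?m) \<omega> - \<tau> ?m \<omega> > ennreal (t n) \<and> (\<forall>i\<in>{1..n}. snd \<omega> (enn2real (\<tau> ?m \<omega>) + t i) \<in> B i)}) \<omega> =
      emeasure (P (snd \<omega> (enn2real (\<tau> ?m \<omega>)))) (between_event ?m n t B \<omega>)"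
    if n: "n \<ge> 1" and t: "0 \<le> t 1" "strict_mono_on {1..n} t" and B: "\<forall>i\<in>{1..n}. B i \<in> sets borel"
    for n :: nat and t :: "nat \<Rightarrow> real" and B :: "nat \<Rightarrow> 'e set"
  proof -
    have t': "0 \<le> t i" "t i \<le> t n" if "i \<in> {1..n}" for i
      using that t n strict_mono_on_leD[OF t(2), of 1 i] strict_mono_on_leD[OF t(2), of i n] by auto
    let ?E = "{\<omega> \<in> space aug_space. \<tau> ?m \<omega> < \<infinity> \<and>
        \<tau> (Suc ?m) \<omega> - \<tau> ?m \<omega> > ennreal (t n) \<and> (\<forall>i\<in>{1..n}. snd \<omega> (enn2real (\<tau> ?m \<omega>) + t i) \<in> B i)}"
    let ?b = "between_event ?m n t B"
    have E: "?E \<in> sets aug_space"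
    proof -
      have 1: "{\<omega> \<in> space aug_space. \<forall>i\<in>{1..n}. snd \<omega> (enn2real (\<tau> ?m \<omega>) + t i) \<in> B i} \<in> sets aug_space"
        by (rule sets_Collect_Ball_in[OF measurable_path_eval_random[OF measurable_aug_snd]]) (use t' B in auto)
      have 2: "{\<omega> \<in> space aug_space. \<tau> ?m \<omega> < \<infinity> \<and> \<tau> (Suc ?m) \<omega> - \<tau> ?m \<omega> > ennreal (t n)} \<in> sets aug_space"
        by measurable
      have "?E = {\<omega> \<in> space aug_space. \<forall>i\<in>{1..n}. snd \<omega> (enn2real (\<tau> ?m \<omega>) + t i) \<in> B i} \<inter>
          {\<omega> \<in> space aug_space. \<tau> ?m \<omega> < \<infinity> \<and> \<tau> (Suc ?m) \<omega> - \<tau> ?m \<omega> > ennreal (t n)}" by blast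
      then show ?thesis
        using sets.Int[OF 1 2] by (simp only:)
    qed
    have b: "(SIGMA \<omega>:space ?G. ?b \<omega>) \<in> sets (?G \<Otimes>\<^sub>M path_space)"
      by (rule sets_between_event_present) (use t' B in auto)
    \<comment> \<open>If the waiting time exceeds \<open>t n\<close>, all sampled times precede the
      next jump and the controlled path shows piece \<open>?m\<close> there. Splicing this piece to
      the pasted path gives the next pasted path, at which \<open>\<tau> (Suc ?m)\<close> takes its
      actual value.\<close>
    have mE: "X w \<in> ?E \<longleftrightarrow> piece w ?m \<in> ?b (pasted_path \<tau> k w)" if w: "regular w" and fin: "T w ?m < \<infinity>" for w
    proof -
      have \<tau>: "\<tau> ?m (X w) = T w ?m" "\<tau> (Suc ?m) (X w) = T w (Suc ?m)" "\<tau> ?m (pasted_path \<tau> k w) = T w ?m"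
        using \<tau>_X[OF w] by (simp_all add: jump_time_Suc)
      have s: "splice (pasted_path \<tau> k w) (enn2real (T w ?m)) (piece w ?m) = pasted_path \<tau> ?m w"
        using fin by (simp add: pasted_path_Suc[OF good_pieces_regular[OF w]])
      have "piece w ?m \<in> cadlag_paths"
        using good_pieces_regular[OF w, of ?m] by (simp add: good_pieces_def)
      moreover have "snd (X w) (enn2real (T w ?m) + t i) = piece w ?m (t i)"
        if "ennreal (t n) < T w (Suc ?m) - T w ?m" and i: "i \<in> {1..n}" for i
      proof (rule snd_X[OF w t'(1)[OF i] fin])
        obtain r where r: "T w ?m = ennreal r" "r \<ge> 0"
          using fin by (cases "T w ?m") auto
        have "ennreal (t i) < T w (Suc ?m) - T w ?m"
          using ennreal_leI[OF t'(2)[OF i]] that(1) by (rule le_less_trans)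
        then have "T w ?m + ennreal (t i) < T w (Suc ?m)"
          using fin by (simp add: less_diff_eq_ennreal add.commute)
        then show "ennreal (enn2real (T w ?m) + t i) < T w (Suc ?m)"
          using r t'(1)[OF i] by (simp add: ennreal_plus)
      qed
      ultimately show ?thesis
        using fin X_in_space[OF w] by (auto simp: between_event_def \<tau> s jump_time_Suc[of _ _ ?m, symmetric])
    qed
    define g where "g \<omega> = (if \<tau> ?m \<omega> < \<infinity> then emeasure (modified k (if \<tau> ?m \<omega> < \<infinity> then value_at ?m \<omega> else undefined)) (?b \<omega>) else 0)" for \<omega>
    have \<tau>G [measurable]: "\<tau> ?m \<in> ?G \<rightarrow>\<^sub>M borel"
      by (rule measurable_policy_past_present) measurable
    have g: "g \<in> borel_measurable ?G"
    proof -
      have [measurable]: "(\<lambda>\<omega>. emeasure (modified k (if \<tau> ?m \<omega> < \<infinity> then value_at ?m \<omega> else undefined)) (?b \<omega>)) \<in> borel_measurable ?G"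
        by (rule emeasure_measurable_subprob_algebra2[OF b
              measurable_compose[OF measurable_value_at_present measurable_prob_algebraD[OF measurable_modify]]])
      show ?thesis
        unfolding g_def by measurable
    qed
    interpret G: sigma_finite_subalgebra M ?G
      by (rule sigma_finite_subalgebra_M) (use sets_policy_present_aug_space[of ?m] in simp_all)
    have "AE \<omega> in M. g \<omega> = nn_cond_exp M ?G (indicator ?E) \<omega>"
    proof (rule G.nn_cond_exp_charact[OF _ _ g])
      show "indicator ?E \<in> borel_measurable M"
        by (rule measurable_sets_eq[OF borel_measurable_indicator[OF E] sets_M])
      fix D assume D: "D \<in> sets ?G"
      have D': "D \<in> sets aug_space"
        using D sets_policy_present_aug_space[of ?m] by auto
      \<comment> \<open>Membership in \<open>D\<close> must be expressed by the earlier pieces and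
        the starting value alone. The unknown continuation is replaced by the constant path with
        that value, a change that events of the present do not notice.\<close>
      let ?c = "\<lambda>w v. splice (pasted_path \<tau> k w) (enn2real (T w ?m)) (\<lambda>s\<in>{0..}. v)"
      define J where "J w v f = (indicator {w. T w ?m < \<infinity>} w * indicator D (?c w v) * indicator (?b (pasted_path \<tau> k w)) f :: ennreal)" for w v f
      let ?N = "initial_space k \<Otimes>\<^sub>M borel \<Otimes>\<^sub>M path_space :: ('e pieces \<times> 'e \<times> 'e path) measure"
      have J: "(\<lambda>(w, v, f). J w v f) \<in> borel_measurable ?N"
      proof -
        have [measurable]: "(\<lambda>x. indicator {w. T w ?m < \<infinity>} (fst x) :: ennreal) \<in> borel_measurable ?N"
          using measurable_compose[OF measurable_fst measurable_T_initial[of k]] unfolding indicator_def by measurable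
        have p: "(\<lambda>x. pasted_path \<tau> k (fst x)) \<in> ?N \<rightarrow>\<^sub>M aug_space"
          by (rule measurable_compose[OF measurable_fst measurable_pasted_initial])
        have "(\<lambda>x. ?c (fst x) (fst (snd x))) \<in> ?N \<rightarrow>\<^sub>M aug_space"
        proof (rule measurable_splice)
          show "(\<lambda>x. fst (pasted_path \<tau> k (fst x))) \<in> ?N \<rightarrow>\<^sub>M borel"
            by (rule measurable_compose[OF p measurable_aug_fst])
          show "snd (pasted_path \<tau> k (fst x)) \<in> cadlag_paths" if "x \<in> space ?N" for x
            using measurable_space[OF p that] by (simp add: space_aug_space)
          show "(\<lambda>x. snd (pasted_path \<tau> k (fst x)) s) \<in> restrict_space ?N {x. s < enn2real (T (fst x) ?m)} \<rightarrow>\<^sub>M borel" if "0 \<le> s" for s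
            by (rule measurable_restrict_space1, rule measurable_compose[OF p],
                rule measurable_compose[OF measurable_aug_snd measurable_path_space_eval[OF that]])
          show "(\<lambda>x. enn2real (T (fst x) ?m)) \<in> borel_measurable ?N"
            using measurable_compose[OF measurable_fst measurable_T_initial[of k]] by measurable
          show "(\<lambda>x. \<lambda>s\<in>{0..}. fst (snd x)) \<in> ?N \<rightarrow>\<^sub>M path_space"
            unfolding path_space_def by (rule measurable_path_sigmaI) (auto simp: const_cadlag)
        qed
        then have [measurable]: "(\<lambda>x. indicator D (?c (fst x) (fst (snd x))) :: ennreal) \<in> borel_measurable ?N"
          using borel_measurable_indicator[OF D'] by (rule measurable_compose)
        have "sets ?G \<subseteq> sets aug_space"
          by (rule sets_policy_present_aug_space) simp
        then have idG: "(\<lambda>\<omega>. \<omega>) \<in> aug_space \<rightarrow>\<^sub>M ?G"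
          by (intro measurableI) auto
        have "(\<lambda>x. (pasted_path \<tau> k (fst x), snd (snd x))) \<in> ?N \<rightarrow>\<^sub>M ?G \<Otimes>\<^sub>M path_space"
          by (rule measurable_Pair[OF measurable_compose[OF p idG]]) measurable
        from measurable_compose[OF this, of "indicator (SIGMA \<omega>:space ?G. ?b \<omega>)" borel] b
        have "(\<lambda>x. indicator (SIGMA \<omega>:space ?G. ?b \<omega>) (pasted_path \<tau> k (fst x), snd (snd x)) :: ennreal) \<in> borel_measurable ?N"
          by simp
        moreover have "indicator (SIGMA \<omega>:space ?G. ?b \<omega>) (pasted_path \<tau> k (fst x), snd (snd x)) =
            (indicator (?b (pasted_path \<tau> k (fst x))) (snd (snd x)) :: ennreal)" if "x \<in> space ?N" for x
          using measurable_space[OF p that] by (simp add: indicator_def)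
        ultimately have [measurable]: "(\<lambda>x. indicator (?b (pasted_path \<tau> k (fst x))) (snd (snd x)) :: ennreal) \<in> borel_measurable ?N"
          by (subst (asm) measurable_cong)
        show ?thesis
          unfolding J_def split_beta' by measurable
      qed
      \<comment> \<open>The time is unchanged because the paths agree before it, and both have the
        starting value of piece \<open>?m\<close> at that time.\<close>
      have mD: "X w \<in> D \<longleftrightarrow> ?c (initial_part k w) (piece w ?m 0) \<in> D" if w: "regular w" and fin: "T w ?m < \<infinity>" for w
      proof -
        obtain r where r: "T w ?m = ennreal r" "r \<ge> 0"
          using fin by (cases "T w ?m") auto
        have c: "?c (initial_part k w) (piece w ?m 0) = splice (pasted_path \<tau> k w) r (\<lambda>s\<in>{0..}. piece w ?m 0)"
          using r by (simp add: pasted_initial_part[OF w] T_initial_part[OF w])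
        let ?a = "splice (pasted_path \<tau> k w) r (\<lambda>s\<in>{0..}. piece w ?m 0)"
        have sp: "?a \<in> space aug_space"
          using splice_cadlag[OF _ const_cadlag] pasted_in_space[OF w, of k] by (simp add: space_aug_space)
        have ap: "agree_before (T w ?m) (pasted_path \<tau> k w) ?a"
          unfolding r by (rule agree_before_splice)
        then have \<tau>a: "\<tau> ?m ?a = T w ?m"
          using \<tau>_agree[of ?m "pasted_path \<tau> k w" ?a] pasted_in_space[OF w] sp by (simp add: jump_time_Suc)
        have "agree_before (\<tau> ?m (X w)) (X w) ?a"
          using agree_before_trans[OF agree_X[OF w, of k, unfolded agree_before_sym[of _ "pasted_path \<tau> k w"]] ap] by (simp add: \<tau>_X[OF w])
        moreover have "value_at ?m (X w) = value_at ?m ?a"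
          unfolding value_at_X[OF w fin] using r by (simp add: value_at_def \<tau>a snd_splice)
        ultimately show ?thesis
          unfolding c by (intro agree_policy_present[OF D] X_in_space[OF w] sp) simp_all
      qed
      have "(\<integral>\<^sup>+\<omega>. indicator ?E \<omega> * indicator D \<omega> \<partial>M) = (\<integral>\<^sup>+w. indicator ?E (X w) * indicator D (X w) \<partial>total_law)"
        by (intro nn_integral_M borel_measurable_times_ennreal borel_measurable_indicator E D')
      also have "\<dots> = (\<integral>\<^sup>+w. J (initial_part k w) (piece w ?m 0) (piece w ?m) \<partial>total_law)"
      proof (rule nn_integral_cong_AE)
        show "AE w in total_law. indicator ?E (X w) * indicator D (X w) = J (initial_part k w) (piece w ?m 0) (piece w ?m)"
          using AE_regular
        proof eventually_elim
          case (elim w)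
          show ?case
          proof (cases "T w ?m < \<infinity>")
            case True
            have "indicator D (X w) = (indicator D (?c (initial_part k w) (piece w ?m 0)) :: ennreal)"
              using mD[OF elim True] by (simp only: indicator_def)
            moreover have "indicator ?E (X w) = (indicator (?b (pasted_path \<tau> k w)) (piece w ?m) :: ennreal)"
              using mE[OF elim True] by (simp only: indicator_def)
            ultimately show ?thesis
              using True unfolding J_def by (simp add: T_initial_part[OF elim] pasted_initial_part[OF elim] mult.commute)
          next
            case False
            then have "X w \<notin> ?E" using \<tau>_X[OF elim, of k] by simp
            then have "indicator ?E (X w) = (0 :: ennreal)"
              by (rule indicator_simps(2))
            moreover have "indicator {w. T w ?m < \<infinity>} (initial_part k w) = (0 :: ennreal)"
              using False by (simp add: T_initial_part[OF elim])
            ultimately show ?thesis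
              unfolding J_def by (simp only: mult_zero_left)
          qed
        qed
      qed
      \<comment> \<open>Here the law of the piece enters: the piece is integrated out while the
        earlier pieces and its starting value are kept, which is exactly the information in the
        present.\<close>
      also have "\<dots> = (\<integral>\<^sup>+w. \<integral>\<^sup>+f. J (initial_part k w) (piece w ?m 0) f \<partial>modified k (piece w ?m 0) \<partial>total_law)"
        by (rule nn_integral_given_start[OF J])
      also have "\<dots> = (\<integral>\<^sup>+w. g (X w) * indicator D (X w) \<partial>total_law)"
      proof (rule nn_integral_cong_AE)
        show "AE w in total_law. (\<integral>\<^sup>+f. J (initial_part k w) (piece w ?m 0) f \<partial>modified k (piece w ?m 0)) = g (X w) * indicator D (X w)"
          using AE_regular
        proof eventually_elim
          case (elim w)
          show ?case
          proof (cases "T w ?m < \<infinity>")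
            case True
            let ?d = "indicator D (?c (initial_part k w) (piece w ?m 0)) :: ennreal"
            have bX: "?b (X w) = ?b (pasted_path \<tau> k w)"
              by (rule between_event_agree[OF _ agree_X_\<tau>[OF elim] _ pasted_in_space[OF elim] X_in_space[OF elim]])
                (use True in \<open>simp_all add: jump_time_Suc\<close>)
            have "Pair (pasted_path \<tau> k w) -` (SIGMA \<omega>:space ?G. ?b \<omega>) = ?b (pasted_path \<tau> k w)"
              using pasted_in_space[OF elim, of k] by auto
            then have "?b (pasted_path \<tau> k w) \<in> sets path_space"
              using sets_Pair1[OF b, of "pasted_path \<tau> k w"] by simp
            then have bs: "?b (pasted_path \<tau> k w) \<in> sets (modified k (piece w ?m 0))"
              using space_prob_algebraD(2)[OF modified_in] by simp
            have "(\<integral>\<^sup>+f. J (initial_part k w) (piece w ?m 0) f \<partial>modified k (piece w ?m 0)) =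
                (\<integral>\<^sup>+f. ?d * indicator (?b (pasted_path \<tau> k w)) f \<partial>modified k (piece w ?m 0))"
              using True by (simp add: J_def T_initial_part[OF elim] pasted_initial_part[OF elim])
            also have "\<dots> = ?d * emeasure (modified k (piece w ?m 0)) (?b (pasted_path \<tau> k w))"
              using bs by (subst nn_integral_cmult) simp_all
            also have "?d = indicator D (X w)"
              using mD[OF elim True] by (simp only: indicator_def)
            finally show ?thesis
              using True by (simp add: g_def \<tau>_X[OF elim] value_at_X[OF elim] bX mult.commute)
          next
            case False
            then show ?thesis
              by (simp add: J_def T_initial_part[OF elim] g_def \<tau>_X[OF elim])
          qed
        qed
      qed
      also have "\<dots> = (\<integral>\<^sup>+\<omega>. g \<omega> * indicator D \<omega> \<partial>M)"
      proof (rule nn_integral_M[symmetric])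
        have "g \<in> borel_measurable aug_space"
          using g measurable_mono[OF order_refl refl sets_policy_present_aug_space[of ?m] space_policy_present] by auto
        then show "(\<lambda>\<omega>. g \<omega> * indicator D \<omega>) \<in> borel_measurable aug_space"
          using D' by measurable
      qed
      finally show "(\<integral>\<^sup>+\<omega>\<in>D. indicator ?E \<omega> \<partial>M) = (\<integral>\<^sup>+\<omega>\<in>D. g \<omega> \<partial>M)" .
    qed
    then show ?thesis
      using AE_value_at_M[of k]
    proof eventually_elim
      case (elim \<omega>)
      show ?case
      proof
        assume fin: "\<tau> ?m \<omega> < \<infinity>"
        with elim(2) have "modified k (value_at ?m \<omega>) = P (value_at ?m \<omega>)"
          by (simp add: modify_def)
        with elim(1) fin show "nn_cond_exp M ?G (indicator ?E) \<omega> = emeasure (P (snd \<omega> (enn2real (\<tau> ?m \<omega>)))) (?b \<omega>)"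
          by (simp add: g_def value_at_def)
      qed
    qed
  qed
  then show ?thesis
    unfolding fundamental_between_def between_event_def by simp
qed

end

theorem corollary3p5:
  fixes P :: "'e::polish_space \<Rightarrow> 'e path measure"
    and S :: "'z measure"
    and Q :: "'e \<times> 'z \<Rightarrow> 'e measure"
    and ebar :: 'e and zbar :: 'z
    and \<tau> :: "nat \<Rightarrow> 'e \<times> 'e path \<Rightarrow> ennreal"
    and Z :: "nat \<Rightarrow> 'e \<times> 'e path \<Rightarrow> 'z"
    and \<nu> :: "'e measure"
  assumes markov: "markov_family P"
    and continuous_support: "\<And>x. AE \<omega> in P x. continuous_on {0..} \<omega>"
    and Q: "Q \<in> borel \<Otimes>\<^sub>M S \<rightarrow>\<^sub>M prob_algebra borel"
    and zbar: "zbar \<in> space S"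
    and policy: "nominal_impulse_policy S \<tau> Z"
    and nonexplosive: "nonexplosive P Q ebar zbar \<tau> Z"
    and \<nu>: "prob_space \<nu>" "sets \<nu> = sets borel"
  shows "let P\<nu> = initial_controlled_law P Q ebar zbar \<tau> Z \<nu> in
    distr P\<nu> borel fst = \<nu> \<and>
    (\<forall>k\<ge>1.
      fundamental_between P \<tau> P\<nu> k \<and>
      regular_cond_distr_on P\<nu> (policy_past \<tau> k) {\<omega> \<in> space aug_space. \<tau> k \<omega> < \<infinity>}
        (\<lambda>\<omega>. snd \<omega> (enn2real (\<tau> k \<omega>))) borel
        (\<lambda>\<omega>. Q (left_limit \<omega> (\<tau> k \<omega>), Z k \<omega>)))"
proof -
  interpret nonexplosive_process S \<tau> Z P Q ebar zbar \<nu>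
    by (intro nonexplosive_process.intro controlled_process.intro impulse_policy.intro
        controlled_process_axioms.intro nonexplosive_process_axioms.intro policy markov Q \<nu> nonexplosive)
  have M: "initial_controlled_law P Q ebar zbar \<tau> Z \<nu> = M"
    by (simp add: M_def initial_controlled_law_eq)
  have "fundamental_between P \<tau> M k \<and>
      regular_cond_distr_on M (policy_past \<tau> k) {\<omega> \<in> space aug_space. \<tau> k \<omega> < \<infinity>}
        (\<lambda>\<omega>. snd \<omega> (enn2real (\<tau> k \<omega>))) borel
        (\<lambda>\<omega>. Q (left_limit \<omega> (\<tau> k \<omega>), Z k \<omega>))" if k: "k \<ge> 1" for k
  proof -
    obtain j where j: "k = Suc j"
      using k by (cases k) auto
    have "fundamental_between P \<tau> M (Suc j)"
      using fundamental_first fundamental_later by (cases j) simp_all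
    with jump_distribution[of j] show ?thesis
      by (simp add: j)
  qed
  then show ?thesis
    unfolding M Let_def using distr_M_fst by blast
qed

end
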